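(* Let $A$ and $B$ be unital C*-algebras such that there are unital $*$-homomorphisms $\varphi:A\to B$ and $\psi:B\to A$. Then $A$ has a maximal UHF-subalgebra if and only if $B$ does. In this case, $MU(A)\cong MU(B)$.
   Context: UHF-algebra: a C*-algebra isomorphic to the inductive limit of a sequence $\mathrm{M}_{k_1}\to \mathrm{M}_{k_2}\to\cdots$ of full matrix algebras with unital connecting maps and $k_i\mid k_{i+1}$ (so $\mathbb{C}$ and all $\mathrm{M}_k$ are included). A UHF C*-subalgebra $B$ of a unital C*-algebra $A$ is a maximal UHF-subalgebra of $A$ if $1_B=1_A$ and for every UHF C*-subalgebra $D$ of $A$ with $1_D=1_A$ there exists a unital embedding $D\to B$. If it exists it is unique up to isomorphism and is denoted $MU(A)$. *)

theory Defs
  imports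
    "HOL-Analysis.Analysis"
    "HOL-Algebra.Subrings"
    "HOL-Algebra.QuotRing"
    "HOL-Algebra.Module"
    "Jordan_Normal_Form.Schur_Decomposition"
begin

section \<open>Unital C*-algebras\<close>

definition complex_ring :: "complex ring" where
  "complex_ring = \<lparr>carrier = UNIV, mult = (*), one = 1, zero = 0, add = (+)\<rparr>"

record 'a cstar = "(complex, 'a) module" +
  star :: "'a \<Rightarrow> 'a"
  cnorm :: "'a \<Rightarrow> real"

text \<open>
  The distance is set to 0 off the carrier because \<^locale>\<open>Metric_space\<close> demands
  non-negativity and symmetry on the whole type.
\<close>
definition cstar_dist :: "'a cstar \<Rightarrow> 'a \<Rightarrow> 'a \<Rightarrow> real" where
  "cstar_dist A x y =
     (if x \<in> carrier A \<and> y \<in> carrier A then cnorm A (x \<ominus>\<^bsub>A\<^esub> y) else 0)"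

definition cstar_topology :: "'a cstar \<Rightarrow> 'a topology" where
  "cstar_topology A = Metric_space.mtopology (carrier A) (cstar_dist A)"

text \<open>The zero algebra is admitted as a unital C*-algebra.\<close>
locale unital_cstar_algebra =
  ring A + module complex_ring A for A :: "'a cstar" (structure) +
  assumes smult_mult_left:
      "\<lbrakk>x \<in> carrier A; y \<in> carrier A\<rbrakk> \<Longrightarrow> (c \<odot> x) \<otimes> y = c \<odot> (x \<otimes> y)"
    and smult_mult_right:
      "\<lbrakk>x \<in> carrier A; y \<in> carrier A\<rbrakk> \<Longrightarrow> x \<otimes> (c \<odot> y) = c \<odot> (x \<otimes> y)"
    and star_closed: "x \<in> carrier A \<Longrightarrow> star A x \<in> carrier A"
    and star_star: "x \<in> carrier A \<Longrightarrow> star A (star A x) = x"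
    and star_add:
      "\<lbrakk>x \<in> carrier A; y \<in> carrier A\<rbrakk> \<Longrightarrow> star A (x \<oplus> y) = star A x \<oplus> star A y"
    and star_smult: "x \<in> carrier A \<Longrightarrow> star A (c \<odot> x) = cnj c \<odot> star A x"
    and star_mult:
      "\<lbrakk>x \<in> carrier A; y \<in> carrier A\<rbrakk> \<Longrightarrow> star A (x \<otimes> y) = star A y \<otimes> star A x"
    and cnorm_nonneg: "x \<in> carrier A \<Longrightarrow> 0 \<le> cnorm A x"
    and cnorm_eq_zero_iff: "x \<in> carrier A \<Longrightarrow> cnorm A x = 0 \<longleftrightarrow> x = \<zero>"
    and cnorm_smult: "x \<in> carrier A \<Longrightarrow> cnorm A (c \<odot> x) = cmod c * cnorm A x"
    and cnorm_triangle:
      "\<lbrakk>x \<in> carrier A; y \<in> carrier A\<rbrakk> \<Longrightarrow> cnorm A (x \<oplus> y) \<le> cnorm A x + cnorm A y"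
    and cnorm_mult:
      "\<lbrakk>x \<in> carrier A; y \<in> carrier A\<rbrakk> \<Longrightarrow> cnorm A (x \<otimes> y) \<le> cnorm A x * cnorm A y"
    and cstar_identity: "x \<in> carrier A \<Longrightarrow> cnorm A (star A x \<otimes> x) = (cnorm A x)\<^sup>2"
    and complete: "Metric_space.mcomplete (carrier A) (cstar_dist A)"

definition unital_star_hom :: "'a cstar \<Rightarrow> 'b cstar \<Rightarrow> ('a \<Rightarrow> 'b) \<Rightarrow> bool" where
  "unital_star_hom A B h \<longleftrightarrow>
     h \<in> Ring.ring_hom A B \<and>
     (\<forall>c. \<forall>x\<in>carrier A. h (c \<odot>\<^bsub>A\<^esub> x) = c \<odot>\<^bsub>B\<^esub> h x) \<and>
     (\<forall>x\<in>carrier A. h (star A x) = star B (h x))"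

definition unital_embedding :: "'a cstar \<Rightarrow> 'b cstar \<Rightarrow> ('a \<Rightarrow> 'b) \<Rightarrow> bool" where
  "unital_embedding A B h \<longleftrightarrow> unital_star_hom A B h \<and> inj_on h (carrier A)"

definition cstar_isomorphic :: "'a cstar \<Rightarrow> 'b cstar \<Rightarrow> bool" where
  "cstar_isomorphic A B \<longleftrightarrow>
     (\<exists>h. unital_star_hom A B h \<and> bij_betw h (carrier A) (carrier B))"

text \<open>\<^const>\<open>subring\<close> already requires the unit of \<open>A\<close> to lie in \<open>D\<close>.\<close>
definition unital_cstar_subalgebra :: "'a set \<Rightarrow> 'a cstar \<Rightarrow> bool" where
  "unital_cstar_subalgebra D A \<longleftrightarrow>
     subring D A \<and>
     (\<forall>c. \<forall>x\<in>D. c \<odot>\<^bsub>A\<^esub> x \<in> D) \<and>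
     (\<forall>x\<in>D. star A x \<in> D) \<and>
     closedin (cstar_topology A) D"

section \<open>Inductive limits of sequences\<close>

text \<open>The algebra of bounded sequences with the supremum norm.\<close>
definition cstar_prod :: "(nat \<Rightarrow> 'a cstar) \<Rightarrow> (nat \<Rightarrow> 'a) cstar" where
  "cstar_prod A =
     \<lparr>carrier = {x. (\<forall>n. x n \<in> carrier (A n)) \<and> bdd_above (range (\<lambda>n. cnorm (A n) (x n)))},
      mult = (\<lambda>x y n. x n \<otimes>\<^bsub>A n\<^esub> y n),
      one = (\<lambda>n. \<one>\<^bsub>A n\<^esub>),
      zero = (\<lambda>n. \<zero>\<^bsub>A n\<^esub>),
      add = (\<lambda>x y n. x n \<oplus>\<^bsub>A n\<^esub> y n),
      smult = (\<lambda>c x n. c \<odot>\<^bsub>A n\<^esub> x n),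
      star = (\<lambda>x n. star (A n) (x n)),
      cnorm = (\<lambda>x. SUP n. cnorm (A n) (x n))\<rparr>"

definition null_sequences :: "(nat \<Rightarrow> 'a cstar) \<Rightarrow> (nat \<Rightarrow> 'a) set" where
  "null_sequences A =
     {x \<in> carrier (cstar_prod A). (\<lambda>n. cnorm (A n) (x n)) \<longlonglongrightarrow> 0}"

definition cstar_quot :: "'a cstar \<Rightarrow> 'a set \<Rightarrow> 'a set cstar" where
  "cstar_quot A I =
     \<lparr>carrier = carrier (A Quot I),
      mult = mult (A Quot I),
      one = one (A Quot I),
      zero = zero (A Quot I),
      add = add (A Quot I),
      smult = (\<lambda>c X. \<Union>x\<in>X. I +>\<^bsub>A\<^esub> (c \<odot>\<^bsub>A\<^esub> x)),
      star = (\<lambda>X. \<Union>x\<in>X. I +>\<^bsub>A\<^esub> star A x),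
      cnorm = (\<lambda>X. INF x\<in>X. cnorm A x)\<rparr>"

text \<open>\<open>connecting \<phi> i n\<close> is the composite \<open>A i \<rightarrow> A (i + n)\<close> of \<open>n\<close> successive maps.\<close>
primrec connecting :: "(nat \<Rightarrow> 'a \<Rightarrow> 'a) \<Rightarrow> nat \<Rightarrow> nat \<Rightarrow> 'a \<Rightarrow> 'a" where
  "connecting \<phi> i 0 = id"
| "connecting \<phi> i (Suc n) = \<phi> (i + n) \<circ> connecting \<phi> i n"

definition limit_map ::
  "(nat \<Rightarrow> 'a cstar) \<Rightarrow> (nat \<Rightarrow> 'a \<Rightarrow> 'a) \<Rightarrow> nat \<Rightarrow> 'a \<Rightarrow> (nat \<Rightarrow> 'a) set" where
  "limit_map A \<phi> i a =
     null_sequences A +>\<^bsub>cstar_prod A\<^esub>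
       (\<lambda>j. if i \<le> j then connecting \<phi> i (j - i) a else \<zero>\<^bsub>A j\<^esub>)"

text \<open>
  The inductive limit of \<open>A 0 \<rightarrow> A 1 \<rightarrow> \<dots>\<close>, realised as usual inside the algebra of
  bounded sequences modulo null sequences: the closure of the union of the images
  of the \<open>A i\<close>.
\<close>
definition inductive_limit ::
  "(nat \<Rightarrow> 'a cstar) \<Rightarrow> (nat \<Rightarrow> 'a \<Rightarrow> 'a) \<Rightarrow> (nat \<Rightarrow> 'a) set cstar" where
  "inductive_limit A \<phi> =
     (let Q = cstar_quot (cstar_prod A) (null_sequences A)
      in Q\<lparr>carrier := cstar_topology Q closure_of (\<Union>i. limit_map A \<phi> i ` carrier (A i))\<rparr>)"

section \<open>UHF-algebras\<close>

definition euclidean_norm :: "complex vec \<Rightarrow> real" where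
  "euclidean_norm v = sqrt (\<Sum>i<dim_vec v. (cmod (v $ i))\<^sup>2)"

definition mat_cstar :: "nat \<Rightarrow> complex mat cstar" where
  "mat_cstar n =
     \<lparr>carrier = carrier_mat n n,
      mult = (*),
      one = 1\<^sub>m n,
      zero = 0\<^sub>m n n,
      add = (+),
      smult = (\<cdot>\<^sub>m),
      star = mat_adjoint,
      cnorm = (\<lambda>a. SUP v\<in>{v \<in> carrier_vec n. euclidean_norm v \<le> 1}.
                     euclidean_norm (a *\<^sub>v v))\<rparr>"

definition UHF_algebra :: "'a cstar \<Rightarrow> bool" where
  "UHF_algebra D \<longleftrightarrow>
     unital_cstar_algebra D \<and>
     (\<exists>k \<phi>. (\<forall>i. 0 < k i \<and> k i dvd k (Suc i)) \<and>
            (\<forall>i. unital_star_hom (mat_cstar (k i)) (mat_cstar (k (Suc i))) (\<phi> i)) \<and>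
            cstar_isomorphic D (inductive_limit (\<lambda>i. mat_cstar (k i)) \<phi>))"

definition UHF_subalgebra :: "'a set \<Rightarrow> 'a cstar \<Rightarrow> bool" where
  "UHF_subalgebra D A \<longleftrightarrow>
     unital_cstar_subalgebra D A \<and> UHF_algebra (A\<lparr>carrier := D\<rparr>)"

definition maximal_UHF_subalgebra :: "'a set \<Rightarrow> 'a cstar \<Rightarrow> bool" where
  "maximal_UHF_subalgebra M A \<longleftrightarrow>
     UHF_subalgebra M A \<and>
     (\<forall>D. UHF_subalgebra D A \<longrightarrow>
        (\<exists>h. unital_embedding (A\<lparr>carrier := D\<rparr>) (A\<lparr>carrier := M\<rparr>) h))"

end

theory Submission
  imports Defs
begin

text \<open>
  A unital homomorphism between unital C*-algebras is contractive, and it is isometric on a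
  UHF-subalgebra as long as the target is not zero. Hence \<open>\<phi>\<close> maps a UHF-subalgebra of \<open>A\<close>
  isomorphically onto a UHF-subalgebra of \<open>B\<close>, and so does \<open>\<psi>\<close> in the other direction. If \<open>M\<close> is
  maximal in \<open>A\<close> and \<open>D\<close> is a UHF-subalgebra of \<open>B\<close>, then \<open>\<psi>(D)\<close> embeds into \<open>M\<close>, so \<open>D\<close> embeds
  into \<open>\<phi>(M)\<close>; thus \<open>\<phi>(M)\<close> is maximal in \<open>B\<close>. If \<open>M\<close> and \<open>N\<close> are maximal in \<open>A\<close> and in \<open>B\<close>, the same
  reasoning gives unital homomorphisms \<open>M \<rightarrow> N\<close> and \<open>N \<rightarrow> M\<close>, and it remains to see that
  UHF-algebras which map unitally into each other are isomorphic (Glimm).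

  Contractivity has an elementary proof: a self-adjoint element of norm less than one is a mean of two
  unitaries (\<open>selfadjoint_mean_of_unitaries\<close>, through a square root obtained from Banach's
  fixed point theorem), and unitaries go to unitaries. It needs completeness of the source only;
  therefore most of the text is about algebras satisfying all axioms except completeness, such as
  bounded sequences modulo null sequences, which contain the inductive limits. Contractivity turns an
  abstract isomorphism with an inductive limit into a tower of matrix subalgebras with dense union
  (\<open>UHF_algebra_imp_tower\<close>). On a matrix algebra a unital homomorphism into a nonzero algebra is
  isometric, because \<open>(a p)\<^sup>* (a p) = \<parallel>a v\<parallel>\<^sup>2 p\<close> for the rank-one projection \<open>p\<close> onto a unit vector \<open>v\<close>
  (\<open>hom_mat_isometric\<close>); by density this extends to UHF-algebras.

  For Glimm's theorem, the normalised traces of the matrix algebras of a tower extend to its closure.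
  If \<open>M\<^sub>m\<close> maps unitally into a tower with matrix sizes \<open>k j\<close>, then a minimal projection of \<open>M\<^sub>m\<close> has
  trace \<open>1 / m\<close> and is similar to a nearby projection of some stage, whose trace is an integer over
  \<open>k j\<close>; so \<open>m\<close> divides \<open>k j\<close> (\<open>tower_hom_imp_dvd\<close>). Consequently the matrix sizes of the two
  towers divide each other. Projections in a matrix algebra with equal trace are equivalent,
  so two unital homomorphisms between matrix algebras are unitarily equivalent, and every pair of
  unital homomorphisms \<open>M\<^sub>k \<rightarrow> M\<^sub>m\<close>, \<open>M\<^sub>k \<rightarrow> M\<^sub>n\<close> with \<open>m\<close> dividing \<open>n\<close> is completed by a unital
  homomorphism \<open>M\<^sub>m \<rightarrow> M\<^sub>n\<close> (\<open>matrix_hom_extension\<close>). Extending partial isomorphisms alternately on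
  the left and on the right gives an isometric isomorphism between dense subalgebras, and hence an
  isomorphism (\<open>towers_isomorphic\<close>).
\<close>

section \<open>Normed star-algebras with the C*-identity\<close>

text \<open>All axioms of a unital C*-algebra except completeness.\<close>
locale pre_cstar_algebra =
  Alg?: ring A + module complex_ring A for A :: "'a cstar" (structure) +
  assumes smult_mult_left:
      "\<lbrakk>x \<in> carrier A; y \<in> carrier A\<rbrakk> \<Longrightarrow> (c \<odot> x) \<otimes> y = c \<odot> (x \<otimes> y)"
    and smult_mult_right:
      "\<lbrakk>x \<in> carrier A; y \<in> carrier A\<rbrakk> \<Longrightarrow> x \<otimes> (c \<odot> y) = c \<odot> (x \<otimes> y)"
    and star_closed [simp, intro]: "x \<in> carrier A \<Longrightarrow> star A x \<in> carrier A"
    and star_star [simp]: "x \<in> carrier A \<Longrightarrow> star A (star A x) = x"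
    and star_add:
      "\<lbrakk>x \<in> carrier A; y \<in> carrier A\<rbrakk> \<Longrightarrow> star A (x \<oplus> y) = star A x \<oplus> star A y"
    and star_smult: "x \<in> carrier A \<Longrightarrow> star A (c \<odot> x) = cnj c \<odot> star A x"
    and star_mult:
      "\<lbrakk>x \<in> carrier A; y \<in> carrier A\<rbrakk> \<Longrightarrow> star A (x \<otimes> y) = star A y \<otimes> star A x"
    and cnorm_nonneg [simp]: "x \<in> carrier A \<Longrightarrow> 0 \<le> cnorm A x"
    and cnorm_eq_zero_iff: "x \<in> carrier A \<Longrightarrow> cnorm A x = 0 \<longleftrightarrow> x = \<zero>"
    and cnorm_smult: "x \<in> carrier A \<Longrightarrow> cnorm A (c \<odot> x) = cmod c * cnorm A x"
    and cnorm_triangle: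
      "\<lbrakk>x \<in> carrier A; y \<in> carrier A\<rbrakk> \<Longrightarrow> cnorm A (x \<oplus> y) \<le> cnorm A x + cnorm A y"
    and cnorm_mult:
      "\<lbrakk>x \<in> carrier A; y \<in> carrier A\<rbrakk> \<Longrightarrow> cnorm A (x \<otimes> y) \<le> cnorm A x * cnorm A y"
    and cstar_identity: "x \<in> carrier A \<Longrightarrow> cnorm A (star A x \<otimes> x) = (cnorm A x)\<^sup>2"

lemma unital_cstar_imp_pre_cstar:
  assumes "unital_cstar_algebra A"
  shows "pre_cstar_algebra A"
proof -
  interpret unital_cstar_algebra A by fact
  show ?thesis
    by unfold_locales
      (auto simp: smult_mult_left smult_mult_right star_closed star_star star_add star_smult
        star_mult cnorm_nonneg cnorm_eq_zero_iff cnorm_smult cnorm_triangle cnorm_mult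
        cstar_identity)
qed

lemma complex_ring_simps [simp]:
  "carrier complex_ring = UNIV" "a \<oplus>\<^bsub>complex_ring\<^esub> b = a + b"
  "a \<otimes>\<^bsub>complex_ring\<^esub> b = a * b" "\<one>\<^bsub>complex_ring\<^esub> = 1" "\<zero>\<^bsub>complex_ring\<^esub> = 0"
  by (auto simp: complex_ring_def)

lemma cring_complex_ring: "cring complex_ring"
proof (rule cringI)
  show "abelian_group complex_ring"
  proof (rule abelian_groupI)
    fix x :: complex
    show "\<exists>y\<in>carrier complex_ring. y \<oplus>\<^bsub>complex_ring\<^esub> x = \<zero>\<^bsub>complex_ring\<^esub>"
      by (rule bexI[of _ "- x"]) auto
  qed auto
  show "comm_monoid complex_ring"
    by (rule comm_monoidI) auto
qed (auto simp: algebra_simps)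

lemma complex_ring_uminus [simp]: "\<ominus>\<^bsub>complex_ring\<^esub> a = - a"
proof -
  interpret cring complex_ring by (rule cring_complex_ring)
  have "- a = \<ominus>\<^bsub>complex_ring\<^esub> a"
    by (rule add.inv_equality[symmetric]) auto
  then show ?thesis by simp
qed

context pre_cstar_algebra
begin

lemma smult_in [simp, intro]: "x \<in> carrier A \<Longrightarrow> c \<odot> x \<in> carrier A"
  using smult_closed by simp

lemma smult_add_left: "x \<in> carrier A \<Longrightarrow> (a + b) \<odot> x = a \<odot> x \<oplus> b \<odot> x"
  using smult_l_distr[of a b x] by simp

lemma smult_add_right:
  "\<lbrakk>x \<in> carrier A; y \<in> carrier A\<rbrakk> \<Longrightarrow> a \<odot> (x \<oplus> y) = a \<odot> x \<oplus> a \<odot> y"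
  using smult_r_distr[of a x y] by simp

lemma smult_smult: "x \<in> carrier A \<Longrightarrow> a \<odot> (b \<odot> x) = (a * b) \<odot> x"
  using smult_assoc1[of a b x] by simp

lemma smult_1 [simp]: "x \<in> carrier A \<Longrightarrow> 1 \<odot> x = x"
  using smult_one by simp

lemma smult_0 [simp]: "x \<in> carrier A \<Longrightarrow> 0 \<odot> x = \<zero>"
  using smult_l_null by simp

lemma smult_zero [simp]: "a \<odot> \<zero> = \<zero>"
  using smult_r_null by simp

lemma uminus_eq_smult: "x \<in> carrier A \<Longrightarrow> \<ominus> x = (- 1) \<odot> x"
  using smult_l_minus[of 1 x] by simp

lemma minus_eq_smult: "x \<in> carrier A \<Longrightarrow> y \<in> carrier A \<Longrightarrow> x \<ominus> y = x \<oplus> (- 1) \<odot> y"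
  by (simp add: a_minus_def uminus_eq_smult)

lemma smult_minus_right:
  "\<lbrakk>x \<in> carrier A; y \<in> carrier A\<rbrakk> \<Longrightarrow> a \<odot> (x \<ominus> y) = a \<odot> x \<ominus> a \<odot> y"
  by (simp add: minus_eq_smult smult_add_right smult_smult)

lemma star_minus:
  "\<lbrakk>x \<in> carrier A; y \<in> carrier A\<rbrakk> \<Longrightarrow> star A (x \<ominus> y) = star A x \<ominus> star A y"
  by (simp add: minus_eq_smult star_add star_smult)

lemma star_zero [simp]: "star A \<zero> = \<zero>"
  using star_smult[of \<zero> 0] by simp

lemma star_one [simp]: "star A \<one> = \<one>"
proof -
  have "star A \<one> = star A (star A \<one>) \<otimes> star A \<one>"
    by simp
  also have "\<dots> = star A (\<one> \<otimes> star A \<one>)"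
    by (subst star_mult) auto
  finally show ?thesis by simp
qed

lemma cnorm_zero [simp]: "cnorm A \<zero> = 0"
  by (simp add: cnorm_eq_zero_iff)

lemma cnorm_uminus: "x \<in> carrier A \<Longrightarrow> cnorm A (\<ominus> x) = cnorm A x"
  by (simp add: uminus_eq_smult cnorm_smult)

lemma cnorm_minus_commute:
  "\<lbrakk>x \<in> carrier A; y \<in> carrier A\<rbrakk> \<Longrightarrow> cnorm A (x \<ominus> y) = cnorm A (y \<ominus> x)"
proof -
  assume *: "x \<in> carrier A" "y \<in> carrier A"
  then have "y \<ominus> x = \<ominus> (x \<ominus> y)" by algebra
  then show ?thesis using * by (simp add: cnorm_uminus)
qed

lemma minus_eq_zero_iff: "\<lbrakk>x \<in> carrier A; y \<in> carrier A\<rbrakk> \<Longrightarrow> x \<ominus> y = \<zero> \<longleftrightarrow> x = y"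
  by (rule Alg.r_right_minus_eq)

lemma cnorm_minus_triangle:
  assumes "x \<in> carrier A" "y \<in> carrier A" "z \<in> carrier A"
  shows "cnorm A (x \<ominus> z) \<le> cnorm A (x \<ominus> y) + cnorm A (y \<ominus> z)"
proof -
  have "x \<ominus> z = (x \<ominus> y) \<oplus> (y \<ominus> z)" using assms by algebra
  then show ?thesis using cnorm_triangle[of "x \<ominus> y" "y \<ominus> z"] assms by simp
qed

lemma cnorm_minus_le:
  "\<lbrakk>x \<in> carrier A; y \<in> carrier A\<rbrakk> \<Longrightarrow> cnorm A (x \<ominus> y) \<le> cnorm A x + cnorm A y"
  using cnorm_triangle[of x "\<ominus> y"] by (simp add: a_minus_def cnorm_uminus)

lemma cnorm_diff_le:
  assumes "x \<in> carrier A" "y \<in> carrier A"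
  shows "\<bar>cnorm A x - cnorm A y\<bar> \<le> cnorm A (x \<ominus> y)"
proof -
  have "x = (x \<ominus> y) \<oplus> y" "y = (y \<ominus> x) \<oplus> x" using assms by algebra+
  then have "cnorm A x \<le> cnorm A (x \<ominus> y) + cnorm A y"
    "cnorm A y \<le> cnorm A (y \<ominus> x) + cnorm A x"
    using cnorm_triangle[of "x \<ominus> y" y] cnorm_triangle[of "y \<ominus> x" x] assms by simp_all
  then show ?thesis using cnorm_minus_commute[OF assms] by linarith
qed

lemma cnorm_star [simp]: "x \<in> carrier A \<Longrightarrow> cnorm A (star A x) = cnorm A x"
proof -
  have le: "cnorm A x \<le> cnorm A (star A x)" if "x \<in> carrier A" for x
  proof (cases "cnorm A x = 0")
    case False
    have "(cnorm A x)\<^sup>2 \<le> cnorm A (star A x) * cnorm A x"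
      using cstar_identity[OF that] cnorm_mult[of "star A x" x] that by simp
    then show ?thesis
      using False cnorm_nonneg[OF that] by (simp add: power2_eq_square)
  qed (use that in simp)
  assume "x \<in> carrier A"
  then show ?thesis using le[of x] le[of "star A x"] by simp
qed

lemma cnorm_selfadjoint_unit:
  assumes "p \<in> carrier A" "star A p = p" "p \<otimes> p = p" "p \<noteq> \<zero>"
  shows "cnorm A p = 1"
  using cstar_identity[of p] assms cnorm_eq_zero_iff[of p] by (auto simp: power2_eq_square)

lemma cnorm_one: "\<one> \<noteq> \<zero> \<Longrightarrow> cnorm A \<one> = 1"
  by (rule cnorm_selfadjoint_unit) auto

lemma cnorm_one_le: "cnorm A \<one> \<le> 1"
  using cnorm_one by (cases "\<one> = \<zero>") auto

lemma cnorm_isometry_le: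
  assumes "u \<in> carrier A" "star A u \<otimes> u = \<one>"
  shows "cnorm A u \<le> 1"
  using cstar_identity[of u] assms cnorm_one_le by (simp add: power_le_one_iff)

lemma Metric_space_dist: "Metric_space (carrier A) (cstar_dist A)"
proof
  fix x y z
  show "0 \<le> cstar_dist A x y" by (simp add: cstar_dist_def)
  show "cstar_dist A x y = cstar_dist A y x"
    by (simp add: cstar_dist_def cnorm_minus_commute)
  assume x: "x \<in> carrier A" and y: "y \<in> carrier A"
  show "cstar_dist A x y = 0 \<longleftrightarrow> x = y"
    using x y by (simp add: cstar_dist_def cnorm_eq_zero_iff minus_eq_zero_iff)
  assume z: "z \<in> carrier A"
  show "cstar_dist A x z \<le> cstar_dist A x y + cstar_dist A y z"
    using x y z by (simp add: cstar_dist_def cnorm_minus_triangle)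
qed

lemma closure_of_iff:
  assumes "S \<subseteq> carrier A"
  shows "x \<in> (cstar_topology A) closure_of S \<longleftrightarrow>
    x \<in> carrier A \<and> (\<forall>e>0. \<exists>y\<in>S. cnorm A (x \<ominus> y) < e)"
proof -
  interpret M: Metric_space "carrier A" "cstar_dist A" by (rule Metric_space_dist)
  show ?thesis
    using assms unfolding cstar_topology_def M.metric_closure_of
    by (force simp: M.in_mball cstar_dist_def)
qed

lemma limitin_iff:
  assumes "\<And>n. s n \<in> carrier A"
  shows "limitin (cstar_topology A) s x sequentially \<longleftrightarrow>
    x \<in> carrier A \<and> (\<lambda>n. cnorm A (s n \<ominus> x)) \<longlonglongrightarrow> 0"
proof -
  interpret M: Metric_space "carrier A" "cstar_dist A" by (rule Metric_space_dist)
  show ?thesis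
    using assms unfolding cstar_topology_def M.limitin_metric_dist_null
    by (auto simp: cstar_dist_def)
qed

lemma closedin_iff:
  "closedin (cstar_topology A) S \<longleftrightarrow> S \<subseteq> carrier A \<and>
    (\<forall>s x. (\<forall>n. s n \<in> S) \<and> x \<in> carrier A \<and> (\<lambda>n. cnorm A (s n \<ominus> x)) \<longlonglongrightarrow> 0 \<longrightarrow> x \<in> S)"
proof -
  interpret M: Metric_space "carrier A" "cstar_dist A" by (rule Metric_space_dist)
  show ?thesis
  proof (cases "S \<subseteq> carrier A")
    case True
    then have "range s \<subseteq> S \<and> limitin M.mtopology s x sequentially \<longleftrightarrow>
        (\<forall>n. s n \<in> S) \<and> x \<in> carrier A \<and> (\<lambda>n. cnorm A (s n \<ominus> x)) \<longlonglongrightarrow> 0" for s x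
      using limitin_iff[unfolded cstar_topology_def, of s x] by blast
    then show ?thesis
      unfolding cstar_topology_def M.metric_closedin_iff_sequentially_closed by presburger
  next
    case False
    then show ?thesis
      unfolding cstar_topology_def M.metric_closedin_iff_sequentially_closed by blast
  qed
qed

lemma mcomplete_iff:
  "Metric_space.mcomplete (carrier A) (cstar_dist A) \<longleftrightarrow>
    (\<forall>s. (\<forall>n. s n \<in> carrier A) \<and> (\<forall>e>0. \<exists>N. \<forall>m\<ge>N. \<forall>n\<ge>N. cnorm A (s m \<ominus> s n) < e) \<longrightarrow>
      (\<exists>x\<in>carrier A. (\<lambda>n. cnorm A (s n \<ominus> x)) \<longlonglongrightarrow> 0))"
proof -
  interpret M: Metric_space "carrier A" "cstar_dist A" by (rule Metric_space_dist)
  have 1: "M.MCauchy s \<longleftrightarrow> (\<forall>n. s n \<in> carrier A) \<and>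
      (\<forall>e>0. \<exists>N. \<forall>m\<ge>N. \<forall>n\<ge>N. cnorm A (s m \<ominus> s n) < e)" for s
  proof (cases "\<forall>n. s n \<in> carrier A")
    case True
    then show ?thesis
      unfolding M.MCauchy_def by (simp add: cstar_dist_def image_subset_iff)
  next
    case False
    then show ?thesis unfolding M.MCauchy_def by blast
  qed
  have 2: "(\<exists>x. limitin M.mtopology s x sequentially) \<longleftrightarrow>
      (\<exists>x\<in>carrier A. (\<lambda>n. cnorm A (s n \<ominus> x)) \<longlonglongrightarrow> 0)" if "\<forall>n. s n \<in> carrier A" for s
    using limitin_iff[unfolded cstar_topology_def, of s] that by simp blast
  show ?thesis
    unfolding M.mcomplete_def 1 using 2 by (intro all_cong) auto
qed

lemma limit_unique:
  assumes "\<And>n. s n \<in> carrier A" "x \<in> carrier A" "y \<in> carrier A"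
    "(\<lambda>n. cnorm A (s n \<ominus> x)) \<longlonglongrightarrow> 0" "(\<lambda>n. cnorm A (s n \<ominus> y)) \<longlonglongrightarrow> 0"
  shows "x = y"
proof -
  have "(\<lambda>n. cnorm A (s n \<ominus> x) + cnorm A (s n \<ominus> y)) \<longlonglongrightarrow> 0 + 0"
    by (intro tendsto_add assms)
  moreover have "cnorm A (x \<ominus> y) \<le> cnorm A (s n \<ominus> x) + cnorm A (s n \<ominus> y)" for n
    using cnorm_minus_triangle[of x "s n" y] cnorm_minus_commute[of x "s n"] assms by simp
  ultimately have "cnorm A (x \<ominus> y) \<le> 0"
    by (intro LIMSEQ_le_const[of _ 0]) auto
  then show ?thesis
    using assms cnorm_nonneg[of "x \<ominus> y"] cnorm_eq_zero_iff[of "x \<ominus> y"] minus_eq_zero_iff[of x y]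
    by (metis Alg.minus_closed order_antisym)
qed

end

lemma unital_cstar_algebraI:
  assumes "pre_cstar_algebra A" "Metric_space.mcomplete (carrier A) (cstar_dist A)"
  shows "unital_cstar_algebra A"
proof -
  interpret pre_cstar_algebra A by fact
  show ?thesis
    by unfold_locales
      (auto simp: smult_mult_left smult_mult_right star_add star_smult
        star_mult cnorm_eq_zero_iff cnorm_smult cnorm_triangle cnorm_mult
        cstar_identity assms(2))
qed

text \<open>
  Star-subalgebras with the restricted operations; completeness is the only axiom that a
  subset closed under the operations can fail.
\<close>
definition star_subalgebra :: "'a set \<Rightarrow> 'a cstar \<Rightarrow> bool" where
  "star_subalgebra C A \<longleftrightarrow> C \<subseteq> carrier A \<and> \<one>\<^bsub>A\<^esub> \<in> C \<and> \<zero>\<^bsub>A\<^esub> \<in> C \<and>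
     (\<forall>x\<in>C. \<forall>y\<in>C. x \<oplus>\<^bsub>A\<^esub> y \<in> C \<and> x \<otimes>\<^bsub>A\<^esub> y \<in> C) \<and>
     (\<forall>c. \<forall>x\<in>C. c \<odot>\<^bsub>A\<^esub> x \<in> C) \<and> (\<forall>x\<in>C. star A x \<in> C)"

lemma pre_cstar_subalgebra:
  assumes "pre_cstar_algebra A" "star_subalgebra C A"
  shows "pre_cstar_algebra (A\<lparr>carrier := C\<rparr>)"
proof -
  interpret pre_cstar_algebra A by fact
  note C = assms(2)[unfolded star_subalgebra_def]
  have [simp, dest]: "x \<in> C \<Longrightarrow> x \<in> carrier A" for x using C by auto
  have ag: "abelian_group (A\<lparr>carrier := C\<rparr>)"
  proof (rule abelian_groupI)
    fix x assume "x \<in> carrier (A\<lparr>carrier := C\<rparr>)"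
    then have "x \<in> C" by simp
    then show "\<exists>y\<in>carrier (A\<lparr>carrier := C\<rparr>).
        y \<oplus>\<^bsub>A\<lparr>carrier := C\<rparr>\<^esub> x = \<zero>\<^bsub>A\<lparr>carrier := C\<rparr>\<^esub>"
      using C smult_add_left[of x "-1" 1] by (intro bexI[of _ "(-1) \<odot>\<^bsub>A\<^esub> x"]) auto
  qed (use C in \<open>auto simp: Alg.a_ac\<close>)
  have rg: "ring (A\<lparr>carrier := C\<rparr>)"
    by (rule ringI[OF ag], rule monoidI) (use C in \<open>auto simp: Alg.m_assoc Alg.l_distr Alg.r_distr\<close>)
  have md: "module complex_ring (A\<lparr>carrier := C\<rparr>)"
    by (rule moduleI[OF cring_complex_ring ag])
      (use C in \<open>auto simp: smult_add_left smult_add_right smult_smult\<close>)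
  show ?thesis
    by (intro pre_cstar_algebra.intro rg md, unfold_locales)
      (use C in \<open>auto simp: smult_mult_left smult_mult_right star_add star_smult
        star_mult cnorm_eq_zero_iff cnorm_smult cnorm_triangle cnorm_mult cstar_identity\<close>)
qed

lemma subalgebra_minus:
  assumes "pre_cstar_algebra A" "star_subalgebra C A" "x \<in> C" "y \<in> C"
  shows "x \<ominus>\<^bsub>A\<lparr>carrier := C\<rparr>\<^esub> y = x \<ominus>\<^bsub>A\<^esub> y"
proof -
  interpret C: pre_cstar_algebra "A\<lparr>carrier := C\<rparr>" by (rule pre_cstar_subalgebra) fact+
  interpret pre_cstar_algebra A by fact
  have "x \<in> carrier A" "y \<in> carrier A" using assms by (auto simp: star_subalgebra_def)
  then show ?thesis using C.minus_eq_smult[of x y] minus_eq_smult[of x y] assms by simp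
qed

lemma unital_cstar_subalgebra_imp_star_subalgebra:
  assumes "pre_cstar_algebra A" "unital_cstar_subalgebra D A"
  shows "star_subalgebra D A"
proof -
  interpret pre_cstar_algebra A by fact
  interpret subring D A using assms by (simp add: unital_cstar_subalgebra_def)
  show ?thesis
    using assms subringE[OF subring_axioms]
    unfolding star_subalgebra_def unital_cstar_subalgebra_def by auto
qed

section \<open>Unital star-homomorphisms\<close>

lemma unital_star_homI:
  assumes "\<And>x. x \<in> carrier A \<Longrightarrow> h x \<in> carrier B"
    "\<And>x y. x \<in> carrier A \<Longrightarrow> y \<in> carrier A \<Longrightarrow> h (x \<otimes>\<^bsub>A\<^esub> y) = h x \<otimes>\<^bsub>B\<^esub> h y"
    "\<And>x y. x \<in> carrier A \<Longrightarrow> y \<in> carrier A \<Longrightarrow> h (x \<oplus>\<^bsub>A\<^esub> y) = h x \<oplus>\<^bsub>B\<^esub> h y"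
    "h \<one>\<^bsub>A\<^esub> = \<one>\<^bsub>B\<^esub>"
    "\<And>c x. x \<in> carrier A \<Longrightarrow> h (c \<odot>\<^bsub>A\<^esub> x) = c \<odot>\<^bsub>B\<^esub> h x"
    "\<And>x. x \<in> carrier A \<Longrightarrow> h (star A x) = star B (h x)"
  shows "unital_star_hom A B h"
  using assms by (auto simp: unital_star_hom_def Ring.ring_hom_def)

lemma unital_star_homD:
  assumes "unital_star_hom A B h"
  shows "x \<in> carrier A \<Longrightarrow> h x \<in> carrier B"
    "x \<in> carrier A \<Longrightarrow> y \<in> carrier A \<Longrightarrow> h (x \<otimes>\<^bsub>A\<^esub> y) = h x \<otimes>\<^bsub>B\<^esub> h y"
    "x \<in> carrier A \<Longrightarrow> y \<in> carrier A \<Longrightarrow> h (x \<oplus>\<^bsub>A\<^esub> y) = h x \<oplus>\<^bsub>B\<^esub> h y"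
    "h \<one>\<^bsub>A\<^esub> = \<one>\<^bsub>B\<^esub>"
    "x \<in> carrier A \<Longrightarrow> h (c \<odot>\<^bsub>A\<^esub> x) = c \<odot>\<^bsub>B\<^esub> h x"
    "x \<in> carrier A \<Longrightarrow> h (star A x) = star B (h x)"
  using assms by (auto simp: unital_star_hom_def Ring.ring_hom_def)

lemma unital_star_hom_zero_minus:
  assumes "pre_cstar_algebra A" "pre_cstar_algebra B" "unital_star_hom A B h"
  shows "h \<zero>\<^bsub>A\<^esub> = \<zero>\<^bsub>B\<^esub>"
    and "x \<in> carrier A \<Longrightarrow> y \<in> carrier A \<Longrightarrow> h (x \<ominus>\<^bsub>A\<^esub> y) = h x \<ominus>\<^bsub>B\<^esub> h y"
proof -
  interpret A: pre_cstar_algebra A by fact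
  interpret B: pre_cstar_algebra B by fact
  note h [simp] = unital_star_homD[OF assms(3)]
  show "h \<zero>\<^bsub>A\<^esub> = \<zero>\<^bsub>B\<^esub>"
    using h(5)[of "\<zero>\<^bsub>A\<^esub>" 0] by (simp del: h(5))
  show "x \<in> carrier A \<Longrightarrow> y \<in> carrier A \<Longrightarrow> h (x \<ominus>\<^bsub>A\<^esub> y) = h x \<ominus>\<^bsub>B\<^esub> h y"
    by (simp add: A.minus_eq_smult B.minus_eq_smult)
qed

lemma unital_star_hom_comp:
  assumes "unital_star_hom A B g" "unital_star_hom B C h"
  shows "unital_star_hom A C (\<lambda>x. h (g x))"
  by (rule unital_star_homI) (simp_all add: unital_star_homD[OF assms(1)] unital_star_homD[OF assms(2)])

text \<open>A factor through an injective homomorphism is again a homomorphism.\<close>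
lemma unital_star_hom_factor:
  assumes "pre_cstar_algebra A" "pre_cstar_algebra B"
    and g: "unital_star_hom A C g" and h: "unital_star_hom B C h" "inj_on h (carrier B)"
    and sub: "\<And>x. x \<in> carrier A \<Longrightarrow> c x \<in> carrier B \<and> h (c x) = g x"
  shows "unital_star_hom A B c"
proof -
  interpret A: pre_cstar_algebra A by fact
  interpret B: pre_cstar_algebra B by fact
  note [simp] = unital_star_homD[OF g] unital_star_homD[OF h(1)]
  have *: "x = y" if "x \<in> carrier B" "y \<in> carrier B" "h x = h y" for x y
    using h(2) that by (auto dest: inj_onD)
  show ?thesis
    by (rule unital_star_homI; (rule *)?) (simp_all add: sub)
qed

lemma unital_star_hom_subalgebra_codomain:
  "\<lbrakk>unital_star_hom A (B\<lparr>carrier := C\<rparr>) h; C \<subseteq> carrier B\<rbrakk> \<Longrightarrow> unital_star_hom A B h"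
  by (auto simp: unital_star_hom_def Ring.ring_hom_def)

lemma unital_star_hom_restrict:
  "\<lbrakk>unital_star_hom A B h; C \<subseteq> carrier A; h ` C \<subseteq> C'\<rbrakk>
    \<Longrightarrow> unital_star_hom (A\<lparr>carrier := C\<rparr>) (B\<lparr>carrier := C'\<rparr>) h"
  using unital_star_homD[of A B h] by (intro unital_star_homI) (auto simp: subset_iff)

lemma star_subalgebra_image:
  assumes "pre_cstar_algebra A" "pre_cstar_algebra B" "unital_star_hom A B h"
  shows "star_subalgebra (h ` carrier A) B"
proof -
  interpret A: pre_cstar_algebra A by fact
  interpret B: pre_cstar_algebra B by fact
  note h = unital_star_homD[OF assms(3)] unital_star_hom_zero_minus[OF assms]
  show ?thesis
    unfolding star_subalgebra_def
    by (auto simp: h(1) h(2-7)[symmetric] intro!: imageI)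
qed

section \<open>Completeness: square roots, inverses and projections\<close>

context pre_cstar_algebra
begin

lemma tendsto_star:
  assumes "\<And>n. s n \<in> carrier A" "x \<in> carrier A" "(\<lambda>n. cnorm A (s n \<ominus> x)) \<longlonglongrightarrow> 0"
  shows "(\<lambda>n. cnorm A (star A (s n) \<ominus> star A x)) \<longlonglongrightarrow> 0"
  using assms by (simp add: star_minus[symmetric])

lemma tendsto_mult_left:
  assumes "\<And>n. s n \<in> carrier A" "x \<in> carrier A" "a \<in> carrier A"
    "(\<lambda>n. cnorm A (s n \<ominus> x)) \<longlonglongrightarrow> 0"
  shows "(\<lambda>n. cnorm A (a \<otimes> s n \<ominus> a \<otimes> x)) \<longlonglongrightarrow> 0"
proof (rule tendsto_sandwich[OF _ _ tendsto_const])
  have "cnorm A (a \<otimes> s n \<ominus> a \<otimes> x) \<le> cnorm A a * cnorm A (s n \<ominus> x)" for n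
  proof -
    have "a \<otimes> s n \<ominus> a \<otimes> x = a \<otimes> (s n \<ominus> x)" using assms by algebra
    then show ?thesis using cnorm_mult[of a "s n \<ominus> x"] assms by simp
  qed
  then show "\<forall>\<^sub>F n in sequentially. cnorm A (a \<otimes> s n \<ominus> a \<otimes> x) \<le> cnorm A a * cnorm A (s n \<ominus> x)"
    by simp
  show "(\<lambda>n. cnorm A a * cnorm A (s n \<ominus> x)) \<longlonglongrightarrow> 0"
    using tendsto_mult_right_zero[OF assms(4)] by simp
qed (use assms in simp)

lemma tendsto_mult_right:
  assumes "\<And>n. s n \<in> carrier A" "x \<in> carrier A" "a \<in> carrier A"
    "(\<lambda>n. cnorm A (s n \<ominus> x)) \<longlonglongrightarrow> 0"
  shows "(\<lambda>n. cnorm A (s n \<otimes> a \<ominus> x \<otimes> a)) \<longlonglongrightarrow> 0"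
  using tendsto_star[OF _ _ tendsto_mult_left[OF _ _ _ tendsto_star[OF assms(1,2,4)], of "star A a"]]
    assms by (simp add: star_mult)

lemma tendsto_cnorm:
  assumes "\<And>n. s n \<in> carrier A" "x \<in> carrier A" "(\<lambda>n. cnorm A (s n \<ominus> x)) \<longlonglongrightarrow> 0"
  shows "(\<lambda>n. cnorm A (s n)) \<longlonglongrightarrow> cnorm A x"
proof (rule LIM_zero_cancel, rule Lim_null_comparison[OF _ assms(3)])
  show "\<forall>\<^sub>F n in sequentially. norm (cnorm A (s n) - cnorm A x) \<le> cnorm A (s n \<ominus> x)"
    using cnorm_diff_le assms by simp
qed

lemma cauchy_converges:
  assumes "Metric_space.mcomplete (carrier A) (cstar_dist A)" "\<And>n. s n \<in> carrier A"
    "\<And>e. e > 0 \<Longrightarrow> \<exists>N. \<forall>m\<ge>N. \<forall>n\<ge>N. cnorm A (s m \<ominus> s n) < e"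
  obtains x where "x \<in> carrier A" "(\<lambda>n. cnorm A (s n \<ominus> x)) \<longlonglongrightarrow> 0"
  using assms unfolding mcomplete_iff by blast

lemma convergent_imp_cauchy:
  assumes "\<And>n. s n \<in> carrier A" "x \<in> carrier A" "(\<lambda>n. cnorm A (s n \<ominus> x)) \<longlonglongrightarrow> 0" "e > 0"
  shows "\<exists>N. \<forall>m\<ge>N. \<forall>n\<ge>N. cnorm A (s m \<ominus> s n) < e"
proof -
  obtain N where N: "\<And>n. n \<ge> N \<Longrightarrow> cnorm A (s n \<ominus> x) < e / 2"
    using LIMSEQ_D[OF assms(3), of "e / 2"] assms by auto
  have "cnorm A (s m \<ominus> s n) < e" if "m \<ge> N" "n \<ge> N" for m n
    using cnorm_minus_triangle[of "s m" x "s n"] N[OF that(1)] N[OF that(2)]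
      cnorm_minus_commute[of x "s n"] assms by simp
  then show ?thesis by blast
qed

lemma fixed_point:
  assumes complete: "Metric_space.mcomplete (carrier A) (cstar_dist A)"
    and S: "S \<subseteq> carrier A" "S \<noteq> {}"
    and closed: "\<And>s x. \<lbrakk>\<And>n. s n \<in> S; x \<in> carrier A; (\<lambda>n. cnorm A (s n \<ominus> x)) \<longlonglongrightarrow> 0\<rbrakk> \<Longrightarrow> x \<in> S"
    and T: "\<And>x. x \<in> S \<Longrightarrow> T x \<in> S"
    and k: "k < 1" "\<And>x y. x \<in> S \<Longrightarrow> y \<in> S \<Longrightarrow> cnorm A (T x \<ominus> T y) \<le> k * cnorm A (x \<ominus> y)"
  shows "\<exists>x\<in>S. T x = x"
proof -
  interpret M: Metric_space "carrier A" "cstar_dist A" by (rule Metric_space_dist)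
  interpret S: Submetric "carrier A" "cstar_dist A" S by unfold_locales (rule S(1))
  have "closedin M.mtopology S"
    unfolding cstar_topology_def[symmetric] closedin_iff using S closed by blast
  then have "S.sub.mcomplete"
    using S.closedin_mcomplete_imp_mcomplete complete by blast
  have con: "cstar_dist A (T x) (T y) \<le> k * cstar_dist A x y" if "x \<in> S" "y \<in> S" for x y
    using k(2)[OF that] that T S by (auto simp: cstar_dist_def subset_iff)
  obtain x where "x \<in> S" "T x = x"
    by (rule S.sub.Banach_fixedpoint_thm[OF \<open>S.sub.mcomplete\<close> S(2) _ k(1) con]) (use T in auto)
  then show ?thesis by blast
qed

text \<open>
  The square root of \<open>1 - x\<close> for self-adjoint \<open>x\<close> of norm less than one, written as
  \<open>1 - c\<close>: the element \<open>c\<close> is the fixed point of \<open>c \<mapsto> (x + c\<^sup>2) / 2\<close>, which contracts the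
  ball of radius \<open>1 - sqrt (1 - \<parallel>x\<parallel>)\<close>. Restricting the map to the commutant of \<open>s\<close> makes
  the root commute with \<open>s\<close>.
\<close>
lemma sqrt_one_minus:
  assumes complete: "Metric_space.mcomplete (carrier A) (cstar_dist A)"
    and x: "x \<in> carrier A" "star A x = x" "cnorm A x < 1"
    and s: "s \<in> carrier A" "star A s = s" "s \<otimes> x = x \<otimes> s"
  obtains c where "c \<in> carrier A" "star A c = c" "s \<otimes> c = c \<otimes> s" "cnorm A c < 1"
    "(\<one> \<ominus> c) \<otimes> (\<one> \<ominus> c) = \<one> \<ominus> x"
proof -
  define r where "r = 1 - sqrt (1 - cnorm A x)"
  have r: "0 \<le> r" "r < 1" "cnorm A x + r\<^sup>2 = 2 * r"
  proof -
    have t: "(sqrt (1 - cnorm A x))\<^sup>2 = 1 - cnorm A x" using x by simp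
    show "cnorm A x + r\<^sup>2 = 2 * r" unfolding r_def power2_diff t by simp
  qed (use x in \<open>auto simp: r_def\<close>)
  define S where "S = {c \<in> carrier A. star A c = c \<and> s \<otimes> c = c \<otimes> s \<and> cnorm A c \<le> r}"
  define T where "T = (\<lambda>c. (1/2) \<odot> (x \<oplus> c \<otimes> c))"
  have "\<exists>c\<in>S. T c = c"
  proof (rule fixed_point[OF complete _ _ _ _ r(2)])
    show "S \<subseteq> carrier A" by (auto simp: S_def)
    have "\<zero> \<in> S" using r s by (simp add: S_def)
    then show "S \<noteq> {}" by auto
  next
    fix t y
    assume t: "\<And>n. t n \<in> S" and y: "y \<in> carrier A" and lim: "(\<lambda>n. cnorm A (t n \<ominus> y)) \<longlonglongrightarrow> 0"
    have t': "t n \<in> carrier A" "star A (t n) = t n" "s \<otimes> t n = t n \<otimes> s" "cnorm A (t n) \<le> r" for n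
      using t[of n] by (auto simp: S_def)
    have "star A y = y"
    proof (rule limit_unique[of t, OF t'(1)])
      show "(\<lambda>n. cnorm A (t n \<ominus> star A y)) \<longlonglongrightarrow> 0"
        using tendsto_star[OF t'(1) y lim] unfolding t'(2) .
    qed (use y lim in auto)
    moreover have "s \<otimes> y = y \<otimes> s"
    proof (rule limit_unique[of "\<lambda>n. s \<otimes> t n"])
      show "(\<lambda>n. cnorm A (s \<otimes> t n \<ominus> s \<otimes> y)) \<longlonglongrightarrow> 0"
        by (rule tendsto_mult_left[OF t'(1) y s(1) lim])
      show "(\<lambda>n. cnorm A (s \<otimes> t n \<ominus> y \<otimes> s)) \<longlonglongrightarrow> 0"
        unfolding t'(3) by (rule tendsto_mult_right[OF t'(1) y s(1) lim])
    qed (use y s t'(1) in auto)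
    moreover have "cnorm A y \<le> r"
      by (rule LIMSEQ_le_const2[OF tendsto_cnorm[OF t'(1) y lim]]) (use t' in auto)
    ultimately show "y \<in> S" using y by (simp add: S_def)
  next
    fix c assume "c \<in> S"
    then have c: "c \<in> carrier A" "star A c = c" "s \<otimes> c = c \<otimes> s" "cnorm A c \<le> r"
      by (auto simp: S_def)
    have "s \<otimes> (c \<otimes> c) = (c \<otimes> c) \<otimes> s"
      using c s by (metis Alg.m_assoc)
    then have "s \<otimes> T c = T c \<otimes> s"
      using c s x by (simp add: T_def smult_mult_right smult_mult_left Alg.r_distr Alg.l_distr)
    moreover have "star A (T c) = T c"
      using c x by (simp add: T_def star_smult star_add star_mult)
    moreover have "cnorm A (T c) \<le> r"
    proof -
      have "cnorm A (x \<oplus> c \<otimes> c) \<le> cnorm A x + cnorm A c * cnorm A c"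
        using cnorm_triangle[of x "c \<otimes> c"] cnorm_mult[of c c] c x by simp
      also have "\<dots> \<le> cnorm A x + r * r"
        using c r by (intro add_left_mono mult_mono) auto
      also have "\<dots> = 2 * r" using r(3) by (simp add: power2_eq_square)
      finally show ?thesis using c x by (simp add: T_def cnorm_smult)
    qed
    ultimately show "T c \<in> S" using c x by (simp add: S_def) (simp add: T_def)
  next
    fix c d assume "c \<in> S" "d \<in> S"
    then have c: "c \<in> carrier A" "d \<in> carrier A" "cnorm A c \<le> r" "cnorm A d \<le> r"
      by (auto simp: S_def)
    have "(x \<oplus> c \<otimes> c) \<ominus> (x \<oplus> d \<otimes> d) = c \<otimes> (c \<ominus> d) \<oplus> (c \<ominus> d) \<otimes> d"
      using x c by algebra
    then have "T c \<ominus> T d = (1/2) \<odot> (c \<otimes> (c \<ominus> d) \<oplus> (c \<ominus> d) \<otimes> d)"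
      using x c by (simp add: T_def smult_minus_right[symmetric])
    then have "cnorm A (T c \<ominus> T d) = 1/2 * cnorm A (c \<otimes> (c \<ominus> d) \<oplus> (c \<ominus> d) \<otimes> d)"
      using c by (simp add: cnorm_smult)
    also have "\<dots> \<le> 1/2 * (cnorm A c * cnorm A (c \<ominus> d) + cnorm A (c \<ominus> d) * cnorm A d)"
      using cnorm_triangle[of "c \<otimes> (c \<ominus> d)" "(c \<ominus> d) \<otimes> d"] cnorm_mult[of c "c \<ominus> d"]
        cnorm_mult[of "c \<ominus> d" d] c by simp
    also have "\<dots> \<le> 1/2 * (r * cnorm A (c \<ominus> d) + cnorm A (c \<ominus> d) * r)"
      using c by (intro mult_left_mono add_mono mult_right_mono) auto
    finally show "cnorm A (T c \<ominus> T d) \<le> r * cnorm A (c \<ominus> d)" by simp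
  qed
  then obtain c where "c \<in> S" and Tc: "T c = c" by auto
  then have c: "c \<in> carrier A" "star A c = c" "s \<otimes> c = c \<otimes> s" "cnorm A c \<le> r"
    by (auto simp: S_def)
  have "c \<oplus> c = 2 \<odot> T c"
    using smult_add_left[of c 1 1] c Tc by simp
  also have "\<dots> = x \<oplus> c \<otimes> c"
    using c x by (simp add: T_def smult_smult)
  finally have cc: "c \<oplus> c = x \<oplus> c \<otimes> c" .
  have "(\<one> \<ominus> c) \<otimes> (\<one> \<ominus> c) = \<one> \<ominus> (c \<oplus> c) \<oplus> c \<otimes> c"
    using c(1) Alg.r_one[OF c(1)] by algebra
  also have "\<dots> = \<one> \<ominus> x"
    unfolding cc using c x by algebra
  finally show thesis
    using that[of c] c r by simp
qed

lemma right_inverse_near_one: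
  assumes complete: "Metric_space.mcomplete (carrier A) (cstar_dist A)"
    and z: "z \<in> carrier A" "cnorm A (\<one> \<ominus> z) < 1"
  obtains w where "w \<in> carrier A" "z \<otimes> w = \<one>"
proof -
  \<comment> \<open>a solution of \<open>z w = 1\<close> is a fixed point of a contraction of the whole algebra\<close>
  have "\<exists>w\<in>carrier A. \<one> \<oplus> (\<one> \<ominus> z) \<otimes> w = w"
  proof (rule fixed_point[OF complete _ _ _ _ z(2)])
    fix w v assume wv: "w \<in> carrier A" "v \<in> carrier A"
    have "\<one> \<oplus> (\<one> \<ominus> z) \<otimes> w \<ominus> (\<one> \<oplus> (\<one> \<ominus> z) \<otimes> v) = (\<one> \<ominus> z) \<otimes> (w \<ominus> v)"
      using wv z by algebra
    then show "cnorm A (\<one> \<oplus> (\<one> \<ominus> z) \<otimes> w \<ominus> (\<one> \<oplus> (\<one> \<ominus> z) \<otimes> v))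
        \<le> cnorm A (\<one> \<ominus> z) * cnorm A (w \<ominus> v)"
      using cnorm_mult[of "\<one> \<ominus> z" "w \<ominus> v"] wv z by simp
  qed (use z in auto)
  then obtain w where w: "w \<in> carrier A" "\<one> \<oplus> (\<one> \<ominus> z) \<otimes> w = w" by blast
  have "z \<otimes> w = \<one> \<oplus> w \<ominus> (\<one> \<oplus> (\<one> \<ominus> z) \<otimes> w)" using w(1) z by algebra
  also have "\<dots> = \<one>" unfolding w(2) using w(1) by algebra
  finally show thesis using that w by blast
qed

lemma inverse_near_one:
  assumes complete: "Metric_space.mcomplete (carrier A) (cstar_dist A)"
    and z: "z \<in> carrier A" "cnorm A (\<one> \<ominus> z) < 1"
  obtains w where "w \<in> carrier A" "z \<otimes> w = \<one>" "w \<otimes> z = \<one>"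
proof -
  obtain w where w: "w \<in> carrier A" "z \<otimes> w = \<one>"
    using right_inverse_near_one[OF assms] .
  have "cnorm A (\<one> \<ominus> star A z) < 1"
    using cnorm_star[of "\<one> \<ominus> z"] z by (simp add: star_minus)
  then obtain v where v: "v \<in> carrier A" "star A z \<otimes> v = \<one>"
    using right_inverse_near_one[OF complete, of "star A z"] z by auto
  have vz: "star A v \<otimes> z = \<one>"
    using star_mult[of "star A z" v] v z by simp
  have "star A v = star A v \<otimes> (z \<otimes> w)" using v w by simp
  also have "\<dots> = (star A v \<otimes> z) \<otimes> w" using v w z by (simp add: Alg.m_assoc)
  also have "\<dots> = w" using vz w by simp
  finally show thesis using that w vz by simp
qed

text \<open>With \<open>y\<close> the square root of \<open>1 - a\<^sup>2\<close>, the elements \<open>a \<plusminus> iy\<close> are unitary.\<close>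
lemma selfadjoint_mean_of_unitaries:
  assumes complete: "Metric_space.mcomplete (carrier A) (cstar_dist A)"
    and a: "a \<in> carrier A" "star A a = a" "cnorm A a < 1"
  obtains u where "u \<in> carrier A" "star A u \<otimes> u = \<one>" "a = (1/2) \<odot> (u \<oplus> star A u)"
proof -
  have "cnorm A (a \<otimes> a) < 1"
    using cstar_identity[of a] a power_strict_mono[of "cnorm A a" 1 2] by simp
  then obtain c where c: "c \<in> carrier A" "star A c = c" "a \<otimes> c = c \<otimes> a"
    "(\<one> \<ominus> c) \<otimes> (\<one> \<ominus> c) = \<one> \<ominus> a \<otimes> a"
    using sqrt_one_minus[OF complete, of "a \<otimes> a" a] a by (auto simp: star_mult Alg.m_assoc)
  define y where "y = \<one> \<ominus> c"
  have y: "y \<in> carrier A" "star A y = y" "y \<otimes> y = \<one> \<ominus> a \<otimes> a"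
    using c by (auto simp: y_def star_minus)
  have "a \<otimes> y = a \<ominus> a \<otimes> c" "y \<otimes> a = a \<ominus> c \<otimes> a"
    unfolding y_def using a(1) c(1) Alg.r_one[OF a(1)] by algebra+
  then have ya: "y \<otimes> a = a \<otimes> y" using c by simp
  define u where "u = a \<oplus> \<i> \<odot> y"
  have u: "u \<in> carrier A" "star A u = a \<oplus> (-\<i>) \<odot> y"
    using a y by (auto simp: u_def star_add star_smult)
  have "star A u \<otimes> u = a \<otimes> a \<oplus> \<i> \<odot> (a \<otimes> y) \<oplus> ((-\<i>) \<odot> (a \<otimes> y) \<oplus> y \<otimes> y)"
    unfolding u(2) unfolding u_def using a y ya
    by (simp add: Alg.l_distr Alg.r_distr smult_mult_left smult_mult_right smult_smult smult_add_right
        Alg.a_ac)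
  also have "\<dots> = a \<otimes> a \<oplus> (\<i> \<odot> (a \<otimes> y) \<oplus> (-\<i>) \<odot> (a \<otimes> y)) \<oplus> y \<otimes> y"
    using a y by (simp add: Alg.a_ac)
  also have "\<dots> = a \<otimes> a \<oplus> y \<otimes> y"
    using smult_add_left[of "a \<otimes> y" \<i> "-\<i>"] a y by simp
  also have "\<dots> = \<one>" unfolding y(3) using a by algebra
  finally have uu: "star A u \<otimes> u = \<one>" .
  have "u \<oplus> star A u = (a \<oplus> a) \<oplus> (\<i> \<odot> y \<oplus> (-\<i>) \<odot> y)"
    unfolding u(2) unfolding u_def using a y by (simp add: Alg.a_ac)
  also have "\<dots> = 2 \<odot> a"
    using smult_add_left[of y \<i> "-\<i>"] smult_add_left[of a 1 1] a y by simp
  finally have "a = (1/2) \<odot> (u \<oplus> star A u)"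
    using a by (simp add: smult_smult)
  then show thesis using that u uu by blast
qed

text \<open>
  The projection is \<open>(1 + g) / 2\<close> for the self-adjoint unitary part \<open>g\<close> of the polar
  decomposition of the invertible element \<open>2a - 1\<close>.
\<close>
lemma projection_near:
  assumes complete: "Metric_space.mcomplete (carrier A) (cstar_dist A)"
    and a: "a \<in> carrier A" "star A a = a" "cnorm A (a \<otimes> a \<ominus> a) < 1/4"
  obtains q where "q \<in> carrier A" "star A q = q" "q \<otimes> q = q" "cnorm A (q \<ominus> a) < 1/2"
proof -
  define s where "s = a \<oplus> a \<ominus> \<one>"
  define x where "x = 4 \<odot> (a \<ominus> a \<otimes> a)"
  have s: "s \<in> carrier A" "star A s = s" and x: "x \<in> carrier A" "star A x = x"
    using a by (auto simp: s_def x_def star_add star_minus star_smult star_mult)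
  have "4 \<odot> y = y \<oplus> y \<oplus> (y \<oplus> y)" if "y \<in> carrier A" for y
    using smult_add_left[of y 2 2] smult_add_left[of y 1 1] that by simp
  then have x': "x = (a \<ominus> a \<otimes> a) \<oplus> (a \<ominus> a \<otimes> a) \<oplus> ((a \<ominus> a \<otimes> a) \<oplus> (a \<ominus> a \<otimes> a))"
    unfolding x_def using a by simp
  have ss: "s \<otimes> s = \<one> \<ominus> x" unfolding x' s_def using a(1) Alg.r_one[OF a(1)] by algebra
  have "x = \<one> \<ominus> (\<one> \<ominus> x)" using x(1) by algebra
  then have x_eq: "x = \<one> \<ominus> s \<otimes> s" unfolding ss .
  have sx: "s \<otimes> x = x \<otimes> s"
    unfolding x_eq using s(1) Alg.r_one[OF s(1)] by algebra
  have "cnorm A x < 1"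
    unfolding x_def using a cnorm_minus_commute[of "a \<otimes> a" a] by (simp add: cnorm_smult)
  then obtain c where c: "c \<in> carrier A" "star A c = c" "s \<otimes> c = c \<otimes> s" "cnorm A c < 1"
    "(\<one> \<ominus> c) \<otimes> (\<one> \<ominus> c) = \<one> \<ominus> x"
    using sqrt_one_minus[OF complete x _ s sx] by blast
  define y where "y = \<one> \<ominus> c"
  have y: "y \<in> carrier A" "star A y = y" "y \<otimes> y = s \<otimes> s"
    using c ss by (auto simp: y_def star_minus)
  have "s \<otimes> y = s \<ominus> s \<otimes> c" "y \<otimes> s = s \<ominus> c \<otimes> s"
    unfolding y_def using s(1) c(1) Alg.r_one[OF s(1)] by algebra+
  then have sy: "s \<otimes> y = y \<otimes> s" using c by simp
  have "\<one> \<ominus> y = c" unfolding y_def using c(1) by algebra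
  then obtain w where w: "w \<in> carrier A" "y \<otimes> w = \<one>" "w \<otimes> y = \<one>"
    using inverse_near_one[OF complete, of y] c y by auto
  have ws: "w \<otimes> s = s \<otimes> w"
  proof -
    have "w \<otimes> s = w \<otimes> s \<otimes> (y \<otimes> w)" using w s by simp
    also have "\<dots> = w \<otimes> (s \<otimes> y) \<otimes> w" using w s y by (simp add: Alg.m_assoc)
    also have "\<dots> = (w \<otimes> y) \<otimes> s \<otimes> w" using w(1) s(1) y(1) by (simp add: sy Alg.m_assoc)
    finally show ?thesis using w s by simp
  qed
  have wstar: "star A w = w"
  proof -
    have "star A w \<otimes> y = \<one>" using star_mult[of y w] w y by simp
    then have "w = star A w \<otimes> (y \<otimes> w)" using w(1) y(1) by (simp add: Alg.m_assoc[symmetric])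
    then show ?thesis using w by simp
  qed
  define g where "g = s \<otimes> w"
  have g: "g \<in> carrier A" "star A g = g"
    using w s by (auto simp: g_def star_mult wstar ws)
  have gg: "g \<otimes> g = \<one>"
  proof -
    have "g \<otimes> g = s \<otimes> (w \<otimes> s) \<otimes> w" using s w by (simp add: g_def Alg.m_assoc)
    also have "\<dots> = (s \<otimes> s) \<otimes> (w \<otimes> w)" unfolding ws using s w by (simp add: Alg.m_assoc)
    also have "\<dots> = y \<otimes> (y \<otimes> w) \<otimes> w"
      using y(1) w(1) by (simp add: y(3)[symmetric] Alg.m_assoc)
    also have "\<dots> = \<one>" using y w by simp
    finally show ?thesis .
  qed
  define q where "q = (1/2) \<odot> (\<one> \<oplus> g)"
  have q: "q \<in> carrier A" "star A q = q"
    using g by (auto simp: q_def star_smult star_add)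
  have "(\<one> \<oplus> g) \<otimes> (\<one> \<oplus> g) = \<one> \<oplus> g \<otimes> g \<oplus> (g \<oplus> g)" using g(1) Alg.r_one[OF g(1)] by algebra
  also have "\<dots> = (\<one> \<oplus> g) \<oplus> (\<one> \<oplus> g)" unfolding gg using g(1) Alg.r_one[OF g(1)] by algebra
  also have "\<dots> = 2 \<odot> (\<one> \<oplus> g)" using smult_add_left[of "\<one> \<oplus> g" 1 1] g by simp
  finally have qq: "q \<otimes> q = q"
    using g by (simp add: q_def smult_mult_left smult_mult_right smult_smult)
  have "g \<otimes> y = s \<otimes> (w \<otimes> y)" unfolding g_def using s w y by (simp add: Alg.m_assoc)
  then have s_eq: "s = g \<otimes> y" using w s by simp
  have "g \<ominus> s = g \<otimes> c" unfolding s_eq y_def using g(1) c(1) Alg.r_one[OF g(1)] by algebra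
  moreover have "q \<ominus> a = (1/2) \<odot> (g \<ominus> s)"
  proof -
    have "a = (1/2) \<odot> (a \<oplus> a)"
      using smult_smult[of a "1/2" 2] smult_add_left[of a 1 1] a by simp
    then have "q \<ominus> a = (1/2) \<odot> ((\<one> \<oplus> g) \<ominus> (a \<oplus> a))"
      unfolding q_def using g a by (subst smult_minus_right) auto
    moreover have "(\<one> \<oplus> g) \<ominus> (a \<oplus> a) = g \<ominus> s" unfolding s_def using g(1) a(1) by algebra
    ultimately show ?thesis by simp
  qed
  ultimately have "cnorm A (q \<ominus> a) = 1/2 * cnorm A (g \<otimes> c)" using g c by (simp add: cnorm_smult)
  also have "\<dots> < 1/2"
  proof -
    have "cnorm A g \<le> 1" using cnorm_isometry_le[of g] g gg by simp
    then have "cnorm A g * cnorm A c \<le> 1 * cnorm A c" using c by (intro mult_right_mono) auto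
    then show ?thesis using cnorm_mult[of g c] g c by simp
  qed
  finally show thesis using that q qq by blast
qed

text \<open>The element \<open>z = q p + (1 - q) (1 - p)\<close> satisfies \<open>1 - z = (1 - 2 q) (p - q)\<close>.\<close>
lemma projections_similar:
  assumes complete: "Metric_space.mcomplete (carrier A) (cstar_dist A)"
    and p: "p \<in> carrier A" "star A p = p" "p \<otimes> p = p"
    and q: "q \<in> carrier A" "star A q = q" "q \<otimes> q = q"
    and near: "cnorm A (p \<ominus> q) < 1"
  obtains z w where "z \<in> carrier A" "w \<in> carrier A" "z \<otimes> w = \<one>" "w \<otimes> z = \<one>" "z \<otimes> p = q \<otimes> z"
proof -
  define z where "z = q \<otimes> p \<oplus> (\<one> \<ominus> q) \<otimes> (\<one> \<ominus> p)"
  define g where "g = \<one> \<ominus> q \<ominus> q"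
  have z: "z \<in> carrier A" and g: "g \<in> carrier A" "star A g = g"
    using p q by (auto simp: z_def g_def star_minus)
  have "g \<otimes> g = \<one> \<ominus> (q \<oplus> q \<oplus> q \<oplus> q) \<oplus> (q \<otimes> q \<oplus> q \<otimes> q \<oplus> q \<otimes> q \<oplus> q \<otimes> q)"
    unfolding g_def using q(1) Alg.r_one[OF q(1)] by algebra
  also have "\<dots> = \<one>" unfolding q(3) using q(1) by algebra
  finally have "cnorm A g \<le> 1" using cnorm_isometry_le[of g] g by simp
  have "g \<otimes> (p \<ominus> q) = p \<ominus> q \<ominus> q \<otimes> p \<ominus> q \<otimes> p \<oplus> q \<otimes> q \<oplus> q \<otimes> q"
    unfolding g_def using p(1) q(1) Alg.r_one[OF q(1)] Alg.r_one[OF p(1)] by algebra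
  also have "\<dots> = \<one> \<ominus> z" unfolding q(3) z_def using p(1) q(1) Alg.r_one[OF q(1)] Alg.r_one[OF p(1)] by algebra
  finally have "cnorm A (\<one> \<ominus> z) \<le> cnorm A g * cnorm A (p \<ominus> q)"
    using cnorm_mult[of g "p \<ominus> q"] g p q by simp
  also have "\<dots> \<le> 1 * cnorm A (p \<ominus> q)"
    using \<open>cnorm A g \<le> 1\<close> p q by (intro mult_right_mono) auto
  finally have "cnorm A (\<one> \<ominus> z) < 1" using near by simp
  then obtain w where w: "w \<in> carrier A" "z \<otimes> w = \<one>" "w \<otimes> z = \<one>"
    using inverse_near_one[OF complete z] by blast
  have "z \<otimes> p = q \<otimes> (p \<otimes> p) \<oplus> (\<one> \<ominus> q) \<otimes> (p \<ominus> p \<otimes> p)"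
    unfolding z_def using p(1) q(1) Alg.r_one[OF q(1)] Alg.r_one[OF p(1)] by algebra
  also have "\<dots> = q \<otimes> p" unfolding p(3) using p(1) q(1) Alg.r_one[OF q(1)] Alg.r_one[OF p(1)] by algebra
  also have "q \<otimes> p = (q \<otimes> q) \<otimes> p \<oplus> (q \<ominus> q \<otimes> q) \<otimes> (\<one> \<ominus> p)"
    unfolding q(3) using p(1) q(1) Alg.r_one[OF q(1)] Alg.r_one[OF p(1)] by algebra
  also have "\<dots> = q \<otimes> z" unfolding z_def using p(1) q(1) Alg.r_one[OF q(1)] Alg.r_one[OF p(1)] by algebra
  finally show thesis using that z w by blast
qed

end

section \<open>Homomorphisms are contractive\<close>

text \<open>
  A homomorphism maps unitaries to unitaries, hence a self-adjoint element of norm less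
  than one, being a mean of two unitaries, to an element of norm at most one. The target need
  not be complete.
\<close>
theorem unital_star_hom_contractive:
  assumes A: "unital_cstar_algebra A" and B: "pre_cstar_algebra B"
    and h: "unital_star_hom A B h" and x: "x \<in> carrier A"
  shows "cnorm B (h x) \<le> cnorm A x"
proof -
  interpret A: pre_cstar_algebra A by (rule unital_cstar_imp_pre_cstar[OF A])
  interpret B: pre_cstar_algebra B by fact
  note complete = unital_cstar_algebra.complete[OF A]
  note hD = unital_star_homD[OF h]
  have 1: "cnorm B (h a) \<le> 1" if a: "a \<in> carrier A" "star A a = a" "cnorm A a < 1" for a
  proof -
    obtain u where u: "u \<in> carrier A" "star A u \<otimes>\<^bsub>A\<^esub> u = \<one>\<^bsub>A\<^esub>"
      and au: "a = (1/2) \<odot>\<^bsub>A\<^esub> (u \<oplus>\<^bsub>A\<^esub> star A u)"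
      using A.selfadjoint_mean_of_unitaries[OF complete a] .
    have "star B (h u) \<otimes>\<^bsub>B\<^esub> h u = \<one>\<^bsub>B\<^esub>"
      using u hD(2)[of "star A u" u] by (simp add: hD)
    then have "cnorm B (h u) \<le> 1" using B.cnorm_isometry_le[of "h u"] u hD(1) by simp
    moreover have "h a = (1/2) \<odot>\<^bsub>B\<^esub> (h u \<oplus>\<^bsub>B\<^esub> star B (h u))"
      unfolding au using u by (simp add: hD)
    ultimately show ?thesis
      using B.cnorm_triangle[of "h u" "star B (h u)"] u hD(1) by (simp add: B.cnorm_smult)
  qed
  have 2: "cnorm B (h a) \<le> cnorm A a" if a: "a \<in> carrier A" "star A a = a" for a
  proof (rule field_le_epsilon)
    fix e :: real assume "e > 0"
    define t where "t = cnorm A a + e"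
    have t: "t > 0" "cnorm A a < t" using \<open>e > 0\<close> A.cnorm_nonneg[OF a(1)] by (simp_all add: t_def del: A.cnorm_nonneg)
    have "cnorm B (h (complex_of_real (1/t) \<odot>\<^bsub>A\<^esub> a)) \<le> 1"
      by (rule 1) (use a t in \<open>auto simp: A.star_smult A.cnorm_smult norm_divide\<close>)
    then have "cnorm B (h a) \<le> t"
      using a t hD(1) by (simp add: hD B.cnorm_smult norm_divide field_simps)
    then show "cnorm B (h a) \<le> cnorm A a + e" by (simp add: t_def)
  qed
  have "(cnorm B (h x))\<^sup>2 = cnorm B (h (star A x \<otimes>\<^bsub>A\<^esub> x))"
    using B.cstar_identity[of "h x"] x by (simp add: hD)
  also have "\<dots> \<le> cnorm A (star A x \<otimes>\<^bsub>A\<^esub> x)"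
    by (rule 2) (use x in \<open>auto simp: A.star_mult\<close>)
  also have "\<dots> = (cnorm A x)\<^sup>2" using x by (rule A.cstar_identity)
  finally show ?thesis using x by (simp add: power2_le_iff_abs_le)
qed

section \<open>Matrix algebras\<close>

subsection \<open>Inner products and rank-one matrices\<close>

text \<open>The inner product, conjugate-linear in the first argument.\<close>
definition cinner :: "complex vec \<Rightarrow> complex vec \<Rightarrow> complex" where
  "cinner v w = (\<Sum>i<dim_vec v. cnj (v $ i) * w $ i)"

text \<open>The rank-one matrix \<open>v w\<^sup>*\<close>, that is, \<open>x \<mapsto> \<langle>w, x\<rangle> v\<close>.\<close>
definition outer :: "nat \<Rightarrow> complex vec \<Rightarrow> complex vec \<Rightarrow> complex mat" where
  "outer n v w = mat n n (\<lambda>(i, j). v $ i * cnj (w $ j))"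

text \<open>The matrix units, with indices counted from zero.\<close>
definition munit :: "nat \<Rightarrow> nat \<Rightarrow> nat \<Rightarrow> complex mat" where
  "munit n p q = outer n (unit_vec n p) (unit_vec n q)"

lemma euclidean_norm_L2: "euclidean_norm v = L2_set (\<lambda>i. cmod (v $ i)) {..<dim_vec v}"
  by (simp add: euclidean_norm_def L2_set_def)

lemma one_smult_mat: "(1 :: complex) \<cdot>\<^sub>m a = a"
  by (rule eq_matI) auto

lemma mult_mat_vec_index:
  "\<lbrakk>a \<in> carrier_mat n n; v \<in> carrier_vec n; i < n\<rbrakk>
    \<Longrightarrow> (a *\<^sub>v v) $ i = (\<Sum>j<n. a $$ (i, j) * v $ j)"
  by (simp add: scalar_prod_def atLeast0LessThan)

lemma mult_mat_index:
  "\<lbrakk>a \<in> carrier_mat n n; b \<in> carrier_mat n n; i < n; j < n\<rbrakk>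
    \<Longrightarrow> (a * b) $$ (i, j) = (\<Sum>k<n. a $$ (i, k) * b $$ (k, j))"
  by (simp add: scalar_prod_def atLeast0LessThan)

lemma mat_adjoint_index:
  "\<lbrakk>a \<in> carrier_mat n n; i < n; j < n\<rbrakk> \<Longrightarrow> mat_adjoint a $$ (i, j) = cnj (a $$ (j, i))"
  by (simp add: mat_adjoint_def mat_of_rows_def)

lemma mat_adjoint_carrier [simp]: "a \<in> carrier_mat n n \<Longrightarrow> mat_adjoint a \<in> carrier_mat n n"
  by (auto simp: mat_adjoint_def mat_of_rows_def)

lemma euclidean_norm_nonneg [simp]: "0 \<le> euclidean_norm v"
  by (simp add: euclidean_norm_L2)

lemma euclidean_norm_0 [simp]: "euclidean_norm (0\<^sub>v n) = 0"
  by (simp add: euclidean_norm_def)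

lemma euclidean_norm_eq_0_iff: "v \<in> carrier_vec n \<Longrightarrow> euclidean_norm v = 0 \<longleftrightarrow> v = 0\<^sub>v n"
  by (auto simp: euclidean_norm_L2 L2_set_eq_0_iff)

lemma euclidean_norm_smult: "euclidean_norm (c \<cdot>\<^sub>v v) = cmod c * euclidean_norm v"
  by (auto simp: euclidean_norm_L2 norm_mult L2_set_right_distrib intro!: L2_set_cong)

lemma euclidean_norm_triangle:
  assumes "v \<in> carrier_vec n" "w \<in> carrier_vec n"
  shows "euclidean_norm (v + w) \<le> euclidean_norm v + euclidean_norm w"
proof -
  have "euclidean_norm (v + w) \<le> L2_set (\<lambda>i. cmod (v $ i) + cmod (w $ i)) {..<n}"
    using assms by (auto simp: euclidean_norm_L2 intro!: L2_set_mono norm_triangle_ineq)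
  also have "\<dots> \<le> euclidean_norm v + euclidean_norm w"
    using assms L2_set_triangle_ineq by (auto simp: euclidean_norm_L2)
  finally show ?thesis .
qed

lemma cinner_self: "cinner v v = complex_of_real ((euclidean_norm v)\<^sup>2)"
  by (simp add: cinner_def euclidean_norm_def sum_nonneg complex_norm_square mult.commute
      del: of_real_power)

lemma cmod_cinner_le:
  assumes "v \<in> carrier_vec n" "w \<in> carrier_vec n"
  shows "cmod (cinner v w) \<le> euclidean_norm v * euclidean_norm w"
proof -
  have "cmod (cinner v w) \<le> (\<Sum>i<n. \<bar>cmod (v $ i)\<bar> * \<bar>cmod (w $ i)\<bar>)"
    using assms by (auto simp: cinner_def norm_mult intro!: sum_norm_le)
  also have "\<dots> \<le> euclidean_norm v * euclidean_norm w"
    using assms L2_set_mult_ineq[of "\<lambda>i. cmod (v $ i)" "\<lambda>i. cmod (w $ i)" "{..<n}"]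
    by (auto simp: euclidean_norm_L2)
  finally show ?thesis .
qed

lemma cinner_adjoint:
  assumes "a \<in> carrier_mat n n" "v \<in> carrier_vec n" "w \<in> carrier_vec n"
  shows "cinner v (a *\<^sub>v w) = cinner (mat_adjoint a *\<^sub>v v) w"
proof -
  have "cinner v (a *\<^sub>v w) = (\<Sum>i<n. \<Sum>j<n. cnj (v $ i) * (a $$ (i, j) * w $ j))"
    using assms by (simp add: cinner_def mult_mat_vec_index[OF assms(1,3)] sum_distrib_left
        del: index_mult_mat_vec)
  also have "\<dots> = (\<Sum>j<n. \<Sum>i<n. cnj (v $ i) * (a $$ (i, j) * w $ j))"
    by (rule sum.swap)
  also have "\<dots> = (\<Sum>j<n. cnj (\<Sum>i<n. mat_adjoint a $$ (j, i) * v $ i) * w $ j)"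
    using assms(1) by (simp add: mat_adjoint_index sum_distrib_left sum_distrib_right mult_ac)
  also have "\<dots> = cinner (mat_adjoint a *\<^sub>v v) w"
  proof -
    have "dim_vec (mat_adjoint a *\<^sub>v v) = n" using mat_adjoint_carrier[OF assms(1)] by auto
    then show ?thesis
      unfolding cinner_def
      by (simp add: mult_mat_vec_index[OF mat_adjoint_carrier[OF assms(1)] assms(2)]
          del: index_mult_mat_vec)
  qed
  finally show ?thesis .
qed

lemma cinner_unit_vec: "i < n \<Longrightarrow> v \<in> carrier_vec n \<Longrightarrow> cinner (unit_vec n i) v = v $ i"
  by (simp add: cinner_def unit_vec_def if_distrib[of cnj] if_distrib[of "\<lambda>x. x * _"] sum.If_cases
      cong: if_cong)

lemma euclidean_norm_unit_vec: "i < n \<Longrightarrow> euclidean_norm (unit_vec n i) = 1"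
  using cinner_self[of "unit_vec n i"] cinner_unit_vec[of i n "unit_vec n i"]
  by (simp add: unit_vec_def flip: of_real_power) (metis euclidean_norm_nonneg of_real_eq_1_iff power2_eq_1_iff power_one
      real_sqrt_pow2 real_sqrt_unique zero_le_one)

lemma outer_carrier [simp]: "outer n v w \<in> carrier_mat n n"
  by (simp add: outer_def)

lemma munit_carrier [simp]: "munit n p q \<in> carrier_mat n n"
  by (simp add: munit_def)

lemma outer_mult_outer:
  assumes "w \<in> carrier_vec n"
  shows "outer n v w * outer n x y = cinner w x \<cdot>\<^sub>m outer n v y"
proof (rule eq_matI)
  fix i j assume "i < dim_row (cinner w x \<cdot>\<^sub>m outer n v y)" "j < dim_col (cinner w x \<cdot>\<^sub>m outer n v y)"
  then have ij: "i < n" "j < n" by (auto simp: outer_def)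
  show "(outer n v w * outer n x y) $$ (i, j) = (cinner w x \<cdot>\<^sub>m outer n v y) $$ (i, j)"
    unfolding mult_mat_index[OF outer_carrier outer_carrier ij]
    using ij assms by (simp add: outer_def cinner_def sum_distrib_left sum_distrib_right mult_ac)
qed (auto simp: outer_def)

lemma mat_adjoint_outer: "mat_adjoint (outer n v w) = outer n w v"
proof (rule eq_matI)
  fix i j assume "i < dim_row (outer n w v)" "j < dim_col (outer n w v)"
  then have ij: "i < n" "j < n" by (auto simp: outer_def)
  show "mat_adjoint (outer n v w) $$ (i, j) = outer n w v $$ (i, j)"
    unfolding mat_adjoint_index[OF outer_carrier ij] using ij by (simp add: outer_def)
qed (auto simp: outer_def mat_adjoint_def mat_of_rows_def)

lemma mult_outer:
  assumes "a \<in> carrier_mat n n" "v \<in> carrier_vec n"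
  shows "a * outer n v w = outer n (a *\<^sub>v v) w"
proof (rule eq_matI)
  fix i j assume "i < dim_row (outer n (a *\<^sub>v v) w)" "j < dim_col (outer n (a *\<^sub>v v) w)"
  then have ij: "i < n" "j < n" by (auto simp: outer_def)
  have "(a * outer n v w) $$ (i, j) = (\<Sum>k<n. a $$ (i, k) * v $ k) * cnj (w $ j)"
    unfolding mult_mat_index[OF assms(1) outer_carrier ij]
    using ij by (simp add: outer_def sum_distrib_left sum_distrib_right mult_ac)
  also have "\<dots> = outer n (a *\<^sub>v v) w $$ (i, j)"
    unfolding mult_mat_vec_index[OF assms ij(1), symmetric] using ij by (simp add: outer_def)
  finally show "(a * outer n v w) $$ (i, j) = outer n (a *\<^sub>v v) w $$ (i, j)" .
qed (use assms in \<open>auto simp: outer_def\<close>)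

lemma mat_adjoint_mult:
  fixes a b :: "complex mat"
  assumes "a \<in> carrier_mat n n" "b \<in> carrier_mat n n"
  shows "mat_adjoint (a * b) = mat_adjoint b * mat_adjoint a"
proof (rule eq_matI)
  have ab: "a * b \<in> carrier_mat n n" using assms by auto
  note adj = mat_adjoint_carrier[OF assms(2)] mat_adjoint_carrier[OF assms(1)]
  fix i j assume "i < dim_row (mat_adjoint b * mat_adjoint a)" "j < dim_col (mat_adjoint b * mat_adjoint a)"
  then have ij: "i < n" "j < n" using adj by auto
  show "mat_adjoint (a * b) $$ (i, j) = (mat_adjoint b * mat_adjoint a) $$ (i, j)"
    unfolding mat_adjoint_index[OF ab ij] mult_mat_index[OF adj ij] mult_mat_index[OF assms ij(2,1)]
    using ij assms by (simp add: mat_adjoint_index mult.commute)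
qed (use assms in \<open>auto simp: mat_adjoint_def mat_of_rows_def\<close>)

lemma mat_adjoint_add:
  fixes a b :: "complex mat"
  shows "\<lbrakk>a \<in> carrier_mat n n; b \<in> carrier_mat n n\<rbrakk>
    \<Longrightarrow> mat_adjoint (a + b) = mat_adjoint a + mat_adjoint b"
  by (rule eq_matI) (auto simp: mat_adjoint_def mat_of_rows_def)

lemma mat_adjoint_smult:
  fixes a :: "complex mat"
  shows "a \<in> carrier_mat n n \<Longrightarrow> mat_adjoint (c \<cdot>\<^sub>m a) = cnj c \<cdot>\<^sub>m mat_adjoint a"
  by (rule eq_matI) (auto simp: mat_adjoint_def mat_of_rows_def)

lemma mat_adjoint_adjoint:
  fixes a :: "complex mat"
  shows "a \<in> carrier_mat n n \<Longrightarrow> mat_adjoint (mat_adjoint a) = a"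
  by (rule eq_matI) (auto simp: mat_adjoint_def mat_of_rows_def)

lemma munit_index:
  "\<lbrakk>i < n; j < n; p < n; q < n\<rbrakk> \<Longrightarrow> munit n p q $$ (i, j) = (if i = p \<and> j = q then 1 else 0)"
  by (auto simp: munit_def outer_def)

lemma munit_mult:
  "\<lbrakk>q < n; r < n\<rbrakk> \<Longrightarrow> munit n p q * munit n r s = (if q = r then munit n p s else 0\<^sub>m n n)"
  unfolding munit_def by (simp add: outer_mult_outer cinner_unit_vec) (auto simp: outer_def)

lemma mat_adjoint_munit: "mat_adjoint (munit n p q) = munit n q p"
  by (simp add: munit_def mat_adjoint_outer)

text \<open>Every matrix is a linear combination of matrix units.\<close>
lemma mat_unit_induct:
  assumes a: "a \<in> carrier_mat n n"
    and zero: "P (0\<^sub>m n n)"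
    and add: "\<And>a b. \<lbrakk>a \<in> carrier_mat n n; b \<in> carrier_mat n n; P a; P b\<rbrakk> \<Longrightarrow> P (a + b)"
    and unit: "\<And>c p q. p < n \<Longrightarrow> q < n \<Longrightarrow> P (c \<cdot>\<^sub>m munit n p q)"
  shows "P a"
proof -
  define r where "r S = mat n n (\<lambda>ij. if ij \<in> S then a $$ ij else 0)" for S
  have "P (r S)" if "finite S" "S \<subseteq> {..<n} \<times> {..<n}" for S
    using that
  proof (induction S)
    case empty
    have "r {} = 0\<^sub>m n n" by (rule eq_matI) (auto simp: r_def)
    then show ?case using zero by simp
  next
    case (insert pq S)
    obtain p q where pq: "pq = (p, q)" "p < n" "q < n" using insert by (cases pq) auto
    have "r (insert pq S) = r S + (a $$ pq) \<cdot>\<^sub>m munit n p q"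
    proof (rule eq_matI)
      fix i j
      assume "i < dim_row (r S + a $$ pq \<cdot>\<^sub>m munit n p q)" "j < dim_col (r S + a $$ pq \<cdot>\<^sub>m munit n p q)"
      then have ij: "i < n" "j < n" by (auto simp: munit_def outer_def)
      have dims: "dim_row (munit n p q) = n" "dim_col (munit n p q) = n"
        by (auto simp: munit_def outer_def)
      show "r (insert pq S) $$ (i, j) = (r S + a $$ pq \<cdot>\<^sub>m munit n p q) $$ (i, j)"
        using ij pq insert(2) by (auto simp: r_def munit_index dims)
    qed (auto simp: r_def munit_def outer_def)
    moreover have "r S \<in> carrier_mat n n" by (simp add: r_def)
    ultimately show ?case
      using insert add[of "r S" "(a $$ pq) \<cdot>\<^sub>m munit n p q"] unit pq by simp
  qed
  moreover have "r ({..<n} \<times> {..<n}) = a"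
    using a by (intro eq_matI) (auto simp: r_def)
  ultimately show ?thesis by (metis finite_SigmaI finite_lessThan subset_refl)
qed

subsection \<open>The operator norm\<close>

text \<open>The norm of \<^term>\<open>mat_cstar n\<close>, which is the operator norm on \<open>\<complex>\<^sup>n\<close>.\<close>
abbreviation opnorm :: "nat \<Rightarrow> complex mat \<Rightarrow> real" where
  "opnorm n \<equiv> cnorm (mat_cstar n)"

lemma mat_cstar_simps [simp]:
  "carrier (mat_cstar n) = carrier_mat n n" "mult (mat_cstar n) = (*)"
  "one (mat_cstar n) = 1\<^sub>m n" "zero (mat_cstar n) = 0\<^sub>m n n" "add (mat_cstar n) = (+)"
  "smult (mat_cstar n) = (\<cdot>\<^sub>m)" "star (mat_cstar n) = mat_adjoint"
  by (auto simp: mat_cstar_def)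

lemma opnorm_def:
  "opnorm n a = (SUP v\<in>{v \<in> carrier_vec n. euclidean_norm v \<le> 1}. euclidean_norm (a *\<^sub>v v))"
  by (simp add: mat_cstar_def)

lemma euclidean_norm_mult_le_sum:
  assumes "a \<in> carrier_mat n n" "v \<in> carrier_vec n"
  shows "euclidean_norm (a *\<^sub>v v) \<le> (\<Sum>i<n. \<Sum>j<n. cmod (a $$ (i, j))) * euclidean_norm v"
proof -
  have le: "cmod (v $ j) \<le> euclidean_norm v" if "j < n" for j
    using member_le_L2_set[of "{..<n}" j "\<lambda>i. cmod (v $ i)"] that assms
    by (auto simp: euclidean_norm_L2)
  have "euclidean_norm (a *\<^sub>v v) \<le> (\<Sum>i<n. cmod ((a *\<^sub>v v) $ i))"
    using L2_set_le_sum[of "{..<n}" "\<lambda>i. cmod ((a *\<^sub>v v) $ i)"] assms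
    by (simp add: euclidean_norm_L2 del: index_mult_mat_vec)
  also have "\<dots> \<le> (\<Sum>i<n. \<Sum>j<n. cmod (a $$ (i, j)) * euclidean_norm v)"
  proof (rule sum_mono)
    fix i assume "i \<in> {..<n}"
    then have "cmod ((a *\<^sub>v v) $ i) \<le> (\<Sum>j<n. cmod (a $$ (i, j) * v $ j))"
      using mult_mat_vec_index[OF assms, of i] norm_sum[of "\<lambda>j. a $$ (i, j) * v $ j" "{..<n}"]
      by (simp del: index_mult_mat_vec)
    also have "\<dots> \<le> (\<Sum>j<n. cmod (a $$ (i, j)) * euclidean_norm v)"
      by (intro sum_mono) (auto simp: norm_mult intro!: mult_left_mono le)
    finally show "cmod ((a *\<^sub>v v) $ i) \<le> (\<Sum>j<n. cmod (a $$ (i, j)) * euclidean_norm v)" .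
  qed
  finally show ?thesis by (simp add: sum_distrib_right)
qed

lemma opnorm_upper1:
  assumes "a \<in> carrier_mat n n" "v \<in> carrier_vec n" "euclidean_norm v \<le> 1"
  shows "euclidean_norm (a *\<^sub>v v) \<le> opnorm n a"
  unfolding opnorm_def
proof (rule cSUP_upper)
  let ?C = "\<Sum>i<n. \<Sum>j<n. cmod (a $$ (i, j))"
  show "bdd_above ((\<lambda>v. euclidean_norm (a *\<^sub>v v)) ` {v \<in> carrier_vec n. euclidean_norm v \<le> 1})"
  proof (rule bdd_aboveI2)
    fix v assume "v \<in> {v \<in> carrier_vec n. euclidean_norm v \<le> 1}"
    then have "euclidean_norm (a *\<^sub>v v) \<le> ?C * euclidean_norm v" "?C * euclidean_norm v \<le> ?C * 1"
      using euclidean_norm_mult_le_sum[OF assms(1), of v]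
      by (simp, intro mult_left_mono sum_nonneg) auto
    then show "euclidean_norm (a *\<^sub>v v) \<le> ?C" by simp
  qed
qed (use assms in auto)

lemma opnorm_least:
  assumes "\<And>v. v \<in> carrier_vec n \<Longrightarrow> euclidean_norm v \<le> 1 \<Longrightarrow> euclidean_norm (a *\<^sub>v v) \<le> C"
  shows "opnorm n a \<le> C"
  unfolding opnorm_def
proof (rule cSUP_least)
  have "0\<^sub>v n \<in> {v \<in> carrier_vec n. euclidean_norm v \<le> 1}" by simp
  then show "{v \<in> carrier_vec n. euclidean_norm v \<le> 1} \<noteq> {}" by blast
qed (use assms in auto)

lemma opnorm_nonneg: "a \<in> carrier_mat n n \<Longrightarrow> 0 \<le> opnorm n a"
  using order_trans[OF euclidean_norm_nonneg opnorm_upper1[of a n "0\<^sub>v n"]] by simp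

lemma opnorm_upper:
  assumes "a \<in> carrier_mat n n" "v \<in> carrier_vec n"
  shows "euclidean_norm (a *\<^sub>v v) \<le> opnorm n a * euclidean_norm v"
proof (cases "euclidean_norm v = 0")
  case True
  then show ?thesis using euclidean_norm_mult_le_sum[OF assms] by simp
next
  case False
  define r where "r = euclidean_norm v"
  have r: "r > 0" using False euclidean_norm_nonneg[of v] unfolding r_def by linarith
  let ?w = "complex_of_real (1 / r) \<cdot>\<^sub>v v"
  have "a *\<^sub>v ?w = complex_of_real (1 / r) \<cdot>\<^sub>v (a *\<^sub>v v)"
    using assms by (simp add: mult_mat_vec)
  then have "euclidean_norm (a *\<^sub>v v) / r = euclidean_norm (a *\<^sub>v ?w)"
    using r by (simp add: euclidean_norm_smult norm_divide)
  also have "\<dots> \<le> opnorm n a"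
    using r by (intro opnorm_upper1 assms) (use assms in \<open>auto simp: euclidean_norm_smult norm_divide r_def[symmetric]\<close>)
  finally show ?thesis using r by (simp add: field_simps r_def)
qed

lemma opnorm_le_sum: "a \<in> carrier_mat n n \<Longrightarrow> opnorm n a \<le> (\<Sum>i<n. \<Sum>j<n. cmod (a $$ (i, j)))"
proof (rule opnorm_least)
  let ?C = "\<Sum>i<n. \<Sum>j<n. cmod (a $$ (i, j))"
  fix v assume "a \<in> carrier_mat n n" "v \<in> carrier_vec n" "euclidean_norm v \<le> 1"
  then have "euclidean_norm (a *\<^sub>v v) \<le> ?C * euclidean_norm v" "?C * euclidean_norm v \<le> ?C * 1"
    using euclidean_norm_mult_le_sum[of a n v]
    by (simp, intro mult_left_mono sum_nonneg) auto
  then show "euclidean_norm (a *\<^sub>v v) \<le> ?C" by simp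
qed

lemma entry_le_opnorm:
  assumes "a \<in> carrier_mat n n" "i < n" "j < n"
  shows "cmod (a $$ (i, j)) \<le> opnorm n a"
proof -
  have "a $$ (i, j) = (a *\<^sub>v unit_vec n j) $ i"
    using assms by simp
  also have "cmod \<dots> \<le> euclidean_norm (a *\<^sub>v unit_vec n j)"
    using member_le_L2_set[of "{..<n}" i "\<lambda>i. cmod ((a *\<^sub>v unit_vec n j) $ i)"] assms
    by (simp add: euclidean_norm_L2 del: index_mult_mat_vec)
  also have "\<dots> \<le> opnorm n a"
    using opnorm_upper1[OF assms(1), of "unit_vec n j"] assms by (simp add: euclidean_norm_unit_vec)
  finally show ?thesis .
qed

text \<open>This follows from \<open>\<parallel>a v\<parallel>\<^sup>2 = \<langle>a\<^sup>* a v, v\<rangle>\<close>.\<close>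
lemma opnorm_cstar_aux:
  assumes "a \<in> carrier_mat n n"
  shows "(opnorm n a)\<^sup>2 \<le> opnorm n (mat_adjoint a * a)"
proof -
  let ?b = "mat_adjoint a * a"
  have b: "?b \<in> carrier_mat n n" by (rule mult_carrier_mat[OF mat_adjoint_carrier[OF assms] assms])
  have "opnorm n a \<le> sqrt (opnorm n ?b)"
  proof (rule opnorm_least)
    fix v assume v: "v \<in> carrier_vec n" "euclidean_norm v \<le> 1"
    have av: "a *\<^sub>v v \<in> carrier_vec n" using assms v by auto
    have "cinner (a *\<^sub>v v) (a *\<^sub>v v) = cinner (mat_adjoint a *\<^sub>v (a *\<^sub>v v)) v"
      using cinner_adjoint[OF assms av v(1)] .
    also have "mat_adjoint a *\<^sub>v (a *\<^sub>v v) = ?b *\<^sub>v v"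
      using assoc_mult_mat_vec[OF mat_adjoint_carrier[OF assms] assms v(1)] by simp
    finally have "cmod (cinner (a *\<^sub>v v) (a *\<^sub>v v)) = cmod (cinner (?b *\<^sub>v v) v)" by simp
    then have "(euclidean_norm (a *\<^sub>v v))\<^sup>2 \<le> euclidean_norm (?b *\<^sub>v v) * euclidean_norm v"
      using cmod_cinner_le[of "?b *\<^sub>v v" n v] b v
      by (simp add: cinner_self norm_power del: of_real_power)
    also have "\<dots> \<le> opnorm n ?b * 1"
      using v opnorm_upper1[OF b v] opnorm_nonneg[OF b] by (intro mult_mono) auto
    finally show "euclidean_norm (a *\<^sub>v v) \<le> sqrt (opnorm n ?b)"
      by (simp add: real_le_rsqrt)
  qed
  then show ?thesis using opnorm_nonneg[OF assms] opnorm_nonneg[OF b]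
    by (metis real_sqrt_le_iff real_sqrt_abs abs_of_nonneg)
qed

lemma opnorm_mult:
  assumes "a \<in> carrier_mat n n" "b \<in> carrier_mat n n"
  shows "opnorm n (a * b) \<le> opnorm n a * opnorm n b"
proof (rule opnorm_least)
  fix v assume v: "v \<in> carrier_vec n" "euclidean_norm v \<le> 1"
  have "euclidean_norm (a * b *\<^sub>v v) = euclidean_norm (a *\<^sub>v (b *\<^sub>v v))"
    using assms v by simp
  also have "\<dots> \<le> opnorm n a * euclidean_norm (b *\<^sub>v v)"
    by (rule opnorm_upper) (use assms v in auto)
  also have "\<dots> \<le> opnorm n a * opnorm n b"
    using opnorm_nonneg[OF assms(1)] opnorm_upper1[OF assms(2) v] by (rule mult_left_mono[rotated])
  finally show "euclidean_norm (a * b *\<^sub>v v) \<le> opnorm n a * opnorm n b" .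
qed

lemma opnorm_adjoint_le:
  assumes "a \<in> carrier_mat n n"
  shows "opnorm n a \<le> opnorm n (mat_adjoint a)"
proof (cases "opnorm n a = 0")
  case True
  then show ?thesis using opnorm_nonneg[OF mat_adjoint_carrier[OF assms]] by simp
next
  case False
  have "(opnorm n a)\<^sup>2 \<le> opnorm n (mat_adjoint a) * opnorm n a"
    using opnorm_cstar_aux[OF assms] opnorm_mult[OF mat_adjoint_carrier[OF assms] assms] by simp
  then show ?thesis using False opnorm_nonneg[OF assms] by (simp add: power2_eq_square)
qed

lemma opnorm_eq_0_iff:
  assumes "a \<in> carrier_mat n n"
  shows "opnorm n a = 0 \<longleftrightarrow> a = 0\<^sub>m n n"
proof
  assume 0: "opnorm n a = 0"
  have "a $$ (i, j) = 0" if "i < n" "j < n" for i j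
    using entry_le_opnorm[OF assms that] 0 by simp
  then show "a = 0\<^sub>m n n" using assms by (intro eq_matI) auto
next
  assume "a = 0\<^sub>m n n"
  then show "opnorm n a = 0"
    using opnorm_le_sum[OF assms] opnorm_nonneg[OF assms] by simp
qed

theorem pre_cstar_mat: "pre_cstar_algebra (mat_cstar n)"
proof -
  have ag: "abelian_group (mat_cstar n)"
  proof (rule abelian_groupI)
    fix x assume "x \<in> carrier (mat_cstar n)"
    then show "\<exists>y\<in>carrier (mat_cstar n). y \<oplus>\<^bsub>mat_cstar n\<^esub> x = \<zero>\<^bsub>mat_cstar n\<^esub>"
      by (intro bexI[of _ "- x"]) auto
  qed (auto simp: comm_add_mat assoc_add_mat)
  have rg: "ring (mat_cstar n)"
    by (rule ringI[OF ag], rule monoidI)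
      (auto simp: assoc_mult_mat[of _ n n _ n _ n] add_mult_distrib_mat[of _ n n] mult_add_distrib_mat[of _ n n])
  have md: "module complex_ring (mat_cstar n)"
    by (rule moduleI[OF cring_complex_ring ag])
      (auto simp: add_smult_distrib_right_mat add_smult_distrib_left_mat intro!: eq_matI simp: algebra_simps)
  have sm: "opnorm n (c \<cdot>\<^sub>m x) \<le> cmod c * opnorm n x" if "x \<in> carrier_mat n n" for c x
  proof (rule opnorm_least)
    fix v assume v: "v \<in> carrier_vec n" "euclidean_norm v \<le> 1"
    have "(c \<cdot>\<^sub>m x) *\<^sub>v v = c \<cdot>\<^sub>v (x *\<^sub>v v)"
      using that v by (intro eq_vecI) auto
    then show "euclidean_norm ((c \<cdot>\<^sub>m x) *\<^sub>v v) \<le> cmod c * opnorm n x"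
      using opnorm_upper1[OF that v] by (simp add: euclidean_norm_smult mult_left_mono)
  qed
  have sm_eq: "opnorm n (c \<cdot>\<^sub>m x) = cmod c * opnorm n x" if x: "x \<in> carrier_mat n n" for c x
  proof (cases "c = 0")
    case True
    then have "c \<cdot>\<^sub>m x = 0\<^sub>m n n" using x by auto
    then show ?thesis using True opnorm_eq_0_iff[of "0\<^sub>m n n" n] by simp
  next
    case False
    have "inverse c \<cdot>\<^sub>m (c \<cdot>\<^sub>m x) = x"
      using False x by (intro eq_matI) auto
    then have "opnorm n x \<le> cmod (inverse c) * opnorm n (c \<cdot>\<^sub>m x)"
      using sm[of "c \<cdot>\<^sub>m x" "inverse c"] x by simp
    then have "cmod c * opnorm n x \<le> opnorm n (c \<cdot>\<^sub>m x)"
      using False by (simp add: norm_inverse norm_divide field_simps)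
    then show ?thesis using sm[OF x, of c] by simp
  qed
  have tri: "opnorm n (x + y) \<le> opnorm n x + opnorm n y"
    if "x \<in> carrier_mat n n" "y \<in> carrier_mat n n" for x y
  proof (rule opnorm_least)
    fix v assume v: "v \<in> carrier_vec n" "euclidean_norm v \<le> 1"
    have "(x + y) *\<^sub>v v = x *\<^sub>v v + y *\<^sub>v v"
      using that v by (simp add: add_mult_distrib_mat_vec)
    then have "euclidean_norm ((x + y) *\<^sub>v v) \<le> euclidean_norm (x *\<^sub>v v) + euclidean_norm (y *\<^sub>v v)"
      using euclidean_norm_triangle[of "x *\<^sub>v v" n "y *\<^sub>v v"] that v by auto
    then show "euclidean_norm ((x + y) *\<^sub>v v) \<le> opnorm n x + opnorm n y"
      using opnorm_upper1[OF that(1) v] opnorm_upper1[OF that(2) v] by simp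
  qed
  have ci: "opnorm n (mat_adjoint x * x) = (opnorm n x)\<^sup>2" if x: "x \<in> carrier_mat n n" for x
  proof (rule antisym)
    have "opnorm n (mat_adjoint x) \<le> opnorm n x"
      using opnorm_adjoint_le[OF mat_adjoint_carrier[OF x]] x by (simp add: mat_adjoint_adjoint)
    then have "opnorm n (mat_adjoint x) * opnorm n x \<le> opnorm n x * opnorm n x"
      using opnorm_nonneg[OF x] by (rule mult_right_mono)
    then show "opnorm n (mat_adjoint x * x) \<le> (opnorm n x)\<^sup>2"
      using opnorm_mult[OF mat_adjoint_carrier[OF x] x] by (simp add: power2_eq_square)
  qed (rule opnorm_cstar_aux[OF x])
  show ?thesis
    by (intro pre_cstar_algebra.intro rg md, unfold_locales)
      (auto simp: mat_adjoint_adjoint mat_adjoint_add mat_adjoint_smult mat_adjoint_mult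
        opnorm_nonneg opnorm_eq_0_iff sm_eq tri opnorm_mult ci)
qed

lemma mat_cstar_minus:
  assumes "a \<in> carrier_mat n n" "b \<in> carrier_mat n n"
  shows "a \<ominus>\<^bsub>mat_cstar n\<^esub> b = a - b"
proof -
  interpret pre_cstar_algebra "mat_cstar n" by (rule pre_cstar_mat)
  show ?thesis using minus_eq_smult[of a b] assms by (auto intro!: eq_matI)
qed

theorem cstar_mat: "unital_cstar_algebra (mat_cstar n)"
proof (rule unital_cstar_algebraI[OF pre_cstar_mat])
  interpret pre_cstar_algebra "mat_cstar n" by (rule pre_cstar_mat)
  show "Metric_space.mcomplete (carrier (mat_cstar n)) (cstar_dist (mat_cstar n))"
    unfolding mcomplete_iff
  proof (intro allI impI, elim conjE)
    fix s :: "nat \<Rightarrow> complex mat"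
    assume "\<forall>m. s m \<in> carrier (mat_cstar n)"
      and c: "\<forall>e>0. \<exists>N. \<forall>m\<ge>N. \<forall>k\<ge>N. opnorm n (s m \<ominus>\<^bsub>mat_cstar n\<^esub> s k) < e"
    then have s: "s m \<in> carrier_mat n n" for m by simp
    have "\<exists>l. (\<lambda>m. s m $$ (i, j)) \<longlonglongrightarrow> l" if ij: "i < n" "j < n" for i j
    proof -
      have "Cauchy (\<lambda>m. s m $$ (i, j))"
      proof (rule CauchyI)
        fix e :: real assume "0 < e"
        then obtain N where N: "\<And>m k. m \<ge> N \<Longrightarrow> k \<ge> N \<Longrightarrow> opnorm n (s m \<ominus>\<^bsub>mat_cstar n\<^esub> s k) < e"
          using c by blast
        have "cmod (s m $$ (i, j) - s k $$ (i, j)) < e" if "m \<ge> N" "k \<ge> N" for m k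
        proof -
          have "s m - s k \<in> carrier_mat n n" using s by (auto intro: minus_carrier_mat)
          then have "cmod ((s m - s k) $$ (i, j)) \<le> opnorm n (s m - s k)"
            using ij by (intro entry_le_opnorm)
          moreover have "(s m - s k) $$ (i, j) = s m $$ (i, j) - s k $$ (i, j)"
            using s[of k] ij by simp
          ultimately show ?thesis using N[OF that] by (simp add: mat_cstar_minus s)
        qed
        then show "\<exists>M. \<forall>m\<ge>M. \<forall>k\<ge>M. norm (s m $$ (i, j) - s k $$ (i, j)) < e" by blast
      qed
      then show ?thesis by (meson Cauchy_convergent_iff convergent_def)
    qed
    then obtain L where L: "\<And>i j. i < n \<Longrightarrow> j < n \<Longrightarrow> (\<lambda>m. s m $$ (i, j)) \<longlonglongrightarrow> L i j"
      by metis
    define x where "x = mat n n (\<lambda>(i, j). L i j)"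
    have x: "x \<in> carrier_mat n n" by (simp add: x_def)
    have sx: "s m - x \<in> carrier_mat n n" for m using x by (auto intro: minus_carrier_mat)
    have "(\<lambda>m. opnorm n (s m - x)) \<longlonglongrightarrow> 0"
    proof (rule tendsto_sandwich[OF _ _ tendsto_const])
      have "opnorm n (s m - x) \<le> (\<Sum>i<n. \<Sum>j<n. cmod (s m $$ (i, j) - L i j))" for m
        using opnorm_le_sum[OF sx, of m] s[of m] by (simp add: x_def)
      then show "\<forall>\<^sub>F m in sequentially. opnorm n (s m - x) \<le> (\<Sum>i<n. \<Sum>j<n. cmod (s m $$ (i, j) - L i j))"
        by simp
      show "(\<lambda>m. \<Sum>i<n. \<Sum>j<n. cmod (s m $$ (i, j) - L i j)) \<longlonglongrightarrow> 0"
        by (intro tendsto_null_sum tendsto_norm_zero LIM_zero L) auto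
    qed (use opnorm_nonneg[OF sx] in simp)
    then have "(\<lambda>m. opnorm n (s m \<ominus>\<^bsub>mat_cstar n\<^esub> x)) \<longlonglongrightarrow> 0"
      by (simp add: mat_cstar_minus s x)
    then show "\<exists>x\<in>carrier (mat_cstar n). (\<lambda>m. opnorm n (s m \<ominus>\<^bsub>mat_cstar n\<^esub> x)) \<longlonglongrightarrow> 0"
      using x by auto
  qed
qed

subsection \<open>Homomorphisms from matrix algebras are isometric\<close>

text \<open>If a rank-one projection were mapped to zero, then so would every rank-one matrix and the unit.\<close>
lemma hom_outer_nonzero:
  assumes B: "pre_cstar_algebra B" "\<one>\<^bsub>B\<^esub> \<noteq> \<zero>\<^bsub>B\<^esub>"
    and h: "unital_star_hom (mat_cstar n) B h" and v: "v \<in> carrier_vec n" "euclidean_norm v = 1"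
  shows "h (outer n v v) \<noteq> \<zero>\<^bsub>B\<^esub>"
proof
  interpret pre_cstar_algebra B by fact
  note hD = unital_star_homD[OF h, simplified]
  assume 0: "h (outer n v v) = \<zero>\<^bsub>B\<^esub>"
  have vv: "cinner v v = 1" using v by (simp add: cinner_self)
  have outer0: "h (outer n x y) = \<zero>\<^bsub>B\<^esub>" for x y
  proof -
    have "outer n x y = outer n x v * outer n v v * outer n v y"
      using v one_smult_mat[of "outer n x v"] one_smult_mat[of "outer n x y"]
      by (simp add: outer_mult_outer vv)
    then show ?thesis
      using 0 mult_carrier_mat[OF outer_carrier outer_carrier] by (simp add: hD)
  qed
  have "h a = \<zero>\<^bsub>B\<^esub>" if "a \<in> carrier_mat n n" for a
    by (rule mat_unit_induct[OF that])
      (use unital_star_hom_zero_minus(1)[OF pre_cstar_mat B(1) h] in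
        \<open>auto simp: hD munit_def outer0\<close>)
  then show False using B(2) hD(4) by force
qed

text \<open>
  For a unit vector \<open>v\<close> and \<open>p = v v\<^sup>*\<close> one has \<open>(a p)\<^sup>* (a p) = \<parallel>a v\<parallel>\<^sup>2 p\<close>, and the image of
  \<open>p\<close> is a projection of norm one.
\<close>
theorem hom_mat_isometric:
  assumes B: "pre_cstar_algebra B" "\<one>\<^bsub>B\<^esub> \<noteq> \<zero>\<^bsub>B\<^esub>"
    and h: "unital_star_hom (mat_cstar n) B h" and a: "a \<in> carrier_mat n n"
  shows "cnorm B (h a) = opnorm n a"
proof (rule antisym)
  interpret pre_cstar_algebra B by fact
  note hD = unital_star_homD[OF h, simplified]
  show "cnorm B (h a) \<le> opnorm n a"
    using unital_star_hom_contractive[OF cstar_mat B(1) h] a by simp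
  have unit: "euclidean_norm (a *\<^sub>v v) \<le> cnorm B (h a)"
    if v: "v \<in> carrier_vec n" "euclidean_norm v = 1" for v
  proof -
    define p where "p = outer n v v"
    have vv: "cinner v v = 1" using v by (simp add: cinner_self)
    have p: "p \<in> carrier_mat n n" "mat_adjoint p = p" "p * p = p"
      using v by (auto simp: p_def mat_adjoint_outer outer_mult_outer vv)
    have "cnorm B (h p) = 1"
    proof (rule cnorm_selfadjoint_unit)
      show "h p \<noteq> \<zero>\<^bsub>B\<^esub>" unfolding p_def by (rule hom_outer_nonzero[OF B h v])
      show "star B (h p) = h p" "h p \<otimes>\<^bsub>B\<^esub> h p = h p" "h p \<in> carrier B"
        using hD(6)[OF p(1)] hD(2)[OF p(1) p(1)] hD(1)[OF p(1)] p by simp_all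
    qed
    moreover have "mat_adjoint (a * p) * (a * p) = complex_of_real ((euclidean_norm (a *\<^sub>v v))\<^sup>2) \<cdot>\<^sub>m p"
      using a v mult_outer[OF a v(1), of v]
      by (simp add: p_def mat_adjoint_outer outer_mult_outer cinner_self del: of_real_power)
    moreover have "star B (h (a * p)) \<otimes>\<^bsub>B\<^esub> h (a * p) = h (mat_adjoint (a * p) * (a * p))"
      using hD(2)[of "mat_adjoint (a * p)" "a * p"] hD(6)[of "a * p"] a p(1)
        mat_adjoint_carrier[of "a * p" n] by simp
    ultimately have "(cnorm B (h (a * p)))\<^sup>2 = (euclidean_norm (a *\<^sub>v v))\<^sup>2"
      using cstar_identity[OF hD(1), of "a * p"] a p(1)
      by (simp add: hD(1,5) cnorm_smult norm_power del: of_real_power)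
    then have "euclidean_norm (a *\<^sub>v v) = cnorm B (h (a * p))"
      using cnorm_nonneg[of "h (a * p)"] a p hD(1)[of "a * p"] by simp
    also have "\<dots> \<le> cnorm B (h a) * cnorm B (h p)"
      using cnorm_mult[of "h a" "h p"] a p by (simp add: hD)
    finally show ?thesis using \<open>cnorm B (h p) = 1\<close> by simp
  qed
  show "opnorm n a \<le> cnorm B (h a)"
  proof (rule opnorm_least)
    fix v assume v: "v \<in> carrier_vec n" "euclidean_norm v \<le> 1"
    show "euclidean_norm (a *\<^sub>v v) \<le> cnorm B (h a)"
    proof (cases "v = 0\<^sub>v n")
      case True
      have "euclidean_norm (a *\<^sub>v v) = 0" using opnorm_upper[OF a v(1)] True
        by (metis euclidean_norm_0 euclidean_norm_nonneg mult_zero_right order_antisym)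
      then show ?thesis using hD(1)[OF a] by simp
    next
      case False
      define r where "r = euclidean_norm v"
      have r: "0 < r" "r \<le> 1"
        using False v euclidean_norm_eq_0_iff[OF v(1)] euclidean_norm_nonneg[of v]
        by (auto simp: r_def less_le simp del: euclidean_norm_nonneg)
      let ?w = "complex_of_real (1 / r) \<cdot>\<^sub>v v"
      have "euclidean_norm ?w = 1" using r by (simp add: euclidean_norm_smult norm_divide r_def[symmetric])
      then have "euclidean_norm (a *\<^sub>v ?w) \<le> cnorm B (h a)" using v by (intro unit) auto
      moreover have "a *\<^sub>v ?w = complex_of_real (1 / r) \<cdot>\<^sub>v (a *\<^sub>v v)"
        using a v by (simp add: mult_mat_vec)
      ultimately have "euclidean_norm (a *\<^sub>v v) \<le> r * cnorm B (h a)"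
        using r by (simp add: euclidean_norm_smult norm_divide field_simps)
      also have "\<dots> \<le> 1 * cnorm B (h a)" using r hD(1)[OF a] by (intro mult_right_mono) auto
      finally show ?thesis by simp
    qed
  qed
qed

lemma hom_mat_inj:
  assumes B: "pre_cstar_algebra B" "\<one>\<^bsub>B\<^esub> \<noteq> \<zero>\<^bsub>B\<^esub>"
    and h: "unital_star_hom (mat_cstar n) B h"
  shows "inj_on h (carrier_mat n n)"
proof (rule inj_onI)
  interpret B: pre_cstar_algebra B by fact
  interpret M: pre_cstar_algebra "mat_cstar n" by (rule pre_cstar_mat)
  note hD = unital_star_homD[OF h, simplified]
  fix x y assume xy: "x \<in> carrier_mat n n" "y \<in> carrier_mat n n" "h x = h y"
  have "opnorm n (x \<ominus>\<^bsub>mat_cstar n\<^esub> y) = cnorm B (h (x \<ominus>\<^bsub>mat_cstar n\<^esub> y))"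
    by (rule hom_mat_isometric[OF assms, symmetric]) (use M.Alg.minus_closed[of x y] xy in simp)
  also have "h (x \<ominus>\<^bsub>mat_cstar n\<^esub> y) = \<zero>\<^bsub>B\<^esub>"
    using unital_star_hom_zero_minus(2)[OF pre_cstar_mat B(1) h, of x y] xy
      B.minus_eq_zero_iff[of "h y" "h y"] hD(1)[OF xy(2)] by simp
  finally show "x = y"
    using M.cnorm_eq_zero_iff[of "x \<ominus>\<^bsub>mat_cstar n\<^esub> y"] M.minus_eq_zero_iff[of x y] xy
      M.Alg.minus_closed[of x y] by simp
qed

section \<open>Bounded sequences modulo null sequences\<close>

lemma le_mult_by_upper_approximations:
  fixes x y z :: real
  assumes "\<And>r s. r > x \<Longrightarrow> s > y \<Longrightarrow> z \<le> r * s"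
  shows "z \<le> x * y"
proof (rule LIMSEQ_le_const)
  have "(\<lambda>n. (x + inverse (real (Suc n))) * (y + inverse (real (Suc n)))) \<longlonglongrightarrow> (x + 0) * (y + 0)"
    by (intro tendsto_intros LIMSEQ_inverse_real_of_nat)
  then show "(\<lambda>n. (x + inverse (real (Suc n))) * (y + inverse (real (Suc n)))) \<longlonglongrightarrow> x * y"
    by simp
qed (use assms in auto)

text \<open>
  The quotient of the bounded sequences by the null sequences satisfies all axioms of a C*-algebra
  other than completeness, which is not needed below.
\<close>
locale pre_cstar_sequence =
  fixes A :: "nat \<Rightarrow> 'a cstar"
  assumes pre: "\<And>n. pre_cstar_algebra (A n)"
begin

abbreviation "P \<equiv> cstar_prod A"
abbreviation "I \<equiv> null_sequences A"
abbreviation "Q \<equiv> cstar_quot (cstar_prod A) (null_sequences A)"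

lemma prod_simps [simp]:
  "mult P = (\<lambda>x y n. x n \<otimes>\<^bsub>A n\<^esub> y n)" "one P = (\<lambda>n. \<one>\<^bsub>A n\<^esub>)" "zero P = (\<lambda>n. \<zero>\<^bsub>A n\<^esub>)"
  "add P = (\<lambda>x y n. x n \<oplus>\<^bsub>A n\<^esub> y n)" "smult P = (\<lambda>c x n. c \<odot>\<^bsub>A n\<^esub> x n)"
  "star P = (\<lambda>x n. star (A n) (x n))"
  by (simp_all add: cstar_prod_def)

lemma prod_carrier_iff: "x \<in> carrier P \<longleftrightarrow>
    (\<forall>n. x n \<in> carrier (A n)) \<and> bdd_above (range (\<lambda>n. cnorm (A n) (x n)))"
  by (simp add: cstar_prod_def)

lemma prod_norm_def: "cnorm P x = (SUP n. cnorm (A n) (x n))"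
  by (simp add: cstar_prod_def)

lemma prod_component [simp]: "x \<in> carrier P \<Longrightarrow> x n \<in> carrier (A n)"
  by (simp add: prod_carrier_iff)

interpretation A: pre_cstar_algebra "A n" for n
  by (rule pre)

lemma prod_carrierI:
  assumes "\<And>n. x n \<in> carrier (A n)" "\<And>n. cnorm (A n) (x n) \<le> K"
  shows "x \<in> carrier P"
  unfolding prod_carrier_iff by (intro conjI allI bdd_aboveI2[where M = K] assms)

lemma prod_norm_upper:
  assumes "x \<in> carrier P"
  shows "cnorm (A n) (x n) \<le> cnorm P x"
proof -
  have "bdd_above (range (\<lambda>n. cnorm (A n) (x n)))"
    using assms unfolding prod_carrier_iff by (rule conjunct2)
  then show ?thesis unfolding prod_norm_def by (rule cSUP_upper[OF UNIV_I])
qed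

lemma prod_norm_least: "(\<And>n. cnorm (A n) (x n) \<le> K) \<Longrightarrow> cnorm P x \<le> K"
  unfolding prod_norm_def by (rule cSUP_least) auto

lemma prod_norm_nonneg: "x \<in> carrier P \<Longrightarrow> 0 \<le> cnorm P x"
  using order_trans[OF A.cnorm_nonneg[of "x 0" 0] prod_norm_upper[of x 0]] prod_component[of x 0]
  by blast

lemma prod_add_mult_closed:
  assumes "x \<in> carrier P" "y \<in> carrier P"
  shows "(\<lambda>n. x n \<oplus>\<^bsub>A n\<^esub> y n) \<in> carrier P" "(\<lambda>n. x n \<otimes>\<^bsub>A n\<^esub> y n) \<in> carrier P"
proof -
  note [simp] = prod_component[OF assms(1)] prod_component[OF assms(2)]
  note ux = prod_norm_upper[OF assms(1)] and uy = prod_norm_upper[OF assms(2)]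
  show "(\<lambda>n. x n \<oplus>\<^bsub>A n\<^esub> y n) \<in> carrier P"
    by (rule prod_carrierI[where K = "cnorm P x + cnorm P y"])
      (auto intro!: order_trans[OF A.cnorm_triangle] add_mono ux uy)
  show "(\<lambda>n. x n \<otimes>\<^bsub>A n\<^esub> y n) \<in> carrier P"
    by (rule prod_carrierI[where K = "cnorm P x * cnorm P y"])
      (auto intro!: order_trans[OF A.cnorm_mult] mult_mono ux uy prod_norm_nonneg assms)
qed

lemma prod_smult_star_closed:
  assumes "x \<in> carrier P"
  shows "(\<lambda>n. c \<odot>\<^bsub>A n\<^esub> x n) \<in> carrier P" "(\<lambda>n. star (A n) (x n)) \<in> carrier P"
proof -
  note [simp] = prod_component[OF assms(1)]
  note ux = prod_norm_upper[OF assms(1)]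
  show "(\<lambda>n. c \<odot>\<^bsub>A n\<^esub> x n) \<in> carrier P"
    by (rule prod_carrierI[where K = "cmod c * cnorm P x"])
      (auto simp: A.cnorm_smult intro!: mult_left_mono ux)
  show "(\<lambda>n. star (A n) (x n)) \<in> carrier P"
    by (rule prod_carrierI[where K = "cnorm P x"]) (auto intro!: ux)
qed

lemmas prod_closed = prod_add_mult_closed prod_smult_star_closed

lemma prod_one_zero_closed: "(\<lambda>n. \<one>\<^bsub>A n\<^esub>) \<in> carrier P" "(\<lambda>n. \<zero>\<^bsub>A n\<^esub>) \<in> carrier P"
  by (rule prod_carrierI[where K = 1], auto simp: A.cnorm_one_le)+

lemma ring_prod: "ring P"
proof -
  have ag: "abelian_group P"
  proof (rule abelian_groupI)
    fix x assume x: "x \<in> carrier P"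
    have "(-1) \<odot>\<^bsub>A n\<^esub> x n \<oplus>\<^bsub>A n\<^esub> x n = \<zero>\<^bsub>A n\<^esub>" for n
      using A.smult_add_left[of "x n" n "-1" 1] x by simp
    then show "\<exists>y\<in>carrier P. y \<oplus>\<^bsub>P\<^esub> x = \<zero>\<^bsub>P\<^esub>"
      using prod_closed(3)[OF x, of "-1"] by (intro bexI[of _ "\<lambda>n. (-1) \<odot>\<^bsub>A n\<^esub> x n"]) auto
  qed (auto simp: prod_closed prod_one_zero_closed A.Alg.a_ac)
  show ?thesis
    by (rule ringI[OF ag], rule monoidI)
      (auto simp: prod_closed prod_one_zero_closed A.Alg.m_assoc A.Alg.l_distr A.Alg.r_distr)
qed

lemma module_prod: "module complex_ring P"
  by (rule moduleI[OF cring_complex_ring ring.is_abelian_group[OF ring_prod]])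
    (auto simp: prod_closed A.smult_add_left A.smult_add_right A.smult_smult)

lemma prod_minus_eq: "x \<in> carrier P \<Longrightarrow> y \<in> carrier P \<Longrightarrow> x \<ominus>\<^bsub>P\<^esub> y = (\<lambda>n. x n \<ominus>\<^bsub>A n\<^esub> y n)"
proof -
  assume x: "x \<in> carrier P" and y: "y \<in> carrier P"
  interpret M: module complex_ring P by (rule module_prod)
  have "\<ominus>\<^bsub>P\<^esub> y = (-1) \<odot>\<^bsub>P\<^esub> y"
    using M.smult_l_minus[of 1 y] M.smult_one[OF y] y by simp
  then show ?thesis
    using x y by (simp add: a_minus_def[of P] A.minus_eq_smult)
qed

lemma null_carrier: "x \<in> I \<Longrightarrow> x \<in> carrier P"
  by (simp add: null_sequences_def)

lemma null_iff: "x \<in> I \<longleftrightarrow> x \<in> carrier P \<and> (\<lambda>n. cnorm (A n) (x n)) \<longlonglongrightarrow> 0"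
  by (simp add: null_sequences_def)

lemma null_dominated:
  assumes "x \<in> carrier P" "y \<in> I" "\<And>n. cnorm (A n) (x n) \<le> K * cnorm (A n) (y n)"
  shows "x \<in> I"
  unfolding null_iff
proof (rule conjI[OF assms(1)], rule tendsto_sandwich[OF _ _ tendsto_const])
  show "(\<lambda>n. K * cnorm (A n) (y n)) \<longlonglongrightarrow> 0"
    using assms(2) tendsto_mult_right_zero unfolding null_iff by blast
qed (use assms in auto)

lemma null_add: "x \<in> I \<Longrightarrow> y \<in> I \<Longrightarrow> x \<oplus>\<^bsub>P\<^esub> y \<in> I"
proof -
  assume x: "x \<in> I" and y: "y \<in> I"
  note c = null_carrier[OF x] null_carrier[OF y]
  have "(\<lambda>n. cnorm (A n) (x n \<oplus>\<^bsub>A n\<^esub> y n)) \<longlonglongrightarrow> 0"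
  proof (rule tendsto_sandwich[OF _ _ tendsto_const])
    show "(\<lambda>n. cnorm (A n) (x n) + cnorm (A n) (y n)) \<longlonglongrightarrow> 0"
      using tendsto_add_zero x y unfolding null_iff by blast
  qed (use c in \<open>auto intro!: always_eventually A.cnorm_triangle\<close>)
  then show ?thesis using prod_closed(1)[OF c] by (simp add: null_iff)
qed

lemma null_smult: "x \<in> I \<Longrightarrow> c \<odot>\<^bsub>P\<^esub> x \<in> I"
  by (rule null_dominated[where y = x and K = "cmod c"])
    (auto simp: A.cnorm_smult prod_closed null_carrier)

lemma null_star: "x \<in> I \<Longrightarrow> star P x \<in> I"
  by (rule null_dominated[where y = x and K = 1]) (auto simp: prod_closed null_carrier)

lemma ideal_null: "ideal I P"
proof (rule idealI[OF ring_prod])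
  interpret ring P by (rule ring_prod)
  show "subgroup I (add_monoid P)"
  proof (rule add.subgroupI)
    show "I \<subseteq> carrier P" using null_carrier by blast
    have "(\<lambda>n. \<zero>\<^bsub>A n\<^esub>) \<in> I" by (simp add: null_iff prod_one_zero_closed)
    then show "I \<noteq> {}" by blast
    fix x assume x: "x \<in> I"
    interpret M: module complex_ring P by (rule module_prod)
    have "\<ominus>\<^bsub>P\<^esub> x = (-1) \<odot>\<^bsub>P\<^esub> x"
      using M.smult_l_minus[of 1 x] M.smult_one null_carrier[OF x] by simp
    then show "\<ominus>\<^bsub>P\<^esub> x \<in> I" using null_smult[OF x, of "-1"] by simp
    show "x \<oplus>\<^bsub>P\<^esub> y \<in> I" if "y \<in> I" for y using null_add[OF x that] .
  qed
  fix a x assume a: "a \<in> I" and x: "x \<in> carrier P"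
  note ac = null_carrier[OF a]
  show "x \<otimes>\<^bsub>P\<^esub> a \<in> I"
  proof (rule null_dominated[OF _ a, where K = "cnorm P x"])
    show "x \<otimes>\<^bsub>P\<^esub> a \<in> carrier P" using prod_closed(2)[OF x ac] by simp
    fix n
    have "cnorm (A n) (x n \<otimes>\<^bsub>A n\<^esub> a n) \<le> cnorm (A n) (x n) * cnorm (A n) (a n)"
      using ac x by (intro A.cnorm_mult) auto
    also have "\<dots> \<le> cnorm P x * cnorm (A n) (a n)"
      using ac by (intro mult_right_mono prod_norm_upper x) auto
    finally show "cnorm (A n) ((x \<otimes>\<^bsub>P\<^esub> a) n) \<le> cnorm P x * cnorm (A n) (a n)" by simp
  qed
  show "a \<otimes>\<^bsub>P\<^esub> x \<in> I"
  proof (rule null_dominated[OF _ a, where K = "cnorm P x"])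
    show "a \<otimes>\<^bsub>P\<^esub> x \<in> carrier P" using prod_closed(2)[OF ac x] by simp
    fix n
    have "cnorm (A n) (a n \<otimes>\<^bsub>A n\<^esub> x n) \<le> cnorm (A n) (a n) * cnorm (A n) (x n)"
      using ac x by (intro A.cnorm_mult) auto
    also have "\<dots> \<le> cnorm (A n) (a n) * cnorm P x"
      using ac by (intro mult_left_mono prod_norm_upper x) auto
    finally show "cnorm (A n) ((a \<otimes>\<^bsub>P\<^esub> x) n) \<le> cnorm P x * cnorm (A n) (a n)" by (simp add: mult.commute)
  qed
qed

text \<open>The class of a bounded sequence.\<close>
abbreviation cl :: "(nat \<Rightarrow> 'a) \<Rightarrow> (nat \<Rightarrow> 'a) set" where
  "cl x \<equiv> I +>\<^bsub>P\<^esub> x"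

lemma cl_eq_iff:
  "\<lbrakk>x \<in> carrier P; y \<in> carrier P\<rbrakk> \<Longrightarrow> cl x = cl y \<longleftrightarrow> (\<lambda>n. x n \<ominus>\<^bsub>A n\<^esub> y n) \<in> I"
  using ring.quotient_eq_iff_same_a_r_cos[OF ring_prod ideal_null, of x y]
  by (simp add: prod_minus_eq)

lemma cl_eqI_eventually:
  assumes "x \<in> carrier P" "y \<in> carrier P" "eventually (\<lambda>n. x n = y n) sequentially"
  shows "cl x = cl y"
proof -
  have "eventually (\<lambda>n. cnorm (A n) (x n \<ominus>\<^bsub>A n\<^esub> y n) = 0) sequentially"
    using assms(3) by eventually_elim (use assms in \<open>simp add: A.cnorm_eq_zero_iff A.minus_eq_zero_iff\<close>)
  then have "(\<lambda>n. cnorm (A n) (x n \<ominus>\<^bsub>A n\<^esub> y n)) \<longlonglongrightarrow> 0" by (rule tendsto_eventually)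
  moreover have "(\<lambda>n. x n \<ominus>\<^bsub>A n\<^esub> y n) \<in> carrier P"
    using ring.ring_simprules(4)[OF ring_prod, of x y] assms by (simp add: prod_minus_eq)
  ultimately show ?thesis using assms by (simp add: cl_eq_iff null_iff)
qed

lemma mem_cl_iff:
  assumes "x \<in> carrier P"
  shows "y \<in> cl x \<longleftrightarrow> y \<in> carrier P \<and> cl y = cl x"
proof -
  interpret ring P by (rule ring_prod)
  interpret ideal I P by (rule ideal_null)
  show ?thesis
    using a_repr_independence[OF _ assms a_subgroup] a_rcos_self[of y]
      a_r_coset_subset_G[OF a_subset assms] by blast
qed

lemma quot_carrier: "carrier Q = cl ` carrier P"
  unfolding cstar_quot_def FactRing_def A_RCOSETS_def' by auto

lemma quot_one_zero: "\<one>\<^bsub>Q\<^esub> = cl (\<lambda>n. \<one>\<^bsub>A n\<^esub>)" "\<zero>\<^bsub>Q\<^esub> = cl (\<lambda>n. \<zero>\<^bsub>A n\<^esub>)"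
proof -
  interpret ring P by (rule ring_prod)
  interpret ideal I P by (rule ideal_null)
  show "\<one>\<^bsub>Q\<^esub> = cl (\<lambda>n. \<one>\<^bsub>A n\<^esub>)" by (simp add: cstar_quot_def FactRing_def)
  show "\<zero>\<^bsub>Q\<^esub> = cl (\<lambda>n. \<zero>\<^bsub>A n\<^esub>)"
    using a_coset_add_zero[OF a_subset] by (simp add: cstar_quot_def FactRing_def)
qed

lemma quot_ops:
  assumes x: "x \<in> carrier P" and y: "y \<in> carrier P"
  shows "cl x \<oplus>\<^bsub>Q\<^esub> cl y = cl (\<lambda>n. x n \<oplus>\<^bsub>A n\<^esub> y n)" "cl x \<otimes>\<^bsub>Q\<^esub> cl y = cl (\<lambda>n. x n \<otimes>\<^bsub>A n\<^esub> y n)"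
proof -
  interpret ring P by (rule ring_prod)
  interpret ideal I P by (rule ideal_null)
  show "cl x \<oplus>\<^bsub>Q\<^esub> cl y = cl (\<lambda>n. x n \<oplus>\<^bsub>A n\<^esub> y n)"
    using a_rcos_sum[OF x y] by (simp add: cstar_quot_def FactRing_def)
  show "cl x \<otimes>\<^bsub>Q\<^esub> cl y = cl (\<lambda>n. x n \<otimes>\<^bsub>A n\<^esub> y n)"
    using rcoset_mult_add[OF x y] by (simp add: cstar_quot_def FactRing_def)
qed

lemma cl_UN_eq:
  assumes "x \<in> carrier P" "\<And>y. y \<in> cl x \<Longrightarrow> F y = F x"
  shows "(\<Union>y\<in>cl x. F y) = F x"
proof -
  have "x \<in> cl x" using assms(1) by (simp add: mem_cl_iff)
  then show ?thesis using assms(2) by blast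
qed

lemma quot_smult:
  assumes x: "x \<in> carrier P"
  shows "c \<odot>\<^bsub>Q\<^esub> cl x = cl (\<lambda>n. c \<odot>\<^bsub>A n\<^esub> x n)"
proof -
  have "cl (c \<odot>\<^bsub>P\<^esub> y) = cl (c \<odot>\<^bsub>P\<^esub> x)" if "y \<in> cl x" for y
  proof -
    have y: "y \<in> carrier P" "(\<lambda>n. y n \<ominus>\<^bsub>A n\<^esub> x n) \<in> I"
      using that x by (auto simp: mem_cl_iff cl_eq_iff)
    have "(\<lambda>n. c \<odot>\<^bsub>A n\<^esub> y n \<ominus>\<^bsub>A n\<^esub> c \<odot>\<^bsub>A n\<^esub> x n) \<in> I"
      using null_smult[OF y(2), of c] y x by (simp add: A.smult_minus_right)
    then show ?thesis using x y by (simp add: cl_eq_iff prod_closed)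
  qed
  then show ?thesis
    using cl_UN_eq[OF x, of "\<lambda>y. cl (c \<odot>\<^bsub>P\<^esub> y)"] by (simp add: cstar_quot_def)
qed

lemma quot_star:
  assumes x: "x \<in> carrier P"
  shows "star Q (cl x) = cl (\<lambda>n. star (A n) (x n))"
proof -
  have "cl (star P y) = cl (star P x)" if "y \<in> cl x" for y
  proof -
    have y: "y \<in> carrier P" "(\<lambda>n. y n \<ominus>\<^bsub>A n\<^esub> x n) \<in> I"
      using that x by (auto simp: mem_cl_iff cl_eq_iff)
    have "(\<lambda>n. star (A n) (y n) \<ominus>\<^bsub>A n\<^esub> star (A n) (x n)) \<in> I"
      using null_star[OF y(2)] y x by (simp add: A.star_minus)
    then show ?thesis using x y by (simp add: cl_eq_iff prod_closed)
  qed
  then show ?thesis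
    using cl_UN_eq[OF x, of "\<lambda>y. cl (star P y)"] by (simp add: cstar_quot_def)
qed

lemma quot_norm_def: "cnorm Q X = (INF x\<in>X. cnorm P x)"
  by (simp add: cstar_quot_def)

text \<open>
  The quotient norm is the limit superior of the norms of the terms; this is the content of the next
  two lemmas.
\<close>
lemma quot_norm_le:
  assumes x: "x \<in> carrier P" and r: "0 \<le> r"
    and ev: "eventually (\<lambda>n. cnorm (A n) (x n) \<le> r) sequentially"
  shows "cnorm Q (cl x) \<le> r"
proof -
  obtain N where N: "\<And>n. n \<ge> N \<Longrightarrow> cnorm (A n) (x n) \<le> r"
    using ev by (auto simp: eventually_sequentially)
  define y where "y n = (if n \<ge> N then x n else \<zero>\<^bsub>A n\<^esub>)" for n
  have yr: "cnorm (A n) (y n) \<le> r" for n using N r by (simp add: y_def)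
  have y: "y \<in> carrier P"
    using x by (intro prod_carrierI[OF _ yr]) (auto simp: y_def)
  have "cl y = cl x"
    by (rule cl_eqI_eventually[OF y x]) (auto simp: y_def eventually_sequentially)
  then have "y \<in> cl x" using y x by (simp add: mem_cl_iff)
  then have "cnorm Q (cl x) \<le> cnorm P y"
    unfolding quot_norm_def
    using x by (intro cINF_lower bdd_belowI2[where m = 0]) (auto simp: mem_cl_iff prod_norm_nonneg)
  also have "\<dots> \<le> r" by (rule prod_norm_least) (rule yr)
  finally show ?thesis .
qed

lemma quot_norm_less_imp_eventually:
  assumes x: "x \<in> carrier P" and r: "cnorm Q (cl x) < r"
  shows "eventually (\<lambda>n. cnorm (A n) (x n) < r) sequentially"
proof -
  have "x \<in> cl x" using x by (simp add: mem_cl_iff)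
  then have "\<exists>y\<in>cl x. cnorm P y < r"
    using r unfolding quot_norm_def
    by (subst (asm) cINF_less_iff) (auto simp: mem_cl_iff[OF x] prod_norm_nonneg intro!: bdd_belowI2[where m = 0])
  then obtain y where y: "y \<in> carrier P" "cl x = cl y" "cnorm P y < r"
    using mem_cl_iff[OF x] by auto
  then have "(\<lambda>n. cnorm (A n) (x n \<ominus>\<^bsub>A n\<^esub> y n)) \<longlonglongrightarrow> 0"
    using x by (simp add: cl_eq_iff null_iff)
  then have "eventually (\<lambda>n. cnorm (A n) (x n \<ominus>\<^bsub>A n\<^esub> y n) < r - cnorm P y) sequentially"
    by (rule order_tendstoD) (use y in simp)
  then show ?thesis
  proof eventually_elim
    case (elim n)
    then show ?case
      using A.cnorm_diff_le[of "x n" n "y n"] prod_norm_upper[OF y(1), of n] x y by simp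
  qed
qed

lemma quot_norm_nonneg: "x \<in> carrier P \<Longrightarrow> 0 \<le> cnorm Q (cl x)"
  unfolding quot_norm_def
  by (rule cINF_greatest) (auto simp: mem_cl_iff prod_norm_nonneg)

theorem pre_cstar_quot: "pre_cstar_algebra Q"
proof -
  note cl = quot_ops quot_smult quot_star quot_one_zero prod_closed prod_one_zero_closed
  have ag: "abelian_group Q"
  proof (rule abelian_groupI; (unfold quot_carrier)?)
    fix X assume "X \<in> cl ` carrier P"
    then obtain x where x: "x \<in> carrier P" "X = cl x" by auto
    have "(-1) \<odot>\<^bsub>A n\<^esub> x n \<oplus>\<^bsub>A n\<^esub> x n = \<zero>\<^bsub>A n\<^esub>" for n
      using A.smult_add_left[of "x n" n "-1" 1] x by simp
    then show "\<exists>Y\<in>cl ` carrier P. Y \<oplus>\<^bsub>Q\<^esub> X = \<zero>\<^bsub>Q\<^esub>"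
      using x by (intro bexI[of _ "cl (\<lambda>n. (-1) \<odot>\<^bsub>A n\<^esub> x n)"]) (auto simp: cl)
  qed (auto simp: cl A.Alg.a_ac)
  have rg: "ring Q"
    by (rule ringI[OF ag], rule monoidI)
      (auto simp: quot_carrier cl A.Alg.m_assoc A.Alg.l_distr A.Alg.r_distr)
  have md: "module complex_ring Q"
    by (rule moduleI[OF cring_complex_ring ag])
      (auto simp: quot_carrier cl A.smult_add_left A.smult_add_right A.smult_smult)
  have star_le: "cnorm Q (cl (\<lambda>n. star (A n) (x n))) \<le> cnorm Q (cl x)" if x: "x \<in> carrier P" for x
  proof (rule dense_ge)
    fix r assume "cnorm Q (cl x) < r"
    then have "eventually (\<lambda>n. cnorm (A n) (x n) < r) sequentially" "0 \<le> r"
      using quot_norm_less_imp_eventually[OF x] quot_norm_nonneg[OF x] by auto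
    then show "cnorm Q (cl (\<lambda>n. star (A n) (x n))) \<le> r"
      using x by (intro quot_norm_le) (auto simp: prod_closed elim: eventually_mono)
  qed
  have mult_le: "cnorm Q (cl (\<lambda>n. x n \<otimes>\<^bsub>A n\<^esub> y n)) \<le> cnorm Q (cl x) * cnorm Q (cl y)"
    if x: "x \<in> carrier P" and y: "y \<in> carrier P" for x y
  proof (rule le_mult_by_upper_approximations)
    fix r s assume rs: "cnorm Q (cl x) < r" "cnorm Q (cl y) < s"
    have "eventually (\<lambda>n. cnorm (A n) (x n) < r \<and> cnorm (A n) (y n) < s) sequentially"
      using quot_norm_less_imp_eventually[OF x rs(1)] quot_norm_less_imp_eventually[OF y rs(2)]
      by (rule eventually_conj)
    moreover have rs0: "0 \<le> r" "0 \<le> s"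
      using quot_norm_nonneg[OF x] quot_norm_nonneg[OF y] rs by auto
    moreover have "cnorm (A n) (x n \<otimes>\<^bsub>A n\<^esub> y n) \<le> r * s"
      if "cnorm (A n) (x n) < r \<and> cnorm (A n) (y n) < s" for n
      by (rule order_trans[OF A.cnorm_mult]) (use x y that rs0 in \<open>auto intro!: mult_mono\<close>)
    ultimately show "cnorm Q (cl (\<lambda>n. x n \<otimes>\<^bsub>A n\<^esub> y n)) \<le> r * s"
      using x y by (intro quot_norm_le) (auto simp: prod_closed elim!: eventually_mono)
  qed
  have smult_le: "cnorm Q (cl (\<lambda>n. c \<odot>\<^bsub>A n\<^esub> x n)) \<le> cmod c * cnorm Q (cl x)"
    if x: "x \<in> carrier P" for x c
  proof (rule le_mult_by_upper_approximations)
    fix r s assume rs: "cmod c < r" "cnorm Q (cl x) < s"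
    have rs0: "0 \<le> r" "0 \<le> s" using quot_norm_nonneg[OF x] rs norm_ge_zero[of c] by linarith+
    have "eventually (\<lambda>n. cnorm (A n) (c \<odot>\<^bsub>A n\<^esub> x n) \<le> r * s) sequentially"
      using quot_norm_less_imp_eventually[OF x rs(2)]
      by eventually_elim (use x rs rs0 in \<open>auto simp: A.cnorm_smult intro!: mult_mono\<close>)
    then show "cnorm Q (cl (\<lambda>n. c \<odot>\<^bsub>A n\<^esub> x n)) \<le> r * s"
      using x rs0 by (intro quot_norm_le) (auto simp: prod_closed)
  qed
  have smult_eq: "cnorm Q (cl (\<lambda>n. c \<odot>\<^bsub>A n\<^esub> x n)) = cmod c * cnorm Q (cl x)"
    if x: "x \<in> carrier P" for x c
  proof (cases "c = 0")
    case True
    then show ?thesis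
      using smult_le[OF x, of c] quot_norm_nonneg[OF prod_closed(3)[OF x], of c] by simp
  next
    case False
    have "(\<lambda>n. inverse c \<odot>\<^bsub>A n\<^esub> (c \<odot>\<^bsub>A n\<^esub> x n)) = x"
      using False x by (simp add: A.smult_smult)
    then have "cnorm Q (cl x) \<le> cmod (inverse c) * cnorm Q (cl (\<lambda>n. c \<odot>\<^bsub>A n\<^esub> x n))"
      using smult_le[OF prod_closed(3)[OF x, of c], of "inverse c"] by simp
    then have "cmod c * cnorm Q (cl x) \<le> cnorm Q (cl (\<lambda>n. c \<odot>\<^bsub>A n\<^esub> x n))"
      using False by (simp add: norm_inverse norm_divide field_simps)
    then show ?thesis using smult_le[OF x, of c] by simp
  qed
  have tri: "cnorm Q (cl (\<lambda>n. x n \<oplus>\<^bsub>A n\<^esub> y n)) \<le> cnorm Q (cl x) + cnorm Q (cl y)"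
    if x: "x \<in> carrier P" and y: "y \<in> carrier P" for x y
  proof (rule field_le_epsilon)
    fix e :: real assume e: "0 < e"
    have "eventually (\<lambda>n. cnorm (A n) (x n) < cnorm Q (cl x) + e/2
        \<and> cnorm (A n) (y n) < cnorm Q (cl y) + e/2) sequentially"
      using e by (intro eventually_conj quot_norm_less_imp_eventually x y) auto
    then have "eventually (\<lambda>n. cnorm (A n) (x n \<oplus>\<^bsub>A n\<^esub> y n)
        \<le> cnorm Q (cl x) + cnorm Q (cl y) + e) sequentially"
    proof eventually_elim
      case (elim n)
      then show ?case using A.cnorm_triangle[of "x n" n "y n"] x y by simp
    qed
    then show "cnorm Q (cl (\<lambda>n. x n \<oplus>\<^bsub>A n\<^esub> y n)) \<le> cnorm Q (cl x) + cnorm Q (cl y) + e"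
      using x y e quot_norm_nonneg[OF x] quot_norm_nonneg[OF y]
      by (intro quot_norm_le) (auto simp: prod_closed)
  qed
  have zero: "cnorm Q (cl x) = 0 \<longleftrightarrow> cl x = cl (\<lambda>n. \<zero>\<^bsub>A n\<^esub>)" if x: "x \<in> carrier P" for x
  proof
    assume 0: "cnorm Q (cl x) = 0"
    have "(\<lambda>n. cnorm (A n) (x n)) \<longlonglongrightarrow> 0"
    proof (rule tendstoI)
      fix e :: real assume "0 < e"
      then have "eventually (\<lambda>n. cnorm (A n) (x n) < e) sequentially"
        using quot_norm_less_imp_eventually[OF x] 0 by simp
      then show "eventually (\<lambda>n. dist (cnorm (A n) (x n)) 0 < e) sequentially"
        by eventually_elim (use x in simp)
    qed
    moreover have "x n \<ominus>\<^bsub>A n\<^esub> \<zero>\<^bsub>A n\<^esub> = x n" for n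
      using x by (simp add: A.minus_eq_smult)
    ultimately show "cl x = cl (\<lambda>n. \<zero>\<^bsub>A n\<^esub>)"
      using x by (simp add: cl_eq_iff prod_one_zero_closed null_iff)
  next
    assume "cl x = cl (\<lambda>n. \<zero>\<^bsub>A n\<^esub>)"
    moreover have "cnorm Q (cl (\<lambda>n. \<zero>\<^bsub>A n\<^esub>)) \<le> 0"
      by (rule quot_norm_le) (auto simp: prod_one_zero_closed)
    ultimately show "cnorm Q (cl x) = 0" using quot_norm_nonneg[OF x] by simp
  qed
  have ci: "cnorm Q (cl (\<lambda>n. star (A n) (x n) \<otimes>\<^bsub>A n\<^esub> x n)) = (cnorm Q (cl x))\<^sup>2"
    if x: "x \<in> carrier P" for x
  proof (rule antisym)
    have "cnorm Q (cl (\<lambda>n. star (A n) (x n) \<otimes>\<^bsub>A n\<^esub> x n))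
        \<le> cnorm Q (cl (\<lambda>n. star (A n) (x n))) * cnorm Q (cl x)"
      using mult_le[OF prod_closed(4)[OF x] x] .
    also have "\<dots> \<le> cnorm Q (cl x) * cnorm Q (cl x)"
      by (rule mult_right_mono[OF star_le[OF x] quot_norm_nonneg[OF x]])
    finally show "cnorm Q (cl (\<lambda>n. star (A n) (x n) \<otimes>\<^bsub>A n\<^esub> x n)) \<le> (cnorm Q (cl x))\<^sup>2"
      by (simp add: power2_eq_square)
    let ?y = "\<lambda>n. star (A n) (x n) \<otimes>\<^bsub>A n\<^esub> x n"
    have y: "?y \<in> carrier P" using x by (intro prod_closed)
    show "(cnorm Q (cl x))\<^sup>2 \<le> cnorm Q (cl ?y)"
    proof (rule dense_ge)
      fix r assume r: "cnorm Q (cl ?y) < r"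
      have r0: "0 \<le> r" using r quot_norm_nonneg[OF y] by simp
      have "eventually (\<lambda>n. cnorm (A n) (x n) \<le> sqrt r) sequentially"
        using quot_norm_less_imp_eventually[OF y r]
        by eventually_elim (use x in \<open>simp add: A.cstar_identity real_le_rsqrt\<close>)
      then have "cnorm Q (cl x) \<le> sqrt r" using x r0 by (intro quot_norm_le) auto
      then have "(cnorm Q (cl x))\<^sup>2 \<le> (sqrt r)\<^sup>2"
        using quot_norm_nonneg[OF x] by (rule power_mono)
      then show "(cnorm Q (cl x))\<^sup>2 \<le> r" using r0 by simp
    qed
  qed
  show ?thesis
    by (intro pre_cstar_algebra.intro rg md, unfold_locales)
      (auto simp: quot_carrier cl A.smult_mult_left A.smult_mult_right A.star_add A.star_smult
        A.star_mult quot_norm_nonneg zero smult_eq tri mult_le ci)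
qed

end

section \<open>UHF-algebras as closures of increasing matrix algebras\<close>

text \<open>
  The nonzero algebra \<open>D\<close> is the closure of the union of an increasing sequence of unital matrix
  subalgebras, the images of unital homomorphisms \<open>e i\<close> from \<open>M\<^bsub>k i\<^esub>\<close>. The sizes are required to divide
  each other, and the connecting maps are left implicit as inclusions between the images.
\<close>
definition matrix_tower ::
  "'a cstar \<Rightarrow> (nat \<Rightarrow> nat) \<Rightarrow> (nat \<Rightarrow> complex mat \<Rightarrow> 'a) \<Rightarrow> bool" where
  "matrix_tower D k e \<longleftrightarrow> \<one>\<^bsub>D\<^esub> \<noteq> \<zero>\<^bsub>D\<^esub> \<and> (\<forall>i. 0 < k i \<and> k i dvd k (Suc i)) \<and>
     (\<forall>i. unital_star_hom (mat_cstar (k i)) D (e i)) \<and>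
     (\<forall>i. e i ` carrier_mat (k i) (k i) \<subseteq> e (Suc i) ` carrier_mat (k (Suc i)) (k (Suc i))) \<and>
     (\<forall>x\<in>carrier D. \<forall>\<epsilon>>0. \<exists>i. \<exists>a\<in>carrier_mat (k i) (k i). cnorm D (x \<ominus>\<^bsub>D\<^esub> e i a) < \<epsilon>)"

lemma matrix_towerD:
  assumes "matrix_tower D k e"
  shows "\<one>\<^bsub>D\<^esub> \<noteq> \<zero>\<^bsub>D\<^esub>" "0 < k i" "k i dvd k (Suc i)" "unital_star_hom (mat_cstar (k i)) D (e i)"
    "e i ` carrier_mat (k i) (k i) \<subseteq> e (Suc i) ` carrier_mat (k (Suc i)) (k (Suc i))"
  using assms by (auto simp: matrix_tower_def)

lemma matrix_tower_dense:
  assumes "matrix_tower D k e" "x \<in> carrier D" "0 < \<epsilon>"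
  obtains i a where "a \<in> carrier_mat (k i) (k i)" "cnorm D (x \<ominus>\<^bsub>D\<^esub> e i a) < \<epsilon>"
  using assms unfolding matrix_tower_def by blast

lemma matrix_tower_mono:
  assumes "matrix_tower D k e" "i \<le> j"
  shows "e i ` carrier_mat (k i) (k i) \<subseteq> e j ` carrier_mat (k j) (k j)" "k i dvd k j"
  using assms(2)
proof (induction j rule: dec_induct)
  case (step n)
  { case 1 then show ?case using step matrix_towerD(5)[OF assms(1), of n] by blast }
  { case 2 then show ?case using step matrix_towerD(3)[OF assms(1), of n] by (blast intro: dvd_trans) }
qed auto

subsection \<open>The inductive limit\<close>

text \<open>The data defining a UHF-algebra, without the divisibility of the matrix sizes.\<close>
locale matrix_sequence =
  fixes k :: "nat \<Rightarrow> nat" and \<phi> :: "nat \<Rightarrow> complex mat \<Rightarrow> complex mat"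
  assumes pos: "\<And>i. 0 < k i"
    and hom: "\<And>i. unital_star_hom (mat_cstar (k i)) (mat_cstar (k (Suc i))) (\<phi> i)"
begin

interpretation pre_cstar_sequence "\<lambda>i. mat_cstar (k i)"
  by (rule pre_cstar_sequence.intro) (rule pre_cstar_mat)

lemma connecting_hom:
  "unital_star_hom (mat_cstar (k i)) (mat_cstar (k (i + n))) (connecting \<phi> i n)"
proof (induction n)
  case 0
  show ?case by (rule unital_star_homI) auto
next
  case (Suc n)
  show ?case using unital_star_hom_comp[OF Suc hom[of "i + n"]] by (simp add: o_def)
qed

lemma connecting_Suc: "connecting \<phi> i (Suc n) a = connecting \<phi> (Suc i) n (\<phi> i a)"
  by (induction n) auto

lemma connecting_opnorm:
  "a \<in> carrier_mat (k i) (k i) \<Longrightarrow> opnorm (k (i + n)) (connecting \<phi> i n a) \<le> opnorm (k i) a"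
  using unital_star_hom_contractive[OF cstar_mat pre_cstar_mat connecting_hom] by simp

text \<open>The sequence of the images of \<open>a \<in> M\<^bsub>k i\<^esub>\<close> in the later algebras, preceded by zeros.\<close>
definition thread :: "nat \<Rightarrow> complex mat \<Rightarrow> nat \<Rightarrow> complex mat" where
  "thread i a j = (if i \<le> j then connecting \<phi> i (j - i) a else 0\<^sub>m (k j) (k j))"

lemma thread_tail: "thread i a (i + n) = connecting \<phi> i n a"
  by (simp add: thread_def)

lemma limit_map_eq: "limit_map (\<lambda>i. mat_cstar (k i)) \<phi> i a = cl (thread i a)"
  by (simp add: limit_map_def thread_def[abs_def] cong: if_cong)

lemma thread_carrier:
  assumes "a \<in> carrier_mat (k i) (k i)"
  shows "thread i a \<in> carrier P"
proof (rule prod_carrierI[where K = "opnorm (k i) a"])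
  fix j
  have 1: "connecting \<phi> i (j - i) a \<in> carrier_mat (k j) (k j)" if "i \<le> j"
    using unital_star_homD(1)[OF connecting_hom[of i "j - i"], of a] assms that by simp
  then show "thread i a j \<in> carrier (mat_cstar (k j))" by (simp add: thread_def)
  have "opnorm (k j) (0\<^sub>m (k j) (k j)) = 0" using opnorm_eq_0_iff[of "0\<^sub>m (k j) (k j)" "k j"] by simp
  then show "opnorm (k j) (thread i a j) \<le> opnorm (k i) a"
    using connecting_opnorm[OF assms, of "j - i"] opnorm_nonneg[OF assms] by (auto simp: thread_def)
qed

abbreviation lim :: "nat \<Rightarrow> complex mat \<Rightarrow> (nat \<Rightarrow> complex mat) set" where
  "lim \<equiv> limit_map (\<lambda>i. mat_cstar (k i)) \<phi>"

lemma lim_hom: "unital_star_hom (mat_cstar (k i)) Q (lim i)"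
proof (rule unital_star_homI; (unfold mat_cstar_simps limit_map_eq)?)
  fix a b :: "complex mat" and c :: complex
  assume a: "a \<in> carrier_mat (k i) (k i)"
  note c = unital_star_homD[OF connecting_hom[of i], simplified]
  show "cl (thread i a) \<in> carrier Q"
    unfolding quot_carrier using thread_carrier[OF a] by (rule imageI)
  have "thread i (c \<cdot>\<^sub>m a) = (\<lambda>n. c \<odot>\<^bsub>mat_cstar (k n)\<^esub> thread i a n)"
    using a by (auto simp: thread_def c)
  then show "cl (thread i (c \<cdot>\<^sub>m a)) = c \<odot>\<^bsub>Q\<^esub> cl (thread i a)"
    using thread_carrier[OF a] by (simp add: quot_smult)
  have "thread i (mat_adjoint a) = (\<lambda>n. star (mat_cstar (k n)) (thread i a n))"
    using a pre_cstar_algebra.star_zero[OF pre_cstar_mat] by (auto simp: thread_def c)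
  then show "cl (thread i (mat_adjoint a)) = star Q (cl (thread i a))"
    using thread_carrier[OF a] by (simp add: quot_star)
  assume b: "b \<in> carrier_mat (k i) (k i)"
  have "thread i (a * b) = (\<lambda>n. thread i a n \<otimes>\<^bsub>mat_cstar (k n)\<^esub> thread i b n)"
    using a b by (auto simp: thread_def c)
  then show "cl (thread i (a * b)) = cl (thread i a) \<otimes>\<^bsub>Q\<^esub> cl (thread i b)"
    using thread_carrier[OF a] thread_carrier[OF b] by (simp add: quot_ops)
  have "thread i (a + b) = (\<lambda>n. thread i a n \<oplus>\<^bsub>mat_cstar (k n)\<^esub> thread i b n)"
    using a b by (auto simp: thread_def c)
  then show "cl (thread i (a + b)) = cl (thread i a) \<oplus>\<^bsub>Q\<^esub> cl (thread i b)"
    using thread_carrier[OF a] thread_carrier[OF b] by (simp add: quot_ops)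
next
  have "eventually (\<lambda>n. thread i (1\<^sub>m (k i)) n = \<one>\<^bsub>mat_cstar (k n)\<^esub>) sequentially"
    using eventually_ge_at_top[of i]
  proof eventually_elim
    case (elim n)
    then show ?case
      using unital_star_homD(4)[OF connecting_hom[of i "n - i"]] by (simp add: thread_def)
  qed
  then show "cl (thread i (1\<^sub>m (k i))) = \<one>\<^bsub>Q\<^esub>"
    unfolding quot_one_zero
    by (intro cl_eqI_eventually) (auto simp: thread_carrier prod_one_zero_closed(1)[simplified])
qed

lemma lim_connecting:
  assumes "a \<in> carrier_mat (k i) (k i)"
  shows "lim (i + n) (connecting \<phi> i n a) = lim i a"
proof (induction n)
  case (Suc n)
  have b: "connecting \<phi> i n a \<in> carrier_mat (k (i + n)) (k (i + n))" for n
    using unital_star_homD(1)[OF connecting_hom[of i n]] assms by simp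
  have "lim (i + Suc n) (connecting \<phi> i (Suc n) a) = lim (i + n) (connecting \<phi> i n a)"
    unfolding limit_map_eq
  proof (rule cl_eqI_eventually[OF thread_carrier[OF b] thread_carrier[OF b]])
    show "eventually (\<lambda>j. thread (i + Suc n) (connecting \<phi> i (Suc n) a) j
        = thread (i + n) (connecting \<phi> i n a) j) sequentially"
      using eventually_ge_at_top[of "i + Suc n"]
    proof eventually_elim
      case (elim j)
      then obtain m where m: "j = Suc (i + n) + m" by (metis add_Suc_right le_Suc_ex)
      show ?case
        unfolding m using thread_tail[of "Suc (i + n)" _ m] thread_tail[of "i + n" _ "Suc m"]
          connecting_Suc[of "i + n" m] by simp
    qed
  qed
  then show ?case using Suc by simp
qed simp

lemma quot_one_nonzero: "\<one>\<^bsub>Q\<^esub> \<noteq> \<zero>\<^bsub>Q\<^esub>"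
proof
  assume "\<one>\<^bsub>Q\<^esub> = \<zero>\<^bsub>Q\<^esub>"
  then have "(\<lambda>n. \<one>\<^bsub>mat_cstar (k n)\<^esub> \<ominus>\<^bsub>mat_cstar (k n)\<^esub> \<zero>\<^bsub>mat_cstar (k n)\<^esub>) \<in> I"
    unfolding quot_one_zero using cl_eq_iff prod_one_zero_closed by blast
  then have "(\<lambda>n. opnorm (k n) (1\<^sub>m (k n) - 0\<^sub>m (k n) (k n))) \<longlonglongrightarrow> 0"
    unfolding null_iff by (simp add: mat_cstar_minus)
  moreover have "opnorm (k n) (1\<^sub>m (k n) - 0\<^sub>m (k n) (k n)) = 1" for n
  proof -
    interpret pre_cstar_algebra "mat_cstar (k n)" by (rule pre_cstar_mat)
    have "(1\<^sub>m (k n) :: complex mat) $$ (0, 0) \<noteq> 0\<^sub>m (k n) (k n) $$ (0, 0)" using pos[of n] by simp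
    then have "(1\<^sub>m (k n) :: complex mat) \<noteq> 0\<^sub>m (k n) (k n)" by metis
    moreover have "1\<^sub>m (k n) - 0\<^sub>m (k n) (k n) = (1\<^sub>m (k n) :: complex mat)" by auto
    ultimately show ?thesis using cnorm_one by simp
  qed
  ultimately show False by (simp add: LIMSEQ_const_iff)
qed

lemma inductive_limit_eq:
  "inductive_limit (\<lambda>i. mat_cstar (k i)) \<phi> =
    Q\<lparr>carrier := (cstar_topology Q) closure_of (\<Union>i. lim i ` carrier_mat (k i) (k i))\<rparr>"
  by (simp add: inductive_limit_def Let_def)

lemma lim_image_subset: "(\<Union>i. lim i ` carrier_mat (k i) (k i)) \<subseteq> carrier Q"
  using unital_star_homD(1)[OF lim_hom] by auto

text \<open>
  The isomorphism \<open>h\<close> is contractive as a map into the quotient, which need not be known to be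
  complete. Its inverse is only seen to be contractive on the union of the matrix algebras; density of
  their images in \<open>D\<close> then follows from completeness of \<open>D\<close>.
\<close>
theorem matrix_tower_of_limit_iso:
  assumes D: "unital_cstar_algebra D"
    and h: "unital_star_hom D (inductive_limit (\<lambda>i. mat_cstar (k i)) \<phi>) h"
      "bij_betw h (carrier D) (carrier (inductive_limit (\<lambda>i. mat_cstar (k i)) \<phi>))"
    and dvd: "\<And>i. k i dvd k (Suc i)"
  shows "\<exists>e. matrix_tower D k e"
proof -
  interpret D: pre_cstar_algebra D by (rule unital_cstar_imp_pre_cstar[OF D])
  interpret Q: pre_cstar_algebra Q by (rule pre_cstar_quot)
  note complete = unital_cstar_algebra.complete[OF D]
  define L where "L = (cstar_topology Q) closure_of (\<Union>i. lim i ` carrier_mat (k i) (k i))"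
  have L_iff: "X \<in> L \<longleftrightarrow> X \<in> carrier Q \<and>
      (\<forall>\<epsilon>>0. \<exists>Y\<in>(\<Union>i. lim i ` carrier_mat (k i) (k i)). cnorm Q (X \<ominus>\<^bsub>Q\<^esub> Y) < \<epsilon>)" for X
    unfolding L_def by (rule Q.closure_of_iff[OF lim_image_subset])
  have LQ: "L \<subseteq> carrier Q" using L_iff by blast
  have limQ: "lim i a \<in> carrier Q" if "a \<in> carrier_mat (k i) (k i)" for i a
    using unital_star_homD(1)[OF lim_hom] that by simp
  have limL: "lim i a \<in> L" if a: "a \<in> carrier_mat (k i) (k i)" for i a
    unfolding L_iff
  proof (intro conjI allI impI)
    fix \<epsilon> :: real assume "0 < \<epsilon>"
    have "lim i a \<ominus>\<^bsub>Q\<^esub> lim i a = \<zero>\<^bsub>Q\<^esub>" using Q.minus_eq_zero_iff limQ[OF a] by blast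
    then have "cnorm Q (lim i a \<ominus>\<^bsub>Q\<^esub> lim i a) < \<epsilon>"
      using \<open>0 < \<epsilon>\<close> Q.cnorm_zero by simp
    then show "\<exists>Y\<in>(\<Union>i. lim i ` carrier_mat (k i) (k i)). cnorm Q (lim i a \<ominus>\<^bsub>Q\<^esub> Y) < \<epsilon>"
      using a by blast
  qed (rule limQ[OF a])
  have hQ: "unital_star_hom D Q h"
    using unital_star_hom_subalgebra_codomain[OF _ LQ] h(1) unfolding inductive_limit_eq L_def .
  have hbij: "bij_betw h (carrier D) L" using h(2) by (simp add: inductive_limit_eq L_def)
  have hinj: "inj_on h (carrier D)" using hbij by (rule bij_betw_imp_inj_on)
  note hD = unital_star_homD[OF hQ]
  have h_minus: "h (x \<ominus>\<^bsub>D\<^esub> y) = h x \<ominus>\<^bsub>Q\<^esub> h y" if "x \<in> carrier D" "y \<in> carrier D" for x y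
    using unital_star_hom_zero_minus(2)[OF D.pre_cstar_algebra_axioms Q.pre_cstar_algebra_axioms hQ that] .
  define e where "e i a = inv_into (carrier D) h (lim i a)" for i a
  have e: "e i a \<in> carrier D" "h (e i a) = lim i a" if "a \<in> carrier_mat (k i) (k i)" for i a
    using bij_betw_inv_into_right[OF hbij limL[OF that]]
      bij_betwE[OF bij_betw_inv_into[OF hbij]] limL[OF that] by (auto simp: e_def)
  have ehom: "unital_star_hom (mat_cstar (k i)) D (e i)" for i
    by (rule unital_star_hom_factor[OF pre_cstar_mat D.pre_cstar_algebra_axioms lim_hom hQ hinj])
      (use e in auto)
  have conn: "connecting \<phi> i n a \<in> carrier_mat (k (i + n)) (k (i + n))"
    if "a \<in> carrier_mat (k i) (k i)" for i n a
    using unital_star_homD(1)[OF connecting_hom[of i n]] that by simp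
  have e_conn: "e (i + n) (connecting \<phi> i n a) = e i a" if a: "a \<in> carrier_mat (k i) (k i)" for i n a
    by (simp add: e_def lim_connecting[OF a])
  \<comment> \<open>the embedding of the union of the matrix algebras into \<open>D\<close> is contractive\<close>
  have bound: "cnorm D (e i a) \<le> cnorm Q (lim i a)" if a: "a \<in> carrier_mat (k i) (k i)" for i a
  proof (rule dense_ge)
    fix r assume "cnorm Q (lim i a) < r"
    then have "eventually (\<lambda>j. opnorm (k j) (thread i a j) < r) sequentially"
      using quot_norm_less_imp_eventually[OF thread_carrier[OF a]] by (simp add: limit_map_eq)
    then obtain N where "\<And>j. j \<ge> N \<Longrightarrow> opnorm (k j) (thread i a j) < r"
      by (auto simp: eventually_sequentially)
    then have "opnorm (k (i + N)) (connecting \<phi> i N a) < r"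
      using thread_tail[of i a N] by (metis le_add2)
    moreover have "cnorm D (e (i + N) (connecting \<phi> i N a)) \<le> opnorm (k (i + N)) (connecting \<phi> i N a)"
      using unital_star_hom_contractive[OF cstar_mat D.pre_cstar_algebra_axioms ehom] conn[OF a] by simp
    ultimately show "cnorm D (e i a) \<le> r" using e_conn[OF a, of N] by simp
  qed
  have bound2: "cnorm D (e i a \<ominus>\<^bsub>D\<^esub> e j b) \<le> cnorm Q (lim i a \<ominus>\<^bsub>Q\<^esub> lim j b)"
    if a: "a \<in> carrier_mat (k i) (k i)" and b: "b \<in> carrier_mat (k j) (k j)" for i j a b
  proof -
    define a' where "a' = connecting \<phi> i j a"
    define b' where "b' = connecting \<phi> j i b"
    interpret M: pre_cstar_algebra "mat_cstar (k (i + j))" by (rule pre_cstar_mat)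
    have ab': "a' \<in> carrier_mat (k (i + j)) (k (i + j))" "b' \<in> carrier_mat (k (i + j)) (k (i + j))"
      using conn[OF a, of j] conn[OF b, of i] by (auto simp: a'_def b'_def add.commute)
    then have c: "a' \<ominus>\<^bsub>mat_cstar (k (i + j))\<^esub> b' \<in> carrier_mat (k (i + j)) (k (i + j))"
      using M.Alg.minus_closed[of a' b'] by simp
    have "e i a = e (i + j) a'" "e j b = e (i + j) b'" "lim i a = lim (i + j) a'" "lim j b = lim (i + j) b'"
      using e_conn[OF a, of j] e_conn[OF b, of i] lim_connecting[OF a, of j] lim_connecting[OF b, of i]
      by (simp_all add: a'_def b'_def add.commute)
    then show ?thesis
      using bound[OF c] ab'
        unital_star_hom_zero_minus(2)[OF pre_cstar_mat D.pre_cstar_algebra_axioms ehom, of a' "i + j" b']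
        unital_star_hom_zero_minus(2)[OF pre_cstar_mat Q.pre_cstar_algebra_axioms lim_hom, of a' "i + j" b']
      by simp
  qed
  have dense: "\<exists>i. \<exists>a\<in>carrier_mat (k i) (k i). cnorm D (x \<ominus>\<^bsub>D\<^esub> e i a) < \<epsilon>"
    if x: "x \<in> carrier D" and "\<epsilon> > 0" for x \<epsilon>
  proof -
    have hx: "h x \<in> L" using bij_betwE[OF hbij] x by blast
    have "\<exists>i a. a \<in> carrier_mat (k i) (k i) \<and> cnorm Q (h x \<ominus>\<^bsub>Q\<^esub> lim i a) < inverse (real (Suc n))" for n
    proof -
      have "0 < inverse (real (Suc n))" by simp
      then show ?thesis using hx unfolding L_iff by blast
    qed
    then obtain i a where ia: "\<And>n. a n \<in> carrier_mat (k (i n)) (k (i n))"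
      "\<And>n. cnorm Q (h x \<ominus>\<^bsub>Q\<^esub> lim (i n) (a n)) < inverse (real (Suc n))" by metis
    define d where "d n = e (i n) (a n)" for n
    have d: "d n \<in> carrier D" "h (d n) = lim (i n) (a n)" for n using e[OF ia(1)] by (auto simp: d_def)
    have hx': "h x \<in> carrier Q" using hx LQ by blast
    have lim_hx: "(\<lambda>n. cnorm Q (h (d n) \<ominus>\<^bsub>Q\<^esub> h x)) \<longlonglongrightarrow> 0"
    proof (rule tendsto_sandwich[OF _ _ tendsto_const LIMSEQ_inverse_real_of_nat])
      show "\<forall>\<^sub>F n in sequentially. 0 \<le> cnorm Q (h (d n) \<ominus>\<^bsub>Q\<^esub> h x)"
        using hx' hD(1)[OF d(1)] by simp
      show "\<forall>\<^sub>F n in sequentially. cnorm Q (h (d n) \<ominus>\<^bsub>Q\<^esub> h x) \<le> inverse (real (Suc n))"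
        using ia(2) Q.cnorm_minus_commute[OF hx' hD(1)[OF d(1)]] d(2)
        by (intro always_eventually allI less_imp_le) simp
    qed
    obtain y where y: "y \<in> carrier D" "(\<lambda>n. cnorm D (d n \<ominus>\<^bsub>D\<^esub> y)) \<longlonglongrightarrow> 0"
    proof (rule D.cauchy_converges[OF complete d(1)])
      fix \<epsilon> :: real assume "\<epsilon> > 0"
      then obtain N where N: "\<And>m n. m \<ge> N \<Longrightarrow> n \<ge> N \<Longrightarrow> cnorm Q (h (d m) \<ominus>\<^bsub>Q\<^esub> h (d n)) < \<epsilon>"
        using Q.convergent_imp_cauchy[OF hD(1)[OF d(1)] hx' lim_hx] by blast
      have "cnorm D (d m \<ominus>\<^bsub>D\<^esub> d n) < \<epsilon>" if "m \<ge> N" "n \<ge> N" for m n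
        using N[OF that] bound2[OF ia(1)[of m] ia(1)[of n]] unfolding d(2) unfolding d_def by simp
      then show "\<exists>N. \<forall>m\<ge>N. \<forall>n\<ge>N. cnorm D (d m \<ominus>\<^bsub>D\<^esub> d n) < \<epsilon>" by blast
    qed
    have "(\<lambda>n. cnorm Q (h (d n) \<ominus>\<^bsub>Q\<^esub> h y)) \<longlonglongrightarrow> 0"
    proof (rule tendsto_sandwich[OF _ _ tendsto_const y(2)])
      show "\<forall>\<^sub>F n in sequentially. 0 \<le> cnorm Q (h (d n) \<ominus>\<^bsub>Q\<^esub> h y)"
        using hD(1)[OF y(1)] hD(1)[OF d(1)] by simp
      show "\<forall>\<^sub>F n in sequentially. cnorm Q (h (d n) \<ominus>\<^bsub>Q\<^esub> h y) \<le> cnorm D (d n \<ominus>\<^bsub>D\<^esub> y)"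
        using unital_star_hom_contractive[OF D Q.pre_cstar_algebra_axioms hQ] d(1) y(1)
        by (simp add: h_minus[symmetric])
    qed
    then have "h x = h y"
      using Q.limit_unique[OF hD(1)[OF d(1)] hx' hD(1)[OF y(1)] lim_hx] by blast
    then have "x = y" using hinj x y by (auto dest: inj_onD)
    moreover obtain n where "norm (cnorm D (d n \<ominus>\<^bsub>D\<^esub> y) - 0) < \<epsilon>"
      using LIMSEQ_D[OF y(2) \<open>\<epsilon> > 0\<close>] by blast
    ultimately have "cnorm D (d n \<ominus>\<^bsub>D\<^esub> x) < \<epsilon>" by simp
    then show ?thesis
      using ia(1)[of n] D.cnorm_minus_commute[OF x d(1)] unfolding d_def by metis
  qed
  have "e i a \<in> e (Suc i) ` carrier_mat (k (Suc i)) (k (Suc i))" if a: "a \<in> carrier_mat (k i) (k i)" for i a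
    using e_conn[OF a, of 1] conn[OF a, of 1] by (metis Suc_eq_plus1 image_eqI)
  moreover have "\<one>\<^bsub>D\<^esub> \<noteq> \<zero>\<^bsub>D\<^esub>"
    using quot_one_nonzero hD(4)
      unital_star_hom_zero_minus(1)[OF D.pre_cstar_algebra_axioms Q.pre_cstar_algebra_axioms hQ] by metis
  ultimately show ?thesis
    unfolding matrix_tower_def using pos dvd ehom dense by (intro exI[of _ e]) blast
qed

end

theorem UHF_algebra_imp_tower:
  assumes "UHF_algebra D"
  obtains k e where "matrix_tower D k e"
proof -
  obtain k \<phi> where k: "\<And>i. 0 < k i \<and> k i dvd k (Suc i)"
    "\<And>i. unital_star_hom (mat_cstar (k i)) (mat_cstar (k (Suc i))) (\<phi> i)"
    and iso: "cstar_isomorphic D (inductive_limit (\<lambda>i. mat_cstar (k i)) \<phi>)"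
    and D: "unital_cstar_algebra D"
    using assms unfolding UHF_algebra_def by blast
  interpret matrix_sequence k \<phi> using k by unfold_locales auto
  show thesis
    using matrix_tower_of_limit_iso[OF D] iso k that unfolding cstar_isomorphic_def by blast
qed

subsection \<open>Images of UHF-algebras\<close>

text \<open>The homomorphism is isometric on the dense union of the matrix algebras.\<close>
lemma tower_hom_isometric:
  assumes D: "unital_cstar_algebra D" and tower: "matrix_tower D k e"
    and B: "pre_cstar_algebra B" "\<one>\<^bsub>B\<^esub> \<noteq> \<zero>\<^bsub>B\<^esub>" and h: "unital_star_hom D B h" and x: "x \<in> carrier D"
  shows "cnorm B (h x) = cnorm D x"
proof -
  interpret D: pre_cstar_algebra D by (rule unital_cstar_imp_pre_cstar[OF D])
  interpret B: pre_cstar_algebra B by fact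
  have "\<bar>cnorm B (h x) - cnorm D x\<bar> \<le> 0 + \<epsilon>" if eps: "\<epsilon> > 0" for \<epsilon>
  proof -
    obtain i a where a: "a \<in> carrier_mat (k i) (k i)" "cnorm D (x \<ominus>\<^bsub>D\<^esub> e i a) < \<epsilon> / 2"
      using matrix_tower_dense[OF tower x half_gt_zero[OF eps]] by blast
    note e = matrix_towerD(4)[OF tower, of i]
    have ea: "e i a \<in> carrier D" using unital_star_homD(1)[OF e] a by simp
    have "cnorm D (e i a) = cnorm B (h (e i a))"
      using hom_mat_isometric[OF D.pre_cstar_algebra_axioms matrix_towerD(1)[OF tower] e a(1)]
        hom_mat_isometric[OF B unital_star_hom_comp[OF e h] a(1)] by simp
    moreover have "\<bar>cnorm B (h x) - cnorm B (h (e i a))\<bar> \<le> cnorm B (h x \<ominus>\<^bsub>B\<^esub> h (e i a))"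
      using B.cnorm_diff_le unital_star_homD(1)[OF h] x ea by blast
    moreover have "cnorm B (h x \<ominus>\<^bsub>B\<^esub> h (e i a)) \<le> cnorm D (x \<ominus>\<^bsub>D\<^esub> e i a)"
      using unital_star_hom_contractive[OF D B(1) h, of "x \<ominus>\<^bsub>D\<^esub> e i a"] x ea
        unital_star_hom_zero_minus(2)[OF D.pre_cstar_algebra_axioms B(1) h x ea] by simp
    moreover have "\<bar>cnorm D x - cnorm D (e i a)\<bar> \<le> cnorm D (x \<ominus>\<^bsub>D\<^esub> e i a)"
      using D.cnorm_diff_le x ea by blast
    ultimately show ?thesis using a(2) by linarith
  qed
  then show ?thesis using field_le_epsilon[of "\<bar>cnorm B (h x) - cnorm D x\<bar>" 0] by simp
qed

lemma unital_star_hom_inverse: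
  assumes A: "pre_cstar_algebra A" and B: "pre_cstar_algebra B"
    and h: "unital_star_hom A B h" "bij_betw h (carrier A) (carrier B)"
  shows "unital_star_hom B A (inv_into (carrier A) h)"
proof (rule unital_star_hom_factor[OF B A _ h(1) bij_betw_imp_inj_on[OF h(2)]])
  show "unital_star_hom B B (\<lambda>x. x)" by (rule unital_star_homI) auto
  fix x assume "x \<in> carrier B"
  then show "inv_into (carrier A) h x \<in> carrier A \<and> h (inv_into (carrier A) h x) = x"
    using bij_betw_inv_into_right[OF h(2)] bij_betwE[OF bij_betw_inv_into[OF h(2)]] by blast
qed

lemma isometric_image:
  assumes D: "unital_cstar_algebra D" and B: "pre_cstar_algebra B"
    and h: "unital_star_hom D B h" and iso: "\<And>x. x \<in> carrier D \<Longrightarrow> cnorm B (h x) = cnorm D x"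
  shows "closedin (cstar_topology B) (h ` carrier D)"
    and "unital_cstar_algebra (B\<lparr>carrier := h ` carrier D\<rparr>)"
proof -
  interpret D: pre_cstar_algebra D by (rule unital_cstar_imp_pre_cstar[OF D])
  interpret B: pre_cstar_algebra B by fact
  have sub: "star_subalgebra (h ` carrier D) B"
    by (rule star_subalgebra_image[OF D.pre_cstar_algebra_axioms B h])
  then have subset: "h ` carrier D \<subseteq> carrier B" by (simp add: star_subalgebra_def)
  interpret C: pre_cstar_algebra "B\<lparr>carrier := h ` carrier D\<rparr>" by (rule pre_cstar_subalgebra[OF B sub])
  note hD = unital_star_homD(1)[OF h]
  have dist: "cnorm B (h x \<ominus>\<^bsub>B\<^esub> h y) = cnorm D (x \<ominus>\<^bsub>D\<^esub> y)" if "x \<in> carrier D" "y \<in> carrier D" for x y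
    using iso[of "x \<ominus>\<^bsub>D\<^esub> y"] that unital_star_hom_zero_minus(2)[OF D.pre_cstar_algebra_axioms B h that] by simp
  have conv: "\<exists>y\<in>h ` carrier D. (\<lambda>n. cnorm B (s n \<ominus>\<^bsub>B\<^esub> y)) \<longlonglongrightarrow> 0"
    if s: "\<And>n. s n \<in> h ` carrier D"
      and cauchy: "\<And>\<epsilon>. \<epsilon> > 0 \<Longrightarrow> \<exists>N. \<forall>m\<ge>N. \<forall>n\<ge>N. cnorm B (s m \<ominus>\<^bsub>B\<^esub> s n) < \<epsilon>" for s :: "nat \<Rightarrow> _"
  proof -
    have "\<exists>d. d \<in> carrier D \<and> s n = h d" for n using s[of n] by blast
    then obtain d where d: "\<And>n. d n \<in> carrier D" "\<And>n. s n = h (d n)" by metis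
    obtain x where x: "x \<in> carrier D" "(\<lambda>n. cnorm D (d n \<ominus>\<^bsub>D\<^esub> x)) \<longlonglongrightarrow> 0"
      by (rule D.cauchy_converges[OF unital_cstar_algebra.complete[OF D] d(1)])
        (use cauchy in \<open>auto simp: d dist\<close>)
    then have "(\<lambda>n. cnorm B (s n \<ominus>\<^bsub>B\<^esub> h x)) \<longlonglongrightarrow> 0" by (simp add: d dist)
    then show ?thesis using x by blast
  qed
  show "closedin (cstar_topology B) (h ` carrier D)"
    unfolding B.closedin_iff
  proof (intro conjI subset allI impI; elim conjE)
    fix s :: "nat \<Rightarrow> _" and y assume s: "\<forall>n. s n \<in> h ` carrier D" and y: "y \<in> carrier B"
      and lim: "(\<lambda>n. cnorm B (s n \<ominus>\<^bsub>B\<^esub> y)) \<longlonglongrightarrow> 0"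
    have sB: "s n \<in> carrier B" for n using s subset by blast
    obtain z where z: "z \<in> h ` carrier D" "(\<lambda>n. cnorm B (s n \<ominus>\<^bsub>B\<^esub> z)) \<longlonglongrightarrow> 0"
      using conv[of s] s B.convergent_imp_cauchy[OF sB y lim] by blast
    then show "y \<in> h ` carrier D"
      using B.limit_unique[OF sB y _ lim z(2)] subset by blast
  qed
  show "unital_cstar_algebra (B\<lparr>carrier := h ` carrier D\<rparr>)"
  proof (rule unital_cstar_algebraI[OF C.pre_cstar_algebra_axioms])
    have minus: "x \<ominus>\<^bsub>B\<lparr>carrier := h ` carrier D\<rparr>\<^esub> y = x \<ominus>\<^bsub>B\<^esub> y"
      if "x \<in> h ` carrier D" "y \<in> h ` carrier D" for x y
      using subalgebra_minus[OF B sub that] .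
    show "Metric_space.mcomplete (carrier (B\<lparr>carrier := h ` carrier D\<rparr>))
        (cstar_dist (B\<lparr>carrier := h ` carrier D\<rparr>))"
      unfolding C.mcomplete_iff
    proof (intro allI impI, elim conjE)
      fix s :: "nat \<Rightarrow> _" assume "\<forall>n. s n \<in> carrier (B\<lparr>carrier := h ` carrier D\<rparr>)"
        and c: "\<forall>\<epsilon>>0. \<exists>N. \<forall>m\<ge>N. \<forall>n\<ge>N.
          cnorm (B\<lparr>carrier := h ` carrier D\<rparr>) (s m \<ominus>\<^bsub>B\<lparr>carrier := h ` carrier D\<rparr>\<^esub> s n) < \<epsilon>"
      then have s: "s n \<in> h ` carrier D" for n by simp
      have "\<exists>y\<in>h ` carrier D. (\<lambda>n. cnorm B (s n \<ominus>\<^bsub>B\<^esub> y)) \<longlonglongrightarrow> 0"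
        by (rule conv[OF s]) (use c in \<open>simp add: minus s\<close>)
      then show "\<exists>y\<in>carrier (B\<lparr>carrier := h ` carrier D\<rparr>).
          (\<lambda>n. cnorm (B\<lparr>carrier := h ` carrier D\<rparr>) (s n \<ominus>\<^bsub>B\<lparr>carrier := h ` carrier D\<rparr>\<^esub> y)) \<longlonglongrightarrow> 0"
        by (auto simp: minus s)
    qed
  qed
qed

text \<open>The image of \<open>D\<close> is closed because \<open>D\<close> is complete and \<open>h\<close> is isometric on \<open>D\<close>.\<close>
theorem UHF_subalgebra_image:
  assumes A: "unital_cstar_algebra A" and B: "unital_cstar_algebra B" "\<one>\<^bsub>B\<^esub> \<noteq> \<zero>\<^bsub>B\<^esub>"
    and h: "unital_star_hom A B h" and D: "UHF_subalgebra D A"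
  shows "UHF_subalgebra (h ` D) B"
    and "unital_star_hom (A\<lparr>carrier := D\<rparr>) (B\<lparr>carrier := h ` D\<rparr>) h" "bij_betw h D (h ` D)"
proof -
  note preA = unital_cstar_imp_pre_cstar[OF A] and preB = unital_cstar_imp_pre_cstar[OF B(1)]
  interpret B: pre_cstar_algebra B by (rule preB)
  have UD: "UHF_algebra (A\<lparr>carrier := D\<rparr>)" and subD: "unital_cstar_subalgebra D A"
    using D by (auto simp: UHF_subalgebra_def)
  then have cD: "unital_cstar_algebra (A\<lparr>carrier := D\<rparr>)" by (simp add: UHF_algebra_def)
  note preD = unital_cstar_imp_pre_cstar[OF cD]
  interpret D: pre_cstar_algebra "A\<lparr>carrier := D\<rparr>" by (rule preD)
  have DA: "D \<subseteq> carrier A"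
    using unital_cstar_subalgebra_imp_star_subalgebra[OF preA subD] by (simp add: star_subalgebra_def)
  have hD: "unital_star_hom (A\<lparr>carrier := D\<rparr>) B h"
    using unital_star_hom_restrict[OF h DA, of "carrier B"] unital_star_homD(1)[OF h] DA by auto
  show hD': "unital_star_hom (A\<lparr>carrier := D\<rparr>) (B\<lparr>carrier := h ` D\<rparr>) h"
    by (rule unital_star_hom_restrict[OF h DA subset_refl])
  obtain k e where tower: "matrix_tower (A\<lparr>carrier := D\<rparr>) k e"
    using UHF_algebra_imp_tower[OF UD] .
  have iso: "cnorm B (h x) = cnorm (A\<lparr>carrier := D\<rparr>) x" if "x \<in> carrier (A\<lparr>carrier := D\<rparr>)" for x
    by (rule tower_hom_isometric[OF cD tower preB B(2) hD that])
  have "inj_on h D"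
  proof (rule inj_onI)
    fix x y assume xy: "x \<in> D" "y \<in> D" "h x = h y"
    have "cnorm (A\<lparr>carrier := D\<rparr>) (x \<ominus>\<^bsub>A\<lparr>carrier := D\<rparr>\<^esub> y) = cnorm B (h (x \<ominus>\<^bsub>A\<lparr>carrier := D\<rparr>\<^esub> y))"
      using iso[of "x \<ominus>\<^bsub>A\<lparr>carrier := D\<rparr>\<^esub> y"] D.Alg.minus_closed[of x y] xy by simp
    also have "h (x \<ominus>\<^bsub>A\<lparr>carrier := D\<rparr>\<^esub> y) = \<zero>\<^bsub>B\<^esub>"
      using unital_star_hom_zero_minus(2)[OF preD preB hD, of x y] xy
        B.minus_eq_zero_iff[of "h y" "h y"] unital_star_homD(1)[OF hD, of y] by simp
    finally show "x = y"
      using D.cnorm_eq_zero_iff[of "x \<ominus>\<^bsub>A\<lparr>carrier := D\<rparr>\<^esub> y"] D.minus_eq_zero_iff[of x y] xy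
        D.Alg.minus_closed[of x y] by simp
  qed
  then show bij: "bij_betw h D (h ` D)" by (simp add: bij_betw_def)
  have closed: "closedin (cstar_topology B) (h ` D)" and cC: "unital_cstar_algebra (B\<lparr>carrier := h ` D\<rparr>)"
    using isometric_image[OF cD preB hD iso] by simp_all
  have sub: "star_subalgebra (h ` D) B"
    using star_subalgebra_image[OF preD preB hD] by simp
  have "subring (h ` D) B"
    by (rule B.Alg.subringI) (use sub in \<open>auto simp: star_subalgebra_def B.uminus_eq_smult subset_iff\<close>)
  then have "unital_cstar_subalgebra (h ` D) B"
    using sub closed by (auto simp: unital_cstar_subalgebra_def star_subalgebra_def)
  moreover have "UHF_algebra (B\<lparr>carrier := h ` D\<rparr>)"
  proof -
    have inv: "unital_star_hom (B\<lparr>carrier := h ` D\<rparr>) (A\<lparr>carrier := D\<rparr>) (inv_into D h)"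
      using unital_star_hom_inverse[OF preD unital_cstar_imp_pre_cstar[OF cC] hD'] bij by simp
    have iso_trans: "cstar_isomorphic (B\<lparr>carrier := h ` D\<rparr>) L" if "cstar_isomorphic (A\<lparr>carrier := D\<rparr>) L"
      for L :: "(nat \<Rightarrow> complex mat) set cstar"
    proof -
      obtain g where g: "unital_star_hom (A\<lparr>carrier := D\<rparr>) L g" "bij_betw g D (carrier L)"
        using \<open>cstar_isomorphic (A\<lparr>carrier := D\<rparr>) L\<close> by (auto simp: cstar_isomorphic_def)
      have "bij_betw (g \<circ> inv_into D h) (h ` D) (carrier L)"
        by (rule bij_betw_trans[OF bij_betw_inv_into[OF bij] g(2)])
      then show ?thesis
        using unital_star_hom_comp[OF inv g(1)] unfolding cstar_isomorphic_def o_def by auto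
    qed
    then show ?thesis using UD cC unfolding UHF_algebra_def by blast
  qed
  ultimately show "UHF_subalgebra (h ` D) B" by (simp add: UHF_subalgebra_def)
qed

section \<open>Traces\<close>

text \<open>The trace of an \<open>n \<times> n\<close> matrix.\<close>
definition tr :: "nat \<Rightarrow> complex mat \<Rightarrow> complex" where
  "tr n a = (\<Sum>i<n. a $$ (i, i))"

text \<open>The normalised trace.\<close>
definition ntr :: "nat \<Rightarrow> complex mat \<Rightarrow> complex" where
  "ntr n a = tr n a / of_nat n"

lemma tr_add: "a \<in> carrier_mat n n \<Longrightarrow> b \<in> carrier_mat n n \<Longrightarrow> tr n (a + b) = tr n a + tr n b"
  by (simp add: tr_def sum.distrib)

lemma tr_smult: "a \<in> carrier_mat n n \<Longrightarrow> tr n (c \<cdot>\<^sub>m a) = c * tr n a"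
  by (simp add: tr_def sum_distrib_left)

lemma tr_mult_commute:
  assumes "a \<in> carrier_mat n n" "b \<in> carrier_mat n n"
  shows "tr n (a * b) = tr n (b * a)"
proof -
  have "tr n (a * b) = (\<Sum>i<n. \<Sum>j<n. a $$ (i, j) * b $$ (j, i))"
    unfolding tr_def by (intro sum.cong refl mult_mat_index[OF assms]) auto
  also have "\<dots> = (\<Sum>j<n. \<Sum>i<n. b $$ (j, i) * a $$ (i, j))"
    by (subst sum.swap) (simp add: mult.commute)
  also have "\<dots> = tr n (b * a)"
    unfolding tr_def by (intro sum.cong refl mult_mat_index[OF assms(2,1), symmetric]) auto
  finally show ?thesis .
qed

lemma tr_one: "tr n (1\<^sub>m n) = of_nat n"
  by (simp add: tr_def)

lemma ntr_one: "0 < n \<Longrightarrow> ntr n (1\<^sub>m n) = 1"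
  by (simp add: ntr_def tr_one)

lemma tr_munit: "p < n \<Longrightarrow> q < n \<Longrightarrow> tr n (munit n p q) = (if p = q then 1 else 0)"
  by (auto simp: tr_def munit_index if_distrib sum.If_cases intro!: sum.neutral)

lemma ntr_add: "a \<in> carrier_mat n n \<Longrightarrow> b \<in> carrier_mat n n \<Longrightarrow> ntr n (a + b) = ntr n a + ntr n b"
  by (simp add: ntr_def tr_add add_divide_distrib)

lemma ntr_smult: "a \<in> carrier_mat n n \<Longrightarrow> ntr n (c \<cdot>\<^sub>m a) = c * ntr n a"
  by (simp add: ntr_def tr_smult)

lemma ntr_mult_commute:
  "a \<in> carrier_mat n n \<Longrightarrow> b \<in> carrier_mat n n \<Longrightarrow> ntr n (a * b) = ntr n (b * a)"
  by (simp add: ntr_def tr_mult_commute[of a n b])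

lemma cmod_ntr_le:
  assumes "a \<in> carrier_mat n n" "0 < n"
  shows "cmod (ntr n a) \<le> opnorm n a"
proof -
  have "cmod (tr n a) \<le> (\<Sum>i<n. opnorm n a)"
    unfolding tr_def by (rule sum_norm_le) (use assms entry_le_opnorm in auto)
  then show ?thesis using assms(2) by (simp add: ntr_def norm_divide field_simps)
qed

lemma trace_unique:
  assumes n: "0 < n"
    and add: "\<And>a b. \<lbrakk>a \<in> carrier_mat n n; b \<in> carrier_mat n n\<rbrakk> \<Longrightarrow> t (a + b) = t a + t b"
    and smult: "\<And>c a. a \<in> carrier_mat n n \<Longrightarrow> t (c \<cdot>\<^sub>m a) = c * t a"
    and comm: "\<And>a b. \<lbrakk>a \<in> carrier_mat n n; b \<in> carrier_mat n n\<rbrakk> \<Longrightarrow> t (a * b) = t (b * a)"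
    and a: "a \<in> carrier_mat n n"
  shows "t a = t (1\<^sub>m n) * ntr n a"
proof -
  have t0: "t (0\<^sub>m n n) = 0"
    using add[of "0\<^sub>m n n" "0\<^sub>m n n"] by simp
  have unit: "t (munit n p q) = t (munit n 0 0) * tr n (munit n p q)" if "p < n" "q < n" for p q
  proof (cases "p = q")
    case True
    then show ?thesis
      using comm[of "munit n p 0" "munit n 0 p"] that n by (simp add: munit_mult tr_munit)
  next
    case False
    then show ?thesis
      using comm[of "munit n p p" "munit n p q"] that t0 by (simp add: munit_mult tr_munit)
  qed
  have *: "t b = t (munit n 0 0) * tr n b" if "b \<in> carrier_mat n n" for b
  proof (rule mat_unit_induct[OF that])
    show "t (0\<^sub>m n n) = t (munit n 0 0) * tr n (0\<^sub>m n n)" by (simp add: t0 tr_def)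
    show "t (c \<cdot>\<^sub>m munit n p q) = t (munit n 0 0) * tr n (c \<cdot>\<^sub>m munit n p q)"
      if "p < n" "q < n" for c p q
      unfolding smult[OF munit_carrier] tr_smult[OF munit_carrier] unit[OF that] by (rule mult.left_commute)
  qed (simp add: add tr_add distrib_left)
  show ?thesis
    using *[OF a] *[of "1\<^sub>m n"] n by (simp add: ntr_def tr_one)
qed

lemma ntr_hom:
  assumes "0 < k" "0 < n" "unital_star_hom (mat_cstar k) (mat_cstar n) c" "a \<in> carrier_mat k k"
  shows "ntr n (c a) = ntr k a"
proof -
  note c = unital_star_homD[OF assms(3), simplified]
  have "ntr n (c a) = ntr n (c (1\<^sub>m k)) * ntr k a"
    by (rule trace_unique[OF assms(1) _ _ _ assms(4)])
      (simp_all add: c ntr_add ntr_smult ntr_mult_commute)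
  then show ?thesis using assms by (simp add: c ntr_one)
qed

subsection \<open>The trace of a UHF-algebra\<close>

text \<open>A homomorphism with values in a stage of the tower factors through the matrix algebra of that stage.\<close>
lemma tower_stage_hom:
  assumes D: "pre_cstar_algebra D" and tower: "matrix_tower D k e"
    and g: "unital_star_hom (mat_cstar m) D g"
    and range: "g ` carrier_mat m m \<subseteq> e i ` carrier_mat (k i) (k i)"
  obtains c where "unital_star_hom (mat_cstar m) (mat_cstar (k i)) c"
    "\<And>a. a \<in> carrier_mat m m \<Longrightarrow> e i (c a) = g a"
proof -
  define c where "c a = inv_into (carrier_mat (k i) (k i)) (e i) (g a)" for a
  have c: "c a \<in> carrier_mat (k i) (k i)" "e i (c a) = g a" if "a \<in> carrier_mat m m" for a
  proof -
    have "g a \<in> e i ` carrier_mat (k i) (k i)" using range that by blast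
    then show "c a \<in> carrier_mat (k i) (k i)" "e i (c a) = g a"
      unfolding c_def by (rule inv_into_into, rule f_inv_into_f)
  qed
  have inj: "inj_on (e i) (carrier (mat_cstar (k i)))"
    using hom_mat_inj[OF D matrix_towerD(1)[OF tower] matrix_towerD(4)[OF tower]] by simp
  have "unital_star_hom (mat_cstar m) (mat_cstar (k i)) c"
    by (rule unital_star_hom_factor[OF pre_cstar_mat pre_cstar_mat g matrix_towerD(4)[OF tower] inj])
      (use c in auto)
  then show thesis using that c by blast
qed

lemma tower_ntr_lift:
  assumes D: "pre_cstar_algebra D" and tower: "matrix_tower D k e" and "i \<le> j"
    and a: "a \<in> carrier_mat (k i) (k i)"
  obtains b where "b \<in> carrier_mat (k j) (k j)" "e j b = e i a" "ntr (k j) b = ntr (k i) a"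
proof -
  obtain c where c: "unital_star_hom (mat_cstar (k i)) (mat_cstar (k j)) c"
    "\<And>a. a \<in> carrier_mat (k i) (k i) \<Longrightarrow> e j (c a) = e i a"
    by (rule tower_stage_hom[OF D tower matrix_towerD(4)[OF tower] matrix_tower_mono(1)[OF tower \<open>i \<le> j\<close>]]) blast
  show thesis
    using that[of "c a"] c a unital_star_homD(1)[OF c(1), of a] matrix_towerD(2)[OF tower]
      ntr_hom[OF _ _ c(1) a] by simp
qed

lemma tower_ntr_diff_le:
  assumes D: "pre_cstar_algebra D" and tower: "matrix_tower D k e"
    and a: "a \<in> carrier_mat (k i) (k i)" and b: "b \<in> carrier_mat (k j) (k j)"
  shows "cmod (ntr (k i) a - ntr (k j) b) \<le> cnorm D (e i a \<ominus>\<^bsub>D\<^esub> e j b)"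
proof -
  define m where "m = max i j"
  obtain a' where a': "a' \<in> carrier_mat (k m) (k m)" "e m a' = e i a" "ntr (k m) a' = ntr (k i) a"
    using tower_ntr_lift[OF D tower _ a, of m] by (auto simp: m_def)
  obtain b' where b': "b' \<in> carrier_mat (k m) (k m)" "e m b' = e j b" "ntr (k m) b' = ntr (k j) b"
    using tower_ntr_lift[OF D tower _ b, of m] by (auto simp: m_def)
  interpret M: pre_cstar_algebra "mat_cstar (k m)" by (rule pre_cstar_mat)
  let ?d = "a' \<ominus>\<^bsub>mat_cstar (k m)\<^esub> b'"
  have d: "?d \<in> carrier_mat (k m) (k m)" using M.Alg.minus_closed[of a' b'] a' b' by simp
  have "?d = a' + (-1) \<cdot>\<^sub>m b'" using M.minus_eq_smult[of a' b'] a' b' by simp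
  then have "ntr (k m) ?d = ntr (k i) a - ntr (k j) b"
    using a' b' by (simp add: ntr_add ntr_smult)
  moreover have "opnorm (k m) ?d = cnorm D (e i a \<ominus>\<^bsub>D\<^esub> e j b)"
    using hom_mat_isometric[OF D matrix_towerD(1)[OF tower] matrix_towerD(4)[OF tower, of m] d]
      unital_star_hom_zero_minus(2)[OF pre_cstar_mat D matrix_towerD(4)[OF tower, of m], of a' b'] a' b'
    by simp
  ultimately show ?thesis using cmod_ntr_le[OF d matrix_towerD(2)[OF tower]] by simp
qed

text \<open>
  The trace is determined by \<open>|\<tau> x - ntr a| \<le> \<parallel>x - e i a\<parallel>\<close> for all matrices \<open>a\<close> of the tower.
\<close>
lemma tower_trace_exists:
  assumes D: "pre_cstar_algebra D" and tower: "matrix_tower D k e" and x: "x \<in> carrier D"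
  shows "\<exists>t. \<forall>i. \<forall>a\<in>carrier_mat (k i) (k i). cmod (t - ntr (k i) a) \<le> cnorm D (x \<ominus>\<^bsub>D\<^esub> e i a)"
proof -
  interpret D: pre_cstar_algebra D by fact
  have eD: "e i a \<in> carrier D" if "a \<in> carrier_mat (k i) (k i)" for i a
    using unital_star_homD(1)[OF matrix_towerD(4)[OF tower]] that by simp
  have "\<exists>i a. a \<in> carrier_mat (k i) (k i) \<and> cnorm D (x \<ominus>\<^bsub>D\<^esub> e i a) < inverse (real (Suc n))" for n
    using matrix_tower_dense[OF tower x, of "inverse (real (Suc n))"] by (metis inverse_positive_iff_positive of_nat_0_less_iff zero_less_Suc)
  then obtain i a where ia: "\<And>n. a n \<in> carrier_mat (k (i n)) (k (i n))"
    "\<And>n. cnorm D (x \<ominus>\<^bsub>D\<^esub> e (i n) (a n)) < inverse (real (Suc n))" by metis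
  define d where "d n = e (i n) (a n)" for n
  define s where "s n = ntr (k (i n)) (a n)" for n
  have dD: "d n \<in> carrier D" for n using eD[OF ia(1)] by (simp add: d_def)
  have d: "(\<lambda>n. cnorm D (d n \<ominus>\<^bsub>D\<^esub> x)) \<longlonglongrightarrow> 0"
  proof (rule tendsto_sandwich[OF _ _ tendsto_const LIMSEQ_inverse_real_of_nat])
    show "\<forall>\<^sub>F n in sequentially. cnorm D (d n \<ominus>\<^bsub>D\<^esub> x) \<le> inverse (real (Suc n))"
      using ia(2) D.cnorm_minus_commute[OF x dD] unfolding d_def
      by (intro always_eventually allI less_imp_le) simp
  qed (use dD x in simp)
  have "Cauchy s"
  proof (rule CauchyI)
    fix \<epsilon> :: real assume "0 < \<epsilon>"
    then obtain N where N: "\<And>m n. m \<ge> N \<Longrightarrow> n \<ge> N \<Longrightarrow> cnorm D (d m \<ominus>\<^bsub>D\<^esub> d n) < \<epsilon>"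
      using D.convergent_imp_cauchy[OF dD x d] by blast
    have "norm (s m - s n) < \<epsilon>" if "m \<ge> N" "n \<ge> N" for m n
      using tower_ntr_diff_le[OF D tower ia(1)[of m] ia(1)[of n]] N[OF that] by (simp add: s_def d_def)
    then show "\<exists>N. \<forall>m\<ge>N. \<forall>n\<ge>N. norm (s m - s n) < \<epsilon>" by blast
  qed
  then obtain t where t: "s \<longlonglongrightarrow> t" by (meson Cauchy_convergent_iff convergent_def)
  have "cmod (t - ntr (k j) b) \<le> cnorm D (x \<ominus>\<^bsub>D\<^esub> e j b)" if b: "b \<in> carrier_mat (k j) (k j)" for j b
  proof (rule LIMSEQ_le)
    show "(\<lambda>n. cmod (s n - ntr (k j) b)) \<longlonglongrightarrow> cmod (t - ntr (k j) b)"
      by (intro tendsto_intros t)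
    have "(\<lambda>n. cnorm D (d n \<ominus>\<^bsub>D\<^esub> x) + cnorm D (x \<ominus>\<^bsub>D\<^esub> e j b)) \<longlonglongrightarrow> 0 + cnorm D (x \<ominus>\<^bsub>D\<^esub> e j b)"
      by (intro tendsto_intros d)
    then show "(\<lambda>n. cnorm D (d n \<ominus>\<^bsub>D\<^esub> x) + cnorm D (x \<ominus>\<^bsub>D\<^esub> e j b)) \<longlonglongrightarrow> cnorm D (x \<ominus>\<^bsub>D\<^esub> e j b)"
      by simp
    have "cmod (s n - ntr (k j) b) \<le> cnorm D (d n \<ominus>\<^bsub>D\<^esub> x) + cnorm D (x \<ominus>\<^bsub>D\<^esub> e j b)" for n
      using tower_ntr_diff_le[OF D tower ia(1)[of n] b] D.cnorm_minus_triangle[OF dD x eD[OF b], of n]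
      by (simp add: s_def d_def)
    then show "\<exists>N. \<forall>n\<ge>N. cmod (s n - ntr (k j) b) \<le> cnorm D (d n \<ominus>\<^bsub>D\<^esub> x) + cnorm D (x \<ominus>\<^bsub>D\<^esub> e j b)"
      by blast
  qed
  then show ?thesis by blast
qed

theorem tower_trace:
  assumes D: "pre_cstar_algebra D" and tower: "matrix_tower D k e"
  obtains \<tau> where "\<And>x y. \<lbrakk>x \<in> carrier D; y \<in> carrier D\<rbrakk> \<Longrightarrow> \<tau> (x \<oplus>\<^bsub>D\<^esub> y) = \<tau> x + \<tau> y"
    "\<And>c x. x \<in> carrier D \<Longrightarrow> \<tau> (c \<odot>\<^bsub>D\<^esub> x) = c * \<tau> x"
    "\<And>x y. \<lbrakk>x \<in> carrier D; y \<in> carrier D\<rbrakk> \<Longrightarrow> \<tau> (x \<otimes>\<^bsub>D\<^esub> y) = \<tau> (y \<otimes>\<^bsub>D\<^esub> x)"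
    "\<And>i a. a \<in> carrier_mat (k i) (k i) \<Longrightarrow> \<tau> (e i a) = ntr (k i) a"
proof -
  interpret D: pre_cstar_algebra D by fact
  note eD = unital_star_homD[OF matrix_towerD(4)[OF tower], simplified]
  obtain \<tau> where \<tau>: "\<And>x i a. \<lbrakk>x \<in> carrier D; a \<in> carrier_mat (k i) (k i)\<rbrakk>
      \<Longrightarrow> cmod (\<tau> x - ntr (k i) a) \<le> cnorm D (x \<ominus>\<^bsub>D\<^esub> e i a)"
    using tower_trace_exists[OF D tower] by metis
  have approx: "\<exists>i. \<exists>a\<in>carrier_mat (k i) (k i). \<exists>b\<in>carrier_mat (k i) (k i).
      cnorm D (x \<ominus>\<^bsub>D\<^esub> e i a) < \<epsilon> \<and> cnorm D (y \<ominus>\<^bsub>D\<^esub> e i b) < \<epsilon>"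
    if xy: "x \<in> carrier D" "y \<in> carrier D" and eps: "\<epsilon> > 0" for x y \<epsilon>
  proof -
    obtain i a where a: "a \<in> carrier_mat (k i) (k i)" "cnorm D (x \<ominus>\<^bsub>D\<^esub> e i a) < \<epsilon>"
      using matrix_tower_dense[OF tower xy(1) eps] .
    obtain j b where b: "b \<in> carrier_mat (k j) (k j)" "cnorm D (y \<ominus>\<^bsub>D\<^esub> e j b) < \<epsilon>"
      using matrix_tower_dense[OF tower xy(2) eps] .
    obtain a' where "a' \<in> carrier_mat (k (max i j)) (k (max i j))" "e (max i j) a' = e i a"
      using tower_ntr_lift[OF D tower _ a(1), of "max i j"] by auto
    moreover obtain b' where "b' \<in> carrier_mat (k (max i j)) (k (max i j))" "e (max i j) b' = e j b"
      using tower_ntr_lift[OF D tower _ b(1), of "max i j"] by auto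
    ultimately show ?thesis using a(2) b(2) by metis
  qed
  have zero: "z = 0" if "\<And>\<epsilon>. 0 < \<epsilon> \<Longrightarrow> \<epsilon> < 1 \<Longrightarrow> cmod z \<le> C * \<epsilon>" for z C
  proof -
    have "cmod z \<le> 0"
    proof (rule LIMSEQ_le_const)
      show "(\<lambda>n. C * inverse (real (Suc (Suc n)))) \<longlonglongrightarrow> 0"
        using tendsto_mult_right_zero[OF LIMSEQ_Suc[OF LIMSEQ_inverse_real_of_nat]] by simp
      have "cmod z \<le> C * inverse (real (Suc (Suc n)))" for n
        by (rule that) (auto simp: field_simps)
      then show "\<exists>N. \<forall>n\<ge>N. cmod z \<le> C * inverse (real (Suc (Suc n)))" by blast
    qed
    then show ?thesis by simp
  qed
  show thesis
  proof (rule that)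
    fix i and a :: "complex mat" assume a: "a \<in> carrier_mat (k i) (k i)"
    have "e i a \<ominus>\<^bsub>D\<^esub> e i a = \<zero>\<^bsub>D\<^esub>" using D.minus_eq_zero_iff eD(1)[OF a] by blast
    then show "\<tau> (e i a) = ntr (k i) a"
      using \<tau>[OF eD(1)[OF a] a] D.cnorm_zero by simp
  next
    fix c x assume x: "x \<in> carrier D"
    have "\<tau> (c \<odot>\<^bsub>D\<^esub> x) - c * \<tau> x = 0"
    proof (rule zero)
      fix \<epsilon> :: real assume "0 < \<epsilon>"
      then obtain i a where a: "a \<in> carrier_mat (k i) (k i)" "cnorm D (x \<ominus>\<^bsub>D\<^esub> e i a) < \<epsilon>"
        using matrix_tower_dense[OF tower x] by blast
      have "c \<odot>\<^bsub>D\<^esub> x \<ominus>\<^bsub>D\<^esub> e i (c \<cdot>\<^sub>m a) = c \<odot>\<^bsub>D\<^esub> (x \<ominus>\<^bsub>D\<^esub> e i a)"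
        using a x eD(1)[OF a(1)] by (simp add: eD(5) D.smult_minus_right)
      then have "cmod (\<tau> (c \<odot>\<^bsub>D\<^esub> x) - c * ntr (k i) a) \<le> cmod c * cnorm D (x \<ominus>\<^bsub>D\<^esub> e i a)"
        using \<tau>[of "c \<odot>\<^bsub>D\<^esub> x" "c \<cdot>\<^sub>m a" i] a x eD(1)[OF a(1)] by (simp add: ntr_smult D.cnorm_smult)
      moreover have "cmod (c * (ntr (k i) a - \<tau> x)) \<le> cmod c * cnorm D (x \<ominus>\<^bsub>D\<^esub> e i a)"
        using \<tau>[OF x a(1)] by (simp add: norm_mult norm_minus_commute mult_left_mono)
      moreover have "cmod (\<tau> (c \<odot>\<^bsub>D\<^esub> x) - c * \<tau> x)
          \<le> cmod (\<tau> (c \<odot>\<^bsub>D\<^esub> x) - c * ntr (k i) a) + cmod (c * (ntr (k i) a - \<tau> x))"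
        using norm_triangle_ineq[of "\<tau> (c \<odot>\<^bsub>D\<^esub> x) - c * ntr (k i) a" "c * (ntr (k i) a - \<tau> x)"]
        by (simp add: algebra_simps)
      moreover have "cmod c * cnorm D (x \<ominus>\<^bsub>D\<^esub> e i a) \<le> cmod c * \<epsilon>"
        using a(2) by (intro mult_left_mono) auto
      ultimately show "cmod (\<tau> (c \<odot>\<^bsub>D\<^esub> x) - c * \<tau> x) \<le> 2 * cmod c * \<epsilon>" by linarith
    qed
    then show "\<tau> (c \<odot>\<^bsub>D\<^esub> x) = c * \<tau> x" by simp
  next
    fix x y assume xy: "x \<in> carrier D" "y \<in> carrier D"
    have "\<tau> (x \<oplus>\<^bsub>D\<^esub> y) - (\<tau> x + \<tau> y) = 0"
    proof (rule zero)
      fix \<epsilon> :: real assume "0 < \<epsilon>"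
      then obtain i a b where ab: "a \<in> carrier_mat (k i) (k i)" "b \<in> carrier_mat (k i) (k i)"
        "cnorm D (x \<ominus>\<^bsub>D\<^esub> e i a) < \<epsilon>" "cnorm D (y \<ominus>\<^bsub>D\<^esub> e i b) < \<epsilon>"
        using approx[OF xy] by blast
      note E = eD(1)[OF ab(1)] eD(1)[OF ab(2)]
      have "(x \<oplus>\<^bsub>D\<^esub> y) \<ominus>\<^bsub>D\<^esub> e i (a + b) = (x \<ominus>\<^bsub>D\<^esub> e i a) \<oplus>\<^bsub>D\<^esub> (y \<ominus>\<^bsub>D\<^esub> e i b)"
        unfolding eD(3)[OF ab(1,2)] using xy E by algebra
      then have "cmod (\<tau> (x \<oplus>\<^bsub>D\<^esub> y) - (ntr (k i) a + ntr (k i) b)) < \<epsilon> + \<epsilon>"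
        using \<tau>[of "x \<oplus>\<^bsub>D\<^esub> y" "a + b" i] xy ab E D.cnorm_triangle[of "x \<ominus>\<^bsub>D\<^esub> e i a" "y \<ominus>\<^bsub>D\<^esub> e i b"]
        by (simp add: ntr_add)
      moreover have "cmod (\<tau> x - ntr (k i) a) < \<epsilon>" "cmod (\<tau> y - ntr (k i) b) < \<epsilon>"
        using \<tau>[OF xy(1) ab(1)] \<tau>[OF xy(2) ab(2)] ab by auto
      moreover have "cmod (\<tau> (x \<oplus>\<^bsub>D\<^esub> y) - (\<tau> x + \<tau> y))
          \<le> cmod (\<tau> (x \<oplus>\<^bsub>D\<^esub> y) - (ntr (k i) a + ntr (k i) b))
            + (cmod (\<tau> x - ntr (k i) a) + cmod (\<tau> y - ntr (k i) b))"
        by (rule order_trans[OF _ add_left_mono[OF norm_triangle_ineq]],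
            rule order_trans[OF _ norm_triangle_ineq4]) (simp add: algebra_simps)
      ultimately show "cmod (\<tau> (x \<oplus>\<^bsub>D\<^esub> y) - (\<tau> x + \<tau> y)) \<le> 4 * \<epsilon>" by linarith
    qed
    then show "\<tau> (x \<oplus>\<^bsub>D\<^esub> y) = \<tau> x + \<tau> y" by simp
  next
    fix x y assume xy: "x \<in> carrier D" "y \<in> carrier D"
    have prod: "cmod (\<tau> (u \<otimes>\<^bsub>D\<^esub> w) - ntr (k i) (a * b)) \<le> (cnorm D u + cnorm D w + 1) * \<epsilon>"
      if uw: "u \<in> carrier D" "w \<in> carrier D"
        and ab: "a \<in> carrier_mat (k i) (k i)" "b \<in> carrier_mat (k i) (k i)"
          "cnorm D (u \<ominus>\<^bsub>D\<^esub> e i a) < \<epsilon>" "cnorm D (w \<ominus>\<^bsub>D\<^esub> e i b) < \<epsilon>" and eps: "0 < \<epsilon>" "\<epsilon> < 1"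
      for u w i a b \<epsilon>
    proof -
      note E = eD(1)[OF ab(1)] eD(1)[OF ab(2)]
      have "u \<otimes>\<^bsub>D\<^esub> w \<ominus>\<^bsub>D\<^esub> e i (a * b)
          = u \<otimes>\<^bsub>D\<^esub> (w \<ominus>\<^bsub>D\<^esub> e i b) \<oplus>\<^bsub>D\<^esub> (u \<ominus>\<^bsub>D\<^esub> e i a) \<otimes>\<^bsub>D\<^esub> e i b"
        unfolding eD(2)[OF ab(1,2)] using uw E by algebra
      then have "cnorm D (u \<otimes>\<^bsub>D\<^esub> w \<ominus>\<^bsub>D\<^esub> e i (a * b))
          \<le> cnorm D u * cnorm D (w \<ominus>\<^bsub>D\<^esub> e i b) + cnorm D (u \<ominus>\<^bsub>D\<^esub> e i a) * cnorm D (e i b)"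
        using D.cnorm_triangle[of "u \<otimes>\<^bsub>D\<^esub> (w \<ominus>\<^bsub>D\<^esub> e i b)" "(u \<ominus>\<^bsub>D\<^esub> e i a) \<otimes>\<^bsub>D\<^esub> e i b"]
          D.cnorm_mult[of u "w \<ominus>\<^bsub>D\<^esub> e i b"] D.cnorm_mult[of "u \<ominus>\<^bsub>D\<^esub> e i a" "e i b"] uw E by simp
      also have "\<dots> \<le> cnorm D u * \<epsilon> + \<epsilon> * (cnorm D w + 1)"
      proof (intro add_mono mult_mono)
        show "cnorm D (e i b) \<le> cnorm D w + 1"
          using D.cnorm_diff_le[OF uw(2) E(2)] ab(4) eps by linarith
      qed (use ab uw E eps in auto)
      finally show ?thesis
        using \<tau>[of "u \<otimes>\<^bsub>D\<^esub> w" "a * b" i] uw ab by (simp add: algebra_simps)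
    qed
    have "\<tau> (x \<otimes>\<^bsub>D\<^esub> y) - \<tau> (y \<otimes>\<^bsub>D\<^esub> x) = 0"
    proof (rule zero)
      fix \<epsilon> :: real assume eps: "0 < \<epsilon>" "\<epsilon> < 1"
      then obtain i a b where ab: "a \<in> carrier_mat (k i) (k i)" "b \<in> carrier_mat (k i) (k i)"
        "cnorm D (x \<ominus>\<^bsub>D\<^esub> e i a) < \<epsilon>" "cnorm D (y \<ominus>\<^bsub>D\<^esub> e i b) < \<epsilon>"
        using approx[OF xy] by blast
      let ?C = "cnorm D x + cnorm D y + 1"
      have "cmod (\<tau> (x \<otimes>\<^bsub>D\<^esub> y) - \<tau> (y \<otimes>\<^bsub>D\<^esub> x))
          \<le> cmod (\<tau> (x \<otimes>\<^bsub>D\<^esub> y) - ntr (k i) (a * b)) + cmod (\<tau> (y \<otimes>\<^bsub>D\<^esub> x) - ntr (k i) (b * a))"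
        using norm_triangle_ineq4[of "\<tau> (x \<otimes>\<^bsub>D\<^esub> y) - ntr (k i) (a * b)" "\<tau> (y \<otimes>\<^bsub>D\<^esub> x) - ntr (k i) (b * a)"]
          ntr_mult_commute[OF ab(1,2)] by simp
      also have "\<dots> \<le> ?C * \<epsilon> + ?C * \<epsilon>"
        using prod[OF xy ab eps] prod[OF xy(2,1) ab(2,1) ab(4,3) eps]
        unfolding add.commute[of "cnorm D y" "cnorm D x"] by (rule add_mono)
      finally show "cmod (\<tau> (x \<otimes>\<^bsub>D\<^esub> y) - \<tau> (y \<otimes>\<^bsub>D\<^esub> x)) \<le> 2 * ?C * \<epsilon>" by (simp add: algebra_simps)
    qed
    then show "\<tau> (x \<otimes>\<^bsub>D\<^esub> y) = \<tau> (y \<otimes>\<^bsub>D\<^esub> x)" by simp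
  qed
qed

section \<open>Projections in matrix algebras\<close>

lemma outer_mult:
  assumes "a \<in> carrier_mat n n" "w \<in> carrier_vec n"
  shows "outer n v w * a = outer n v (mat_adjoint a *\<^sub>v w)"
proof -
  have "outer n v w * a = mat_adjoint (mat_adjoint a * outer n w v)"
    using assms mat_adjoint_carrier[OF assms(1)]
    by (simp add: mat_adjoint_mult[of _ n] mat_adjoint_outer mat_adjoint_adjoint)
  also have "\<dots> = outer n v (mat_adjoint a *\<^sub>v w)"
    using mult_outer[OF mat_adjoint_carrier[OF assms(1)] assms(2)] by (simp add: mat_adjoint_outer)
  finally show ?thesis .
qed

lemma tr_outer: "w \<in> carrier_vec n \<Longrightarrow> tr n (outer n v w) = cinner w v"
  by (auto simp: tr_def outer_def cinner_def mult.commute intro!: sum.cong)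

lemma tr_adjoint_mult:
  assumes "a \<in> carrier_mat n n"
  shows "tr n (mat_adjoint a * a) = complex_of_real (\<Sum>i<n. \<Sum>j<n. (cmod (a $$ (j, i)))\<^sup>2)"
proof -
  have "tr n (mat_adjoint a * a) = (\<Sum>i<n. \<Sum>j<n. mat_adjoint a $$ (i, j) * a $$ (j, i))"
    unfolding tr_def by (intro sum.cong refl mult_mat_index[OF mat_adjoint_carrier[OF assms] assms]) auto
  also have "\<dots> = (\<Sum>i<n. \<Sum>j<n. complex_of_real ((cmod (a $$ (j, i)))\<^sup>2))"
    using assms by (intro sum.cong refl)
      (simp add: mat_adjoint_index complex_norm_square mult.commute del: of_real_power)
  finally show ?thesis by simp
qed

text \<open>Orthogonal projections.\<close>
definition projection_mat :: "nat \<Rightarrow> complex mat \<Rightarrow> bool" where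
  "projection_mat n p \<longleftrightarrow> p \<in> carrier_mat n n \<and> mat_adjoint p = p \<and> p * p = p"

lemma projection_tr_nonneg:
  assumes "projection_mat n p"
  shows "Im (tr n p) = 0" "0 \<le> Re (tr n p)" "tr n p = 0 \<longleftrightarrow> p = 0\<^sub>m n n"
proof -
  have p: "p \<in> carrier_mat n n" "mat_adjoint p * p = p" using assms by (auto simp: projection_mat_def)
  note t = tr_adjoint_mult[OF p(1), unfolded p(2)]
  show "Im (tr n p) = 0" "0 \<le> Re (tr n p)" unfolding t by (auto intro!: sum_nonneg)
  show "tr n p = 0 \<longleftrightarrow> p = 0\<^sub>m n n"
  proof
    assume "tr n p = 0"
    then have "(\<Sum>i<n. \<Sum>j<n. (cmod (p $$ (j, i)))\<^sup>2) = 0" unfolding t by (simp only: of_real_eq_0_iff)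
    then have "p $$ (j, i) = 0" if "i < n" "j < n" for i j
      using that by (simp add: sum_nonneg_eq_0_iff sum_nonneg)
    then show "p = 0\<^sub>m n n" using p by (intro eq_matI) auto
  qed (simp add: tr_def)
qed

text \<open>Splitting a rank-one projection off a nonzero projection.\<close>
lemma projection_split:
  assumes p: "projection_mat n p" and "p \<noteq> 0\<^sub>m n n"
  obtains x where "x \<in> carrier_vec n" "cinner x x = 1" "projection_mat n (p - outer n x x)"
    "(p - outer n x x) *\<^sub>v x = 0\<^sub>v n" "tr n (p - outer n x x) = tr n p - 1"
proof -
  have pc: "p \<in> carrier_mat n n" "mat_adjoint p = p" "p * p = p"
    using p by (auto simp: projection_mat_def)
  obtain i j where ij: "i < n" "j < n" "p $$ (i, j) \<noteq> 0"
    using assms(2) pc(1) by (metis carrier_matD eq_matI index_zero_mat)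
  define w where "w = p *\<^sub>v unit_vec n j"
  have w: "w \<in> carrier_vec n" using pc by (simp add: w_def)
  have pw: "p *\<^sub>v w = w"
    unfolding w_def using assoc_mult_mat_vec[OF pc(1) pc(1), of "unit_vec n j"] pc(3) by simp
  have "w $ i \<noteq> 0" using ij pc by (simp add: w_def)
  then have "w \<noteq> 0\<^sub>v n" using ij by auto
  define r where "r = euclidean_norm w"
  have r: "r > 0"
    using euclidean_norm_eq_0_iff[OF w] \<open>w \<noteq> 0\<^sub>v n\<close> euclidean_norm_nonneg[of w]
    unfolding r_def by linarith
  define x where "x = complex_of_real (1 / r) \<cdot>\<^sub>v w"
  have x: "x \<in> carrier_vec n" using w by (simp add: x_def)
  have "euclidean_norm x = 1" using r by (simp add: x_def euclidean_norm_smult norm_divide r_def[symmetric])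
  then have xx: "cinner x x = 1" by (simp add: cinner_self)
  have px: "p *\<^sub>v x = x" unfolding x_def using pc w pw by (simp add: mult_mat_vec)
  let ?o = "outer n x x"
  have po: "p * ?o = ?o" "?o * p = ?o" "?o * ?o = ?o"
    using mult_outer[OF pc(1) x, of x] outer_mult[OF pc(1) x, of x] pc(2) px
      outer_mult_outer[OF x, of x x x] xx by (simp_all add: one_smult_mat)
  interpret M: pre_cstar_algebra "mat_cstar n" by (rule pre_cstar_mat)
  have sub: "p - ?o \<in> carrier_mat n n" "p - ?o = p \<ominus>\<^bsub>mat_cstar n\<^esub> ?o"
    using pc by (auto simp: mat_cstar_minus intro!: minus_carrier_mat)
  have "mat_adjoint (p - ?o) = p - ?o"
    unfolding sub(2) using M.star_minus[of p ?o] pc by (simp add: mat_adjoint_outer)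
  moreover have "(p - ?o) * (p - ?o) = p - ?o"
  proof -
    have "(p - ?o) * (p - ?o) = p * (p - ?o) - ?o * (p - ?o)"
      using pc sub(1) by (intro minus_mult_distrib_mat[of _ n n _ _ n]) auto
    also have "p * (p - ?o) = p - ?o"
      using pc po mult_minus_distrib_mat[of p n n p n ?o] by simp
    also have "?o * (p - ?o) = ?o - ?o"
      using pc po mult_minus_distrib_mat[of ?o n n p n ?o] by simp
    finally show ?thesis using pc by (intro eq_matI) (auto simp: outer_def)
  qed
  ultimately have proj: "projection_mat n (p - ?o)" using sub by (simp add: projection_mat_def)
  have "?o *\<^sub>v x = x"
  proof (rule eq_vecI)
    fix i assume "i < dim_vec x"
    then have i: "i < n" using x by simp
    have "(?o *\<^sub>v x) $ i = x $ i * cinner x x"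
      unfolding mult_mat_vec_index[OF outer_carrier x i]
      using i x by (simp add: outer_def cinner_def sum_distrib_left mult.assoc)
    then show "(?o *\<^sub>v x) $ i = x $ i" by (simp add: xx)
  qed (use x in \<open>simp add: outer_def\<close>)
  then have "(p - ?o) *\<^sub>v x = 0\<^sub>v n"
    using minus_mult_distrib_mat_vec[of p n n ?o x] pc x px by simp
  moreover have "tr n (p - ?o) = tr n p - 1"
  proof -
    have "p - ?o = p + (-1) \<cdot>\<^sub>m ?o" using pc by (intro eq_matI) (auto simp: outer_def)
    then show ?thesis using pc x by (simp add: tr_add tr_smult tr_outer xx)
  qed
  ultimately show thesis using that x xx proj by blast
qed

text \<open>
  Projections of equal trace are equivalent through a partial isometry \<open>v\<close>, and their trace is a
  natural number: rank-one projections are split off both of them until nothing is left. The bound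
  \<open>N\<close> on the trace serves the induction only.
\<close>
lemma projection_equiv_aux:
  "\<lbrakk>projection_mat n p; projection_mat n q; tr n p = tr n q; Re (tr n p) \<le> real N\<rbrakk>
    \<Longrightarrow> tr n p \<in> \<nat> \<and> (\<exists>v\<in>carrier_mat n n. mat_adjoint v * v = p \<and> v * mat_adjoint v = q)"
proof (induction N arbitrary: p q)
  case 0
  have "Re (tr n p) = 0" "Im (tr n p) = 0" using projection_tr_nonneg[OF 0(1)] 0(4) by auto
  then have "tr n p = 0" by (simp add: complex_eq_iff)
  then have "p = 0\<^sub>m n n" "q = 0\<^sub>m n n"
    using 0 projection_tr_nonneg(3)[OF 0(1)] projection_tr_nonneg(3)[OF 0(2)] by auto
  moreover have "mat_adjoint (0\<^sub>m n n :: complex mat) = 0\<^sub>m n n"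
    using pre_cstar_algebra.star_zero[OF pre_cstar_mat[of n]] by simp
  ultimately show ?case using \<open>tr n p = 0\<close> by (intro conjI bexI[of _ "0\<^sub>m n n"]) auto
next
  case (Suc N)
  show ?case
  proof (cases "tr n p = 0")
    case True
    then show ?thesis using Suc.IH[OF Suc.prems(1-3)] by simp
  next
    case False
    then have nz: "p \<noteq> 0\<^sub>m n n" "q \<noteq> 0\<^sub>m n n"
      using Suc.prems projection_tr_nonneg(3)[of n p] projection_tr_nonneg(3)[of n q] by auto
    obtain x where x: "x \<in> carrier_vec n" "cinner x x = 1" "projection_mat n (p - outer n x x)"
      "(p - outer n x x) *\<^sub>v x = 0\<^sub>v n" "tr n (p - outer n x x) = tr n p - 1"
      using projection_split[OF Suc.prems(1) nz(1)] .
    obtain y where y: "y \<in> carrier_vec n" "cinner y y = 1" "projection_mat n (q - outer n y y)"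
      "(q - outer n y y) *\<^sub>v y = 0\<^sub>v n" "tr n (q - outer n y y) = tr n q - 1"
      using projection_split[OF Suc.prems(2) nz(2)] .
    let ?p = "p - outer n x x" and ?q = "q - outer n y y" and ?o = "outer n y x"
    have IH: "tr n ?p \<in> \<nat> \<and> (\<exists>v\<in>carrier_mat n n. mat_adjoint v * v = ?p \<and> v * mat_adjoint v = ?q)"
      by (rule Suc.IH[OF x(3) y(3)]) (use x(5) y(5) Suc.prems in auto)
    then obtain v where v: "v \<in> carrier_mat n n" "mat_adjoint v * v = ?p" "v * mat_adjoint v = ?q"
      by blast
    note v' = mat_adjoint_carrier[OF v(1)]
    have vx: "v *\<^sub>v x = 0\<^sub>v n"
    proof -
      have "cinner (v *\<^sub>v x) (v *\<^sub>v x) = cinner (?p *\<^sub>v x) x"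
        using cinner_adjoint[OF v(1), of "v *\<^sub>v x" x] v x(1) assoc_mult_mat_vec[OF v' v(1) x(1)] by simp
      then have "euclidean_norm (v *\<^sub>v x) = 0"
        unfolding x(4) using x(1) by (simp add: cinner_self cinner_def)
      then show ?thesis using euclidean_norm_eq_0_iff[of "v *\<^sub>v x" n] v x by simp
    qed
    have vy: "mat_adjoint v *\<^sub>v y = 0\<^sub>v n"
    proof -
      have "cinner (mat_adjoint v *\<^sub>v y) (mat_adjoint v *\<^sub>v y) = cinner (?q *\<^sub>v y) y"
        using cinner_adjoint[OF v', of "mat_adjoint v *\<^sub>v y" y] v v' y(1)
          assoc_mult_mat_vec[OF v(1) v' y(1)] by (simp add: mat_adjoint_adjoint)
      then have "euclidean_norm (mat_adjoint v *\<^sub>v y) = 0"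
        unfolding y(4) using y(1) by (simp add: cinner_self cinner_def)
      then show ?thesis using euclidean_norm_eq_0_iff[of "mat_adjoint v *\<^sub>v y" n] v' y by simp
    qed
    have out0: "outer n (0\<^sub>v n) z = 0\<^sub>m n n" "outer n z (0\<^sub>v n) = 0\<^sub>m n n" for z
      by (auto simp: outer_def intro!: eq_matI)
    have o: "mat_adjoint ?o = outer n x y" "mat_adjoint v * ?o = 0\<^sub>m n n" "outer n x y * v = 0\<^sub>m n n"
      "v * outer n x y = 0\<^sub>m n n" "?o * mat_adjoint v = 0\<^sub>m n n"
      "outer n x y * ?o = outer n x x" "?o * outer n x y = outer n y y"
      using mult_outer[OF v' y(1), of x] outer_mult[OF v(1) y(1), of x] mult_outer[OF v(1) x(1), of y]
        outer_mult[OF v' x(1), of y] vx vy v(1)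
      by (simp_all add: mat_adjoint_outer out0 mat_adjoint_adjoint outer_mult_outer x y one_smult_mat)
    have oc: "outer n z z' \<in> carrier_mat n n" for z z' by simp
    have p_eq: "?p + outer n x x = p" "?q + outer n y y = q"
      using Suc.prems by (auto simp: projection_mat_def outer_def intro!: eq_matI)
    let ?u = "v + ?o"
    have u: "?u \<in> carrier_mat n n" "mat_adjoint ?u = mat_adjoint v + outer n x y"
      using v(1) by (auto simp: mat_adjoint_add[of _ n] o)
    have "mat_adjoint ?u * ?u = mat_adjoint v * ?u + outer n x y * ?u"
      unfolding u(2) by (rule add_mult_distrib_mat[OF v' oc u(1)])
    also have "\<dots> = ?p + outer n x x"
      using mult_add_distrib_mat[OF v' v(1) oc, of y x] mult_add_distrib_mat[OF oc v(1) oc, of x y y x]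
        o v x(3) by (simp add: projection_mat_def)
    finally have 1: "mat_adjoint ?u * ?u = p" using p_eq by simp
    have "?u * mat_adjoint ?u = v * mat_adjoint ?u + ?o * mat_adjoint ?u"
      using u v(1) v' by (intro add_mult_distrib_mat[of _ n n _ _ n]) auto
    also have "\<dots> = ?q + outer n y y"
      unfolding u(2) using mult_add_distrib_mat[OF v(1) v' oc, of x y]
        mult_add_distrib_mat[OF oc v' oc, of y x x y] o v y(3) by (simp add: projection_mat_def)
    finally have 2: "?u * mat_adjoint ?u = q" using p_eq by simp
    have "tr n p = tr n ?p + 1" using x(5) by simp
    then have "tr n p \<in> \<nat>" using IH by (metis Nats_1 Nats_add)
    then show ?thesis using 1 2 u(1) by blast
  qed
qed

lemma projection_equiv:
  assumes "projection_mat n p" "projection_mat n q" "tr n p = tr n q"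
  obtains v where "v \<in> carrier_mat n n" "mat_adjoint v * v = p" "v * mat_adjoint v = q"
  using projection_equiv_aux[OF assms real_nat_ceiling_ge] by blast

lemma projection_tr_Nats: "projection_mat n p \<Longrightarrow> tr n p \<in> \<nat>"
  using projection_equiv_aux[OF _ _ refl real_nat_ceiling_ge] by blast

section \<open>Divisibility of the matrix sizes\<close>

text \<open>
  The image of a minimal projection of \<open>M\<^sub>m\<close> has trace \<open>1 / m\<close>. It is similar to a nearby projection in
  one of the matrix algebras of the tower, whose trace is an integer divided by the matrix size.
\<close>
theorem tower_hom_imp_dvd:
  assumes D: "unital_cstar_algebra D" and tower: "matrix_tower D k e"
    and m: "0 < m" and g: "unital_star_hom (mat_cstar m) D g"
  shows "\<exists>j. m dvd k j"
proof -
  note preD = unital_cstar_imp_pre_cstar[OF D] and complete = unital_cstar_algebra.complete[OF D]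
  interpret D: pre_cstar_algebra D by (rule preD)
  note gD = unital_star_homD[OF g, simplified]
  obtain \<tau> where \<tau>: "\<And>x y. \<lbrakk>x \<in> carrier D; y \<in> carrier D\<rbrakk> \<Longrightarrow> \<tau> (x \<oplus>\<^bsub>D\<^esub> y) = \<tau> x + \<tau> y"
    "\<And>c x. x \<in> carrier D \<Longrightarrow> \<tau> (c \<odot>\<^bsub>D\<^esub> x) = c * \<tau> x"
    "\<And>x y. \<lbrakk>x \<in> carrier D; y \<in> carrier D\<rbrakk> \<Longrightarrow> \<tau> (x \<otimes>\<^bsub>D\<^esub> y) = \<tau> (y \<otimes>\<^bsub>D\<^esub> x)"
    "\<And>i a. a \<in> carrier_mat (k i) (k i) \<Longrightarrow> \<tau> (e i a) = ntr (k i) a"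
    using tower_trace[OF preD tower] by blast
  have "\<tau> (e 0 (1\<^sub>m (k 0))) = 1"
    using \<tau>(4)[of "1\<^sub>m (k 0)" 0] ntr_one matrix_towerD(2)[OF tower] by simp
  then have \<tau>1: "\<tau> \<one>\<^bsub>D\<^esub> = 1"
    using unital_star_homD(4)[OF matrix_towerD(4)[OF tower, of 0]] by simp
  define p where "p = g (munit m 0 0)"
  have p: "p \<in> carrier D" "star D p = p" "p \<otimes>\<^bsub>D\<^esub> p = p"
    using gD(1)[of "munit m 0 0"] gD(6)[of "munit m 0 0"] gD(2)[of "munit m 0 0" "munit m 0 0"] m
    by (auto simp: p_def mat_adjoint_munit munit_mult)
  have "\<tau> (g (munit m 0 0)) = \<tau> (g (1\<^sub>m m)) * ntr m (munit m 0 0)"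
    by (rule trace_unique[OF m]) (auto simp: gD \<tau>)
  then have \<tau>p: "\<tau> p = 1 / of_nat m"
    using m by (simp add: gD \<tau>1 p_def ntr_def tr_munit)
  have p1: "cnorm D p \<le> 1" using D.cnorm_selfadjoint_unit[OF p] by (cases "p = \<zero>\<^bsub>D\<^esub>") auto
  \<comment> \<open>\<open>1/16\<close> is small enough to make the self-adjoint part \<open>a\<close> of \<open>b\<close> satisfy \<open>\<parallel>a\<^sup>2 - a\<parallel> < 1/4\<close>\<close>
  obtain j b where b: "b \<in> carrier_mat (k j) (k j)" "cnorm D (p \<ominus>\<^bsub>D\<^esub> e j b) < 1/16"
    using matrix_tower_dense[OF tower p(1) zero_less_divide_1_iff[THEN iffD2, OF zero_less_numeral]] by blast
  interpret M: pre_cstar_algebra "mat_cstar (k j)" by (rule pre_cstar_mat)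
  note ehom = matrix_towerD(4)[OF tower, of j]
  note eD = unital_star_homD[OF ehom, simplified]
  note e_minus = unital_star_hom_zero_minus(2)[OF pre_cstar_mat preD ehom, simplified]
  have e_iso: "cnorm D (e j x) = opnorm (k j) x" if "x \<in> carrier_mat (k j) (k j)" for x
    using hom_mat_isometric[OF preD matrix_towerD(1)[OF tower] ehom that] .
  define a where "a = (1/2) \<cdot>\<^sub>m (b + mat_adjoint b)"
  have a: "a \<in> carrier_mat (k j) (k j)" "mat_adjoint a = a"
    using b(1) mat_adjoint_carrier[OF b(1)] comm_add_mat[OF b(1) mat_adjoint_carrier[OF b(1)]]
    by (auto simp: a_def mat_adjoint_smult[of _ "k j"] mat_adjoint_add[of _ "k j"] mat_adjoint_adjoint)
  define f where "f = e j a"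
  define y where "y = e j b"
  have y: "y \<in> carrier D" and f: "f \<in> carrier D" using eD(1) a(1) b(1) by (auto simp: y_def f_def)
  have f_eq: "f = (1/2) \<odot>\<^bsub>D\<^esub> (y \<oplus>\<^bsub>D\<^esub> star D y)"
    using b(1) mat_adjoint_carrier[OF b(1)] by (simp add: f_def a_def y_def eD)
  have pf: "cnorm D (p \<ominus>\<^bsub>D\<^esub> f) < 1/16"
  proof -
    have "p = (1/2) \<odot>\<^bsub>D\<^esub> (p \<oplus>\<^bsub>D\<^esub> star D p)"
      using D.smult_smult[of p "1/2" 2] D.smult_add_left[of p 1 1] p by simp
    then have "p \<ominus>\<^bsub>D\<^esub> f = (1/2) \<odot>\<^bsub>D\<^esub> ((p \<oplus>\<^bsub>D\<^esub> star D p) \<ominus>\<^bsub>D\<^esub> (y \<oplus>\<^bsub>D\<^esub> star D y))"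
      unfolding f_eq using p y D.smult_minus_right[of "p \<oplus>\<^bsub>D\<^esub> star D p" "y \<oplus>\<^bsub>D\<^esub> star D y" "1/2"] by simp
    also have "(p \<oplus>\<^bsub>D\<^esub> star D p) \<ominus>\<^bsub>D\<^esub> (y \<oplus>\<^bsub>D\<^esub> star D y) = (p \<ominus>\<^bsub>D\<^esub> y) \<oplus>\<^bsub>D\<^esub> star D (p \<ominus>\<^bsub>D\<^esub> y)"
      unfolding D.star_minus[OF p(1) y] using p(1) y D.star_closed[OF p(1)] D.star_closed[OF y] by algebra
    finally show ?thesis
      using D.cnorm_triangle[of "p \<ominus>\<^bsub>D\<^esub> y" "star D (p \<ominus>\<^bsub>D\<^esub> y)"] p y b(2)
      by (simp add: D.cnorm_smult y_def)
  qed
  have "cnorm D (f \<otimes>\<^bsub>D\<^esub> f \<ominus>\<^bsub>D\<^esub> f) < 1/4"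
  proof -
    define r where "r = f \<ominus>\<^bsub>D\<^esub> p"
    have r: "r \<in> carrier D" "cnorm D r < 1/16"
      using p f pf D.cnorm_minus_commute[of p f] by (auto simp: r_def)
    have f1: "cnorm D f \<le> 2" using D.cnorm_diff_le[of p f] p1 pf p f by simp
    have "f \<otimes>\<^bsub>D\<^esub> f \<ominus>\<^bsub>D\<^esub> f = f \<otimes>\<^bsub>D\<^esub> r \<oplus>\<^bsub>D\<^esub> r \<otimes>\<^bsub>D\<^esub> p \<ominus>\<^bsub>D\<^esub> r \<oplus>\<^bsub>D\<^esub> (p \<otimes>\<^bsub>D\<^esub> p \<ominus>\<^bsub>D\<^esub> p)"
      unfolding r_def using f p(1) by algebra
    also have "p \<otimes>\<^bsub>D\<^esub> p \<ominus>\<^bsub>D\<^esub> p = \<zero>\<^bsub>D\<^esub>" using D.minus_eq_zero_iff[of p p] p by simp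
    finally have "f \<otimes>\<^bsub>D\<^esub> f \<ominus>\<^bsub>D\<^esub> f = f \<otimes>\<^bsub>D\<^esub> r \<oplus>\<^bsub>D\<^esub> r \<otimes>\<^bsub>D\<^esub> p \<ominus>\<^bsub>D\<^esub> r" using f r p by simp
    then have "cnorm D (f \<otimes>\<^bsub>D\<^esub> f \<ominus>\<^bsub>D\<^esub> f) \<le> cnorm D f * cnorm D r + cnorm D r * cnorm D p + cnorm D r"
      using D.cnorm_minus_le[of "f \<otimes>\<^bsub>D\<^esub> r \<oplus>\<^bsub>D\<^esub> r \<otimes>\<^bsub>D\<^esub> p" r] D.cnorm_triangle[of "f \<otimes>\<^bsub>D\<^esub> r" "r \<otimes>\<^bsub>D\<^esub> p"]
        D.cnorm_mult[of f r] D.cnorm_mult[of r p] f r p by simp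
    also have "\<dots> \<le> 2 * cnorm D r + cnorm D r * 1 + cnorm D r"
      using f1 p1 r p(1) by (intro add_mono mult_mono order_refl) auto
    finally show ?thesis using r(2) by simp
  qed
  moreover have "e j (a \<otimes>\<^bsub>mat_cstar (k j)\<^esub> a \<ominus>\<^bsub>mat_cstar (k j)\<^esub> a) = f \<otimes>\<^bsub>D\<^esub> f \<ominus>\<^bsub>D\<^esub> f"
    using a(1) e_minus[of "a * a" a] by (simp add: eD f_def)
  ultimately have "opnorm (k j) (a \<otimes>\<^bsub>mat_cstar (k j)\<^esub> a \<ominus>\<^bsub>mat_cstar (k j)\<^esub> a) < 1/4"
    using e_iso[of "a \<otimes>\<^bsub>mat_cstar (k j)\<^esub> a \<ominus>\<^bsub>mat_cstar (k j)\<^esub> a"] M.Alg.minus_closed[of "a * a" a] a(1)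
    by simp
  then obtain q where q: "q \<in> carrier_mat (k j) (k j)" "mat_adjoint q = q" "q * q = q"
    "opnorm (k j) (q \<ominus>\<^bsub>mat_cstar (k j)\<^esub> a) < 1/2"
    using M.projection_near[OF unital_cstar_algebra.complete[OF cstar_mat], of a] a by auto
  define q' where "q' = e j q"
  have q': "q' \<in> carrier D" "star D q' = q'" "q' \<otimes>\<^bsub>D\<^esub> q' = q'"
    using eD(1)[OF q(1)] eD(6)[OF q(1)] eD(2)[OF q(1) q(1)] q by (auto simp: q'_def)
  have "cnorm D (q' \<ominus>\<^bsub>D\<^esub> f) < 1/2"
    using e_iso[of "q \<ominus>\<^bsub>mat_cstar (k j)\<^esub> a"] M.Alg.minus_closed[of q a] e_minus[of q a] q a(1)
    by (simp add: q'_def f_def)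
  then have "cnorm D (p \<ominus>\<^bsub>D\<^esub> q') < 1"
    using D.cnorm_minus_triangle[OF p(1) f q'(1)] pf D.cnorm_minus_commute[OF f q'(1)] by simp
  then obtain z w where zw: "z \<in> carrier D" "w \<in> carrier D" "z \<otimes>\<^bsub>D\<^esub> w = \<one>\<^bsub>D\<^esub>"
    "w \<otimes>\<^bsub>D\<^esub> z = \<one>\<^bsub>D\<^esub>" "z \<otimes>\<^bsub>D\<^esub> p = q' \<otimes>\<^bsub>D\<^esub> z"
    using D.projections_similar[OF complete p q'] by blast
  have "q' = (z \<otimes>\<^bsub>D\<^esub> p) \<otimes>\<^bsub>D\<^esub> w"
    unfolding zw(5) using zw(1,2) q'(1) by (simp add: D.Alg.m_assoc zw(3))
  then have "\<tau> q' = \<tau> (w \<otimes>\<^bsub>D\<^esub> (z \<otimes>\<^bsub>D\<^esub> p))" using \<tau>(3)[of "z \<otimes>\<^bsub>D\<^esub> p" w] zw p q'(1) by simp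
  also have "w \<otimes>\<^bsub>D\<^esub> (z \<otimes>\<^bsub>D\<^esub> p) = p" using zw(1,2) p(1) by (simp add: D.Alg.m_assoc[symmetric] zw(4))
  finally have "tr (k j) q / of_nat (k j) = 1 / of_nat m"
    using \<tau>(4)[OF q(1)] \<tau>p by (simp add: q'_def ntr_def)
  moreover obtain s where "tr (k j) q = of_nat s"
    using projection_tr_Nats[of "k j" q] q by (auto simp: projection_mat_def Nats_def)
  ultimately have "of_nat s * of_nat m = (of_nat (k j) :: complex)"
    using m matrix_towerD(2)[OF tower, of j] by (simp add: field_simps)
  then have "s * m = k j" by (metis of_nat_mult of_nat_eq_iff)
  then show ?thesis by (metis dvd_triv_right)
qed

section \<open>Homomorphisms between matrix algebras\<close>

text \<open>Amplification \<open>a \<mapsto> a \<oplus> \<dots> \<oplus> a\<close> with \<open>m\<close> diagonal blocks.\<close>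
definition amplify :: "nat \<Rightarrow> nat \<Rightarrow> complex mat \<Rightarrow> complex mat" where
  "amplify m l a = mat (m * l) (m * l)
     (\<lambda>(i, j). if i div l = j div l then a $$ (i mod l, j mod l) else 0)"

lemma sum_block:
  fixes f :: "nat \<Rightarrow> 'a::comm_monoid_add"
  assumes "s < m" "0 < l"
  shows "(\<Sum>r<m * l. if r div l = s then f (r mod l) else 0) = (\<Sum>t<l. f t)"
proof -
  have "(\<Sum>r<m * l. if r div l = s then f (r mod l) else 0) = (\<Sum>r | r < m * l \<and> r div l = s. f (r mod l))"
    by (subst sum.inter_filter[symmetric]) auto
  also have "\<dots> = (\<Sum>t<l. f t)"
  proof (rule sum.reindex_bij_witness[where i = "\<lambda>t. s * l + t" and j = "\<lambda>r. r mod l"])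
    fix t assume "t \<in> {..<l}"
    then have t: "t < l" by simp
    have "s * l + t < s * l + l" using t by simp
    also have "\<dots> = Suc s * l" by simp
    also have "\<dots> \<le> m * l" using assms(1) by (intro mult_right_mono) auto
    finally show "s * l + t \<in> {r. r < m * l \<and> r div l = s}" using t assms by simp
  qed (use assms in auto)
  finally show ?thesis .
qed

lemma amplify_hom:
  assumes "0 < m" "0 < l"
  shows "unital_star_hom (mat_cstar l) (mat_cstar (m * l)) (amplify m l)"
proof (rule unital_star_homI; (unfold mat_cstar_simps)?)
  have md: "i mod l < l" for i using assms by simp
  have carr: "amplify m l x \<in> carrier_mat (m * l) (m * l)" for x by (simp add: amplify_def)
  fix a b :: "complex mat" and c :: complex assume a: "a \<in> carrier_mat l l"
  show "amplify m l a \<in> carrier_mat (m * l) (m * l)" by (rule carr)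
  show "amplify m l (c \<cdot>\<^sub>m a) = c \<cdot>\<^sub>m amplify m l a"
    using a md by (intro eq_matI) (auto simp: amplify_def)
  show "amplify m l (mat_adjoint a) = mat_adjoint (amplify m l a)"
  proof (rule eq_matI)
    fix i j assume "i < dim_row (mat_adjoint (amplify m l a))" "j < dim_col (mat_adjoint (amplify m l a))"
    then have ij: "i < m * l" "j < m * l" using mat_adjoint_carrier[OF carr, of a] by auto
    show "amplify m l (mat_adjoint a) $$ (i, j) = mat_adjoint (amplify m l a) $$ (i, j)"
      unfolding mat_adjoint_index[OF carr ij]
      using ij by (simp add: amplify_def mat_adjoint_index[OF a md md])
  qed (use mat_adjoint_carrier[OF carr, of a] carr[of "mat_adjoint a"] in auto)
  assume b: "b \<in> carrier_mat l l"
  show "amplify m l (a + b) = amplify m l a + amplify m l b"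
    using a b md by (intro eq_matI) (auto simp: amplify_def)
  show "amplify m l (a * b) = amplify m l a * amplify m l b"
  proof (rule eq_matI)
    fix i j assume "i < dim_row (amplify m l a * amplify m l b)" "j < dim_col (amplify m l a * amplify m l b)"
    then have ij: "i < m * l" "j < m * l" by (auto simp: amplify_def)
    have iblock: "i div l < m" using ij assms by (simp add: less_mult_imp_div_less)
    let ?f = "\<lambda>t. (if i div l = j div l then a $$ (i mod l, t) * b $$ (t, j mod l) else 0)"
    have "(amplify m l a * amplify m l b) $$ (i, j)
        = (\<Sum>r<m * l. amplify m l a $$ (i, r) * amplify m l b $$ (r, j))"
      by (rule mult_mat_index[OF carr carr ij])
    also have "\<dots> = (\<Sum>r<m * l. if r div l = i div l then ?f (r mod l) else 0)"
      using ij by (intro sum.cong refl) (auto simp: amplify_def)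
    also have "\<dots> = (\<Sum>t<l. ?f t)" by (rule sum_block[OF iblock assms(2)])
    also have "\<dots> = amplify m l (a * b) $$ (i, j)"
      using ij mult_mat_index[OF a b md md, of i j] by (simp add: amplify_def)
    finally show "amplify m l (a * b) $$ (i, j) = (amplify m l a * amplify m l b) $$ (i, j)" by simp
  qed (auto simp: amplify_def)
next
  have md: "i mod l < l" for i using assms by simp
  have "i div l = j div l \<and> i mod l = j mod l \<longleftrightarrow> i = j" for i j
    by (metis div_mult_mod_eq)
  then show "amplify m l (1\<^sub>m l) = 1\<^sub>m (m * l)"
    using md by (intro eq_matI) (auto simp: amplify_def)
qed

context pre_cstar_algebra
begin

text \<open>
  Two representations of a matrix algebra whose minimal projections are equivalent, through
  a partial isometry \<open>v\<close>, are unitarily equivalent; the unitary is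
  \<open>\<Sum>\<^sub>i \<psi>(e\<^sub>i\<^sub>0) v \<phi>(e\<^sub>0\<^sub>i)\<close>.
\<close>
lemma unitary_intertwiner:
  assumes n: "0 < n" and \<phi>: "unital_star_hom (mat_cstar n) A \<phi>" and \<psi>: "unital_star_hom (mat_cstar n) A \<psi>"
    and v: "v \<in> carrier A" "star A v \<otimes> v = \<phi> (munit n 0 0)" "v \<otimes> star A v = \<psi> (munit n 0 0)"
  obtains u where "u \<in> carrier A" "star A u \<otimes> u = \<one>" "u \<otimes> star A u = \<one>"
    "\<And>a. a \<in> carrier_mat n n \<Longrightarrow> u \<otimes> \<phi> a = \<psi> a \<otimes> u"
proof -
  note p = unital_star_homD[OF \<phi>, simplified] and q = unital_star_homD[OF \<psi>, simplified]
  have pz: "\<phi> (0\<^sub>m n n) = \<zero>" "\<psi> (0\<^sub>m n n) = \<zero>"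
    using unital_star_hom_zero_minus(1)[OF pre_cstar_mat pre_cstar_algebra_axioms \<phi>]
      unital_star_hom_zero_minus(1)[OF pre_cstar_mat pre_cstar_algebra_axioms \<psi>] by simp_all
  note [simp] = p(1)[OF munit_carrier] q(1)[OF munit_carrier]
  have pm: "\<phi> (munit n i j) \<otimes> \<phi> (munit n j' l) = (if j = j' then \<phi> (munit n i l) else \<zero>)"
    and qm: "\<psi> (munit n i j) \<otimes> \<psi> (munit n j' l) = (if j = j' then \<psi> (munit n i l) else \<zero>)"
    if "j < n" "j' < n" for i j j' l
    using p(2)[OF munit_carrier munit_carrier, of i j j' l] q(2)[OF munit_carrier munit_carrier, of i j j' l]
    by (auto simp: munit_mult that pz)
  define T where "T i j = \<psi> (munit n i 0) \<otimes> v \<otimes> \<phi> (munit n 0 j)" for i j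
  have T: "T i j \<in> carrier A" for i j using v by (simp add: T_def)
  have Tp: "T i j \<otimes> \<phi> (munit n j' l) = (if j = j' then T i l else \<zero>)" if "j < n" "j' < n" for i j j' l
    using v that pm[OF that, of 0 l] by (simp add: T_def Alg.m_assoc)
  have qT: "\<psi> (munit n i j) \<otimes> T j' l = (if j = j' then T i l else \<zero>)" if "j < n" "j' < n" for i j j' l
    using v that qm[OF that, of i 0] by (simp add: T_def Alg.m_assoc[symmetric])
  \<comment> \<open>the partial sums \<open>T 0 0 + \<dots> + T (m - 1) (m - 1)\<close>, characterised by their products with
    the matrix units\<close>
  have "\<exists>u\<in>carrier A. \<forall>i<n. \<forall>j<n.
      u \<otimes> \<phi> (munit n i j) = (if i < m then T i j else \<zero>) \<and>
      \<psi> (munit n i j) \<otimes> u = (if j < m then T i j else \<zero>)" if "m \<le> n" for m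
    using that
  proof (induction m)
    case 0
    show ?case by (rule bexI[of _ \<zero>]) auto
  next
    case (Suc m)
    then obtain u where u: "u \<in> carrier A"
      "\<And>i j. i < n \<Longrightarrow> j < n \<Longrightarrow> u \<otimes> \<phi> (munit n i j) = (if i < m then T i j else \<zero>)"
      "\<And>i j. i < n \<Longrightarrow> j < n \<Longrightarrow> \<psi> (munit n i j) \<otimes> u = (if j < m then T i j else \<zero>)"
      by auto
    show ?case
    proof (intro bexI allI impI conjI)
      show "u \<oplus> T m m \<in> carrier A" using u T by simp
      fix i j assume ij: "i < n" "j < n"
      have m: "m < n" using Suc by simp
      show "(u \<oplus> T m m) \<otimes> \<phi> (munit n i j) = (if i < Suc m then T i j else \<zero>)"
        using u(1) T by (simp add: Alg.l_distr u(2)[OF ij] Tp[OF m ij(1)] less_Suc_eq)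
      show "\<psi> (munit n i j) \<otimes> (u \<oplus> T m m) = (if j < Suc m then T i j else \<zero>)"
        using u(1) T by (simp add: Alg.r_distr u(3)[OF ij] qT[OF ij(2) m] less_Suc_eq)
    qed
  qed
  then obtain u where u: "u \<in> carrier A"
    "\<And>i j. i < n \<Longrightarrow> j < n \<Longrightarrow> u \<otimes> \<phi> (munit n i j) = T i j"
    "\<And>i j. i < n \<Longrightarrow> j < n \<Longrightarrow> \<psi> (munit n i j) \<otimes> u = T i j"
    by (metis order_refl)
  have inter: "u \<otimes> \<phi> a = \<psi> a \<otimes> u" if "a \<in> carrier_mat n n" for a
  proof (rule mat_unit_induct[OF that])
    fix a b assume "a \<in> carrier_mat n n" "b \<in> carrier_mat n n" "u \<otimes> \<phi> a = \<psi> a \<otimes> u" "u \<otimes> \<phi> b = \<psi> b \<otimes> u"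
    then show "u \<otimes> \<phi> (a + b) = \<psi> (a + b) \<otimes> u"
      using u(1) p(1) q(1) by (simp add: p(3) q(3) Alg.r_distr Alg.l_distr)
  next
    fix c i j assume "i < n" "j < n"
    then show "u \<otimes> \<phi> (c \<cdot>\<^sub>m munit n i j) = \<psi> (c \<cdot>\<^sub>m munit n i j) \<otimes> u"
      using u by (simp add: p(5) q(5) smult_mult_left smult_mult_right)
  qed (use u(1) pz in simp)
  \<comment> \<open>an element that commutes with a representation and fixes the image of a minimal projection
    is the unit; this applies to \<open>u\<^sup>* u\<close> and to \<open>u u\<^sup>*\<close>\<close>
  have one: "w = \<one>"
    if h: "unital_star_hom (mat_cstar n) A h" and w: "w \<in> carrier A"
      "\<And>a. a \<in> carrier_mat n n \<Longrightarrow> w \<otimes> h a = h a \<otimes> w" "w \<otimes> h (munit n 0 0) = h (munit n 0 0)" for w h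
  proof -
    note hD = unital_star_homD[OF h, simplified]
    have hz: "h (0\<^sub>m n n) = \<zero>"
      using unital_star_hom_zero_minus(1)[OF pre_cstar_mat pre_cstar_algebra_axioms h] by simp
    note [simp] = hD(1)[OF munit_carrier]
    have unit: "w \<otimes> h (munit n i j) = h (munit n i j)" if "i < n" "j < n" for i j
    proof -
      have hm: "h (munit n i j) = h (munit n i 0) \<otimes> h (munit n 0 0) \<otimes> h (munit n 0 j)"
        using hD(2)[of "munit n i 0" "munit n 0 0"] hD(2)[of "munit n i 0" "munit n 0 j"] n
        by (simp add: munit_mult)
      have "w \<otimes> h (munit n i j) = (w \<otimes> h (munit n i 0)) \<otimes> h (munit n 0 0) \<otimes> h (munit n 0 j)"
        unfolding hm using w(1) by (simp add: Alg.m_assoc)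
      also have "\<dots> = h (munit n i 0) \<otimes> (w \<otimes> h (munit n 0 0)) \<otimes> h (munit n 0 j)"
        unfolding w(2)[OF munit_carrier, of i 0] using w(1) by (simp add: Alg.m_assoc)
      also have "\<dots> = h (munit n i j)" unfolding w(3) hm ..
      finally show ?thesis .
    qed
    have "w \<otimes> h a = h a" if "a \<in> carrier_mat n n" for a
    proof (rule mat_unit_induct[OF that])
      show "w \<otimes> h (a + b) = h (a + b)"
        if "a \<in> carrier_mat n n" "b \<in> carrier_mat n n" "w \<otimes> h a = h a" "w \<otimes> h b = h b" for a b
        using w(1) hD(1) that by (simp add: hD(3) Alg.r_distr)
    qed (use w(1) hz unit in \<open>auto simp: hD(5) smult_mult_right\<close>)
    from this[of "1\<^sub>m n"] show ?thesis using w(1) by (simp add: hD(4))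
  qed
  have inter': "star A u \<otimes> \<psi> a = \<phi> a \<otimes> star A u" if a: "a \<in> carrier_mat n n" for a
  proof -
    have "star A (u \<otimes> \<phi> (mat_adjoint a)) = star A (\<psi> (mat_adjoint a) \<otimes> u)"
      using inter[OF mat_adjoint_carrier[OF a]] by simp
    then show ?thesis
      using u(1) p(1)[OF a] q(1)[OF a] a by (simp add: p(6) q(6) star_mult)
  qed
  have pp: "star A (\<phi> (munit n 0 0)) = \<phi> (munit n 0 0)" "\<phi> (munit n 0 0) \<otimes> \<phi> (munit n 0 0) = \<phi> (munit n 0 0)"
    "star A (\<psi> (munit n 0 0)) = \<psi> (munit n 0 0)" "\<psi> (munit n 0 0) \<otimes> \<psi> (munit n 0 0) = \<psi> (munit n 0 0)"
    using p(6)[of "munit n 0 0"] q(6)[of "munit n 0 0"] pm[of 0 0 0 0] qm[of 0 0 0 0] n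
    by (simp_all add: mat_adjoint_munit)
  let ?p = "\<phi> (munit n 0 0)" and ?q = "\<psi> (munit n 0 0)"
  have vp: "v \<otimes> ?p = v"
  proof -
    let ?d = "v \<ominus> v \<otimes> ?p"
    have "star A ?d \<otimes> ?d = star A v \<otimes> v \<ominus> (star A v \<otimes> v) \<otimes> ?p \<ominus> ?p \<otimes> (star A v \<otimes> v)
        \<oplus> ?p \<otimes> (star A v \<otimes> v) \<otimes> ?p"
    proof -
      have "star A ?d = star A v \<ominus> ?p \<otimes> star A v" using v(1) pp(1) by (simp add: star_minus star_mult)
      moreover have "?p \<in> carrier A" by simp
      ultimately show ?thesis using v(1) star_closed[OF v(1)] by algebra
    qed
    also have "\<dots> = ?p \<ominus> ?p \<ominus> ?p \<oplus> ?p" unfolding v(2) pp(2) ..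
    also have "\<dots> = \<zero>"
      using minus_eq_zero_iff[of ?p ?p] Alg.l_neg[of ?p] by (simp add: a_minus_def)
    finally have "(cnorm A ?d)\<^sup>2 = 0" using cstar_identity[of ?d] v(1) by simp
    then have "?d = \<zero>" using cnorm_eq_zero_iff[of ?d] v(1) by simp
    then show ?thesis using minus_eq_zero_iff[of v "v \<otimes> ?p"] v(1) by simp
  qed
  have qv: "?q \<otimes> v = v"
    unfolding v(3)[symmetric] using v(1) vp by (simp add: Alg.m_assoc v(2))
  have up: "u \<otimes> ?p = v"
    using u(2)[OF n n] v(1) qv vp by (simp add: T_def)
  have qu: "?q \<otimes> u = v"
    using inter[of "munit n 0 0"] up by simp
  have su: "star A v = ?p \<otimes> star A u" "star A v = star A u \<otimes> ?q"
    using up qu u(1) pp star_mult[of u ?p] star_mult[of ?q u] by simp_all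
  have "star A u \<otimes> u = \<one>"
  proof (rule one[OF \<phi>])
    show "star A u \<otimes> u \<otimes> \<phi> a = \<phi> a \<otimes> (star A u \<otimes> u)" if a: "a \<in> carrier_mat n n" for a
    proof -
      have "star A u \<otimes> u \<otimes> \<phi> a = star A u \<otimes> \<psi> a \<otimes> u"
        using u(1) p(1)[OF a] q(1)[OF a] by (simp add: Alg.m_assoc inter[OF a])
      also have "\<dots> = \<phi> a \<otimes> (star A u \<otimes> u)"
        unfolding inter'[OF a] using u(1) p(1)[OF a] by (simp add: Alg.m_assoc)
      finally show ?thesis .
    qed
    have "star A u \<otimes> u \<otimes> ?p = star A u \<otimes> (?q \<otimes> v)" using u(1) by (simp add: Alg.m_assoc up qv)
    also have "\<dots> = star A v \<otimes> v" using u(1) v(1) by (simp add: su(2) Alg.m_assoc)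
    finally show "star A u \<otimes> u \<otimes> ?p = ?p" using v(2) by simp
  qed (use u in simp)
  moreover have "u \<otimes> star A u = \<one>"
  proof (rule one[OF \<psi>])
    show "u \<otimes> star A u \<otimes> \<psi> a = \<psi> a \<otimes> (u \<otimes> star A u)" if a: "a \<in> carrier_mat n n" for a
    proof -
      have "u \<otimes> star A u \<otimes> \<psi> a = u \<otimes> \<phi> a \<otimes> star A u"
        using u(1) p(1)[OF a] q(1)[OF a] by (simp add: Alg.m_assoc inter'[OF a])
      also have "\<dots> = \<psi> a \<otimes> (u \<otimes> star A u)"
        unfolding inter[OF a] using u(1) q(1)[OF a] by (simp add: Alg.m_assoc)
      finally show ?thesis .
    qed
    have "u \<otimes> star A u \<otimes> ?q = u \<otimes> (?p \<otimes> star A u)"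
      using u(1) by (simp add: Alg.m_assoc su[symmetric])
    also have "\<dots> = v \<otimes> star A u" using u(1) by (simp add: Alg.m_assoc[symmetric] up)
    also have "\<dots> = v \<otimes> ?p \<otimes> star A u" by (simp add: vp)
    also have "\<dots> = v \<otimes> star A v" using u(1) v(1) by (simp add: su(1) Alg.m_assoc)
    finally show "u \<otimes> star A u \<otimes> ?q = ?q" using v(3) by simp
  qed (use u in simp)
  ultimately show thesis using that u(1) inter by blast
qed

lemma conjugation_hom:
  assumes u: "u \<in> carrier A" "star A u \<otimes> u = \<one>" "u \<otimes> star A u = \<one>" and h: "unital_star_hom B A h"
  shows "unital_star_hom B A (\<lambda>x. u \<otimes> h x \<otimes> star A u)"
proof (rule unital_star_homI)
  note hD = unital_star_homD[OF h]
  show "u \<otimes> h \<one>\<^bsub>B\<^esub> \<otimes> star A u = \<one>" using u by (simp add: hD)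
  fix x y c assume x: "x \<in> carrier B"
  note hx = hD(1)[OF x]
  show "u \<otimes> h x \<otimes> star A u \<in> carrier A" using u hx by simp
  show "u \<otimes> h (c \<odot>\<^bsub>B\<^esub> x) \<otimes> star A u = c \<odot> (u \<otimes> h x \<otimes> star A u)"
    using u hx x by (simp add: hD smult_mult_left smult_mult_right)
  show "u \<otimes> h (star B x) \<otimes> star A u = star A (u \<otimes> h x \<otimes> star A u)"
    using u hx x by (simp add: hD star_mult Alg.m_assoc)
  assume y: "y \<in> carrier B"
  note hy = hD(1)[OF y]
  show "u \<otimes> h (x \<oplus>\<^bsub>B\<^esub> y) \<otimes> star A u = u \<otimes> h x \<otimes> star A u \<oplus> u \<otimes> h y \<otimes> star A u"
    using u hx hy x y by (simp add: hD Alg.r_distr Alg.l_distr)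
  have "(u \<otimes> h x \<otimes> star A u) \<otimes> (u \<otimes> h y \<otimes> star A u) = u \<otimes> h x \<otimes> (star A u \<otimes> u) \<otimes> h y \<otimes> star A u"
    using u(1) hx hy by (simp add: Alg.m_assoc)
  then show "u \<otimes> h (x \<otimes>\<^bsub>B\<^esub> y) \<otimes> star A u = (u \<otimes> h x \<otimes> star A u) \<otimes> (u \<otimes> h y \<otimes> star A u)"
    using u hx hy x y by (simp add: hD Alg.m_assoc)
qed

end

lemma hom_munit_projection:
  assumes "0 < k" "0 < n" "unital_star_hom (mat_cstar k) (mat_cstar n) c"
  shows "projection_mat n (c (munit k 0 0))" "tr n (c (munit k 0 0)) = of_nat n / of_nat k"
proof -
  note c = unital_star_homD[OF assms(3), simplified]
  show "projection_mat n (c (munit k 0 0))"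
    unfolding projection_mat_def
    using c(1)[of "munit k 0 0"] c(6)[of "munit k 0 0"] c(2)[of "munit k 0 0" "munit k 0 0"] assms(1)
    by (simp add: mat_adjoint_munit munit_mult)
  have "ntr n (c (munit k 0 0)) = 1 / of_nat k"
    using ntr_hom[OF assms, of "munit k 0 0"] assms(1) by (simp add: ntr_def tr_munit)
  then show "tr n (c (munit k 0 0)) = of_nat n / of_nat k"
    using assms by (simp add: ntr_def field_simps)
qed

text \<open>An amplification of \<open>M\<^sub>m\<close> agrees with \<open>d\<close> on the image of \<open>c\<close> up to a unitary.\<close>
theorem matrix_hom_extension:
  assumes pos: "0 < k" "0 < m" "0 < n" and c: "unital_star_hom (mat_cstar k) (mat_cstar m) c"
    and d: "unital_star_hom (mat_cstar k) (mat_cstar n) d" and "m dvd n"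
  obtains h where "unital_star_hom (mat_cstar m) (mat_cstar n) h"
    "\<And>a. a \<in> carrier_mat k k \<Longrightarrow> h (c a) = d a"
proof -
  obtain r where r: "n = r * m" using \<open>m dvd n\<close> by (metis dvd_def mult.commute)
  have amp: "unital_star_hom (mat_cstar m) (mat_cstar n) (amplify r m)"
    unfolding r by (rule amplify_hom) (use r pos in auto)
  interpret pre_cstar_algebra "mat_cstar n" by (rule pre_cstar_mat)
  have \<phi>: "unital_star_hom (mat_cstar k) (mat_cstar n) (\<lambda>a. amplify r m (c a))"
    by (rule unital_star_hom_comp[OF c amp])
  obtain v where "v \<in> carrier_mat n n" "mat_adjoint v * v = amplify r m (c (munit k 0 0))"
    "v * mat_adjoint v = d (munit k 0 0)"
    using projection_equiv[OF hom_munit_projection(1)[OF pos(1,3) \<phi>] hom_munit_projection(1)[OF pos(1,3) d]]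
      hom_munit_projection(2)[OF pos(1,3) \<phi>] hom_munit_projection(2)[OF pos(1,3) d] by metis
  then obtain u where u: "u \<in> carrier_mat n n" "mat_adjoint u * u = 1\<^sub>m n" "u * mat_adjoint u = 1\<^sub>m n"
    "\<And>a. a \<in> carrier_mat k k \<Longrightarrow> u * amplify r m (c a) = d a * u"
    using unitary_intertwiner[OF pos(1) \<phi> d, of v] by auto
  have "unital_star_hom (mat_cstar m) (mat_cstar n) (\<lambda>x. u * amplify r m x * mat_adjoint u)"
    using conjugation_hom[OF _ _ _ amp, of u] u by simp
  moreover have "u * amplify r m (c a) * mat_adjoint u = d a" if a: "a \<in> carrier_mat k k" for a
  proof -
    have da: "d a \<in> carrier_mat n n" using unital_star_homD(1)[OF d] a by simp
    show ?thesis
      unfolding u(4)[OF a] using assoc_mult_mat[OF da u(1) mat_adjoint_carrier[OF u(1)]] u(3) da by simp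
  qed
  ultimately show thesis using that by blast
qed

section \<open>Isomorphisms from dense isometric relations\<close>

context pre_cstar_algebra
begin

lemma minus_self [simp]: "x \<in> carrier A \<Longrightarrow> x \<ominus> x = \<zero>"
  by (simp add: minus_eq_zero_iff)

lemma tendsto_plus:
  assumes "\<And>n. s n \<in> carrier A" "\<And>n. t n \<in> carrier A" "x \<in> carrier A" "y \<in> carrier A"
    and s: "(\<lambda>n. cnorm A (s n \<ominus> x)) \<longlonglongrightarrow> 0" and t: "(\<lambda>n. cnorm A (t n \<ominus> y)) \<longlonglongrightarrow> 0"
  shows "(\<lambda>n. cnorm A ((s n \<oplus> t n) \<ominus> (x \<oplus> y))) \<longlonglongrightarrow> 0"
proof (rule tendsto_sandwich[OF _ _ tendsto_const])
  have "cnorm A ((s n \<oplus> t n) \<ominus> (x \<oplus> y)) \<le> cnorm A (s n \<ominus> x) + cnorm A (t n \<ominus> y)" for n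
  proof -
    have "(s n \<oplus> t n) \<ominus> (x \<oplus> y) = (s n \<ominus> x) \<oplus> (t n \<ominus> y)" using assms(1-4) by algebra
    then show ?thesis using cnorm_triangle[of "s n \<ominus> x" "t n \<ominus> y"] assms(1-4) by simp
  qed
  then show "\<forall>\<^sub>F n in sequentially. cnorm A ((s n \<oplus> t n) \<ominus> (x \<oplus> y)) \<le> cnorm A (s n \<ominus> x) + cnorm A (t n \<ominus> y)"
    by simp
  show "(\<lambda>n. cnorm A (s n \<ominus> x) + cnorm A (t n \<ominus> y)) \<longlonglongrightarrow> 0"
    by (rule tendsto_add_zero[OF s t])
qed (use assms(1-4) in simp)

lemma tendsto_smult:
  assumes "\<And>n. s n \<in> carrier A" "x \<in> carrier A" "(\<lambda>n. cnorm A (s n \<ominus> x)) \<longlonglongrightarrow> 0"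
  shows "(\<lambda>n. cnorm A (c \<odot> s n \<ominus> c \<odot> x)) \<longlonglongrightarrow> 0"
  using tendsto_mult_right_zero[OF assms(3), of "cmod c"] assms(1,2)
  by (simp add: smult_minus_right[symmetric] cnorm_smult)

lemma tendsto_mult:
  assumes "\<And>n. s n \<in> carrier A" "\<And>n. t n \<in> carrier A" "x \<in> carrier A" "y \<in> carrier A"
    and s: "(\<lambda>n. cnorm A (s n \<ominus> x)) \<longlonglongrightarrow> 0" and t: "(\<lambda>n. cnorm A (t n \<ominus> y)) \<longlonglongrightarrow> 0"
  shows "(\<lambda>n. cnorm A (s n \<otimes> t n \<ominus> x \<otimes> y)) \<longlonglongrightarrow> 0"
proof (rule tendsto_sandwich[OF _ _ tendsto_const])
  have "cnorm A (s n \<otimes> t n \<ominus> x \<otimes> y) \<le> cnorm A (s n \<ominus> x) * cnorm A (t n) + cnorm A x * cnorm A (t n \<ominus> y)" for n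
  proof -
    have "s n \<otimes> t n \<ominus> x \<otimes> y = (s n \<ominus> x) \<otimes> t n \<oplus> x \<otimes> (t n \<ominus> y)" using assms(1-4) by algebra
    then show ?thesis
      using cnorm_triangle[of "(s n \<ominus> x) \<otimes> t n" "x \<otimes> (t n \<ominus> y)"] cnorm_mult[of "s n \<ominus> x" "t n"]
        cnorm_mult[of x "t n \<ominus> y"] assms(1-4) by simp
  qed
  then show "\<forall>\<^sub>F n in sequentially. cnorm A (s n \<otimes> t n \<ominus> x \<otimes> y)
      \<le> cnorm A (s n \<ominus> x) * cnorm A (t n) + cnorm A x * cnorm A (t n \<ominus> y)" by simp
  have "(\<lambda>n. cnorm A (s n \<ominus> x) * cnorm A (t n) + cnorm A x * cnorm A (t n \<ominus> y))
      \<longlonglongrightarrow> 0 * cnorm A y + cnorm A x * 0"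
    by (intro tendsto_intros s t tendsto_cnorm[OF assms(2,4) t])
  then show "(\<lambda>n. cnorm A (s n \<ominus> x) * cnorm A (t n) + cnorm A x * cnorm A (t n \<ominus> y)) \<longlonglongrightarrow> 0"
    by simp
qed (use assms(1-4) in simp)

end

text \<open>
  The graph of an isometric isomorphism between two unital star-subalgebras. Working with graphs
  keeps the two algebras symmetric.
\<close>
definition isometric_relation :: "'a cstar \<Rightarrow> 'b cstar \<Rightarrow> ('a \<times> 'b) set \<Rightarrow> bool" where
  "isometric_relation D E R \<longleftrightarrow> (\<one>\<^bsub>D\<^esub>, \<one>\<^bsub>E\<^esub>) \<in> R \<and>
    (\<forall>(x, y)\<in>R. x \<in> carrier D \<and> y \<in> carrier E \<and> cnorm D x = cnorm E y \<and>
       (star D x, star E y) \<in> R \<and> (\<forall>c. (c \<odot>\<^bsub>D\<^esub> x, c \<odot>\<^bsub>E\<^esub> y) \<in> R) \<and>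
       (\<forall>(x', y')\<in>R. (x \<oplus>\<^bsub>D\<^esub> x', y \<oplus>\<^bsub>E\<^esub> y') \<in> R \<and> (x \<otimes>\<^bsub>D\<^esub> x', y \<otimes>\<^bsub>E\<^esub> y') \<in> R))"

lemma isometric_relationD:
  assumes "isometric_relation D E R"
  shows "(\<one>\<^bsub>D\<^esub>, \<one>\<^bsub>E\<^esub>) \<in> R"
    "(x, y) \<in> R \<Longrightarrow> x \<in> carrier D" "(x, y) \<in> R \<Longrightarrow> y \<in> carrier E"
    "(x, y) \<in> R \<Longrightarrow> cnorm D x = cnorm E y" "(x, y) \<in> R \<Longrightarrow> (star D x, star E y) \<in> R"
    "(x, y) \<in> R \<Longrightarrow> (c \<odot>\<^bsub>D\<^esub> x, c \<odot>\<^bsub>E\<^esub> y) \<in> R"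
    "(x, y) \<in> R \<Longrightarrow> (x', y') \<in> R \<Longrightarrow> (x \<oplus>\<^bsub>D\<^esub> x', y \<oplus>\<^bsub>E\<^esub> y') \<in> R"
    "(x, y) \<in> R \<Longrightarrow> (x', y') \<in> R \<Longrightarrow> (x \<otimes>\<^bsub>D\<^esub> x', y \<otimes>\<^bsub>E\<^esub> y') \<in> R"
  using assms unfolding isometric_relation_def by fast+

lemma isometric_relation_converse:
  "isometric_relation D E R \<Longrightarrow> isometric_relation E D (R\<inverse>)"
  unfolding isometric_relation_def by fastforce

text \<open>The closure of a relation in the product of two normed algebras.\<close>
definition relation_closure :: "'a cstar \<Rightarrow> 'b cstar \<Rightarrow> ('a \<times> 'b) set \<Rightarrow> ('a \<times> 'b) set" where
  "relation_closure D E R = {(x, y). x \<in> carrier D \<and> y \<in> carrier E \<and>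
     (\<exists>s t. (\<forall>n. (s n, t n) \<in> R) \<and> (\<lambda>n. cnorm D (s n \<ominus>\<^bsub>D\<^esub> x)) \<longlonglongrightarrow> 0 \<and>
       (\<lambda>n. cnorm E (t n \<ominus>\<^bsub>E\<^esub> y)) \<longlonglongrightarrow> 0)}"

lemma relation_closure_converse: "relation_closure E D (R\<inverse>) = (relation_closure D E R)\<inverse>"
  unfolding relation_closure_def by auto

lemma relation_closureE:
  assumes "(x, y) \<in> relation_closure D E R"
  obtains s t where "x \<in> carrier D" "y \<in> carrier E" "\<And>n. (s n, t n) \<in> R"
    "(\<lambda>n. cnorm D (s n \<ominus>\<^bsub>D\<^esub> x)) \<longlonglongrightarrow> 0" "(\<lambda>n. cnorm E (t n \<ominus>\<^bsub>E\<^esub> y)) \<longlonglongrightarrow> 0"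
  using assms unfolding relation_closure_def by blast

lemma relation_closureI:
  assumes "x \<in> carrier D" "y \<in> carrier E" "\<And>n. (s n, t n) \<in> R"
    "(\<lambda>n. cnorm D (s n \<ominus>\<^bsub>D\<^esub> x)) \<longlonglongrightarrow> 0" "(\<lambda>n. cnorm E (t n \<ominus>\<^bsub>E\<^esub> y)) \<longlonglongrightarrow> 0"
  shows "(x, y) \<in> relation_closure D E R"
  using assms unfolding relation_closure_def by blast

lemma isometric_relation_closure:
  assumes D: "pre_cstar_algebra D" and E: "pre_cstar_algebra E" and R: "isometric_relation D E R"
  shows "isometric_relation D E (relation_closure D E R)"
proof -
  interpret D: pre_cstar_algebra D by fact
  interpret E: pre_cstar_algebra E by fact
  note RD = isometric_relationD[OF R]
  let ?C = "relation_closure D E R"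
  have "(\<one>\<^bsub>D\<^esub>, \<one>\<^bsub>E\<^esub>) \<in> ?C"
  proof (rule relation_closureI[where s = "\<lambda>_. \<one>\<^bsub>D\<^esub>" and t = "\<lambda>_. \<one>\<^bsub>E\<^esub>"])
    show "(\<lambda>n. cnorm D (\<one>\<^bsub>D\<^esub> \<ominus>\<^bsub>D\<^esub> \<one>\<^bsub>D\<^esub>)) \<longlonglongrightarrow> 0" "(\<lambda>n. cnorm E (\<one>\<^bsub>E\<^esub> \<ominus>\<^bsub>E\<^esub> \<one>\<^bsub>E\<^esub>)) \<longlonglongrightarrow> 0"
      by simp_all
  qed (auto simp: RD(1))
  moreover have "x \<in> carrier D \<and> y \<in> carrier E \<and> cnorm D x = cnorm E y \<and>
       (star D x, star E y) \<in> ?C \<and> (\<forall>c. (c \<odot>\<^bsub>D\<^esub> x, c \<odot>\<^bsub>E\<^esub> y) \<in> ?C) \<and>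
       (\<forall>(x', y')\<in>?C. (x \<oplus>\<^bsub>D\<^esub> x', y \<oplus>\<^bsub>E\<^esub> y') \<in> ?C \<and> (x \<otimes>\<^bsub>D\<^esub> x', y \<otimes>\<^bsub>E\<^esub> y') \<in> ?C)"
    if C: "(x, y) \<in> ?C" for x y
  proof -
    obtain s t where x: "x \<in> carrier D" "y \<in> carrier E" and st: "\<And>n. (s n, t n) \<in> R"
      and s: "(\<lambda>n. cnorm D (s n \<ominus>\<^bsub>D\<^esub> x)) \<longlonglongrightarrow> 0" and t: "(\<lambda>n. cnorm E (t n \<ominus>\<^bsub>E\<^esub> y)) \<longlonglongrightarrow> 0"
      by (rule relation_closureE[OF C]) (rule that)
    note sc = RD(2)[OF st] and tc = RD(3)[OF st]
    have "cnorm D x = cnorm E y"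
      using D.tendsto_cnorm[OF sc x(1) s] E.tendsto_cnorm[OF tc x(2) t]
      unfolding RD(4)[OF st] by (rule LIMSEQ_unique)
    moreover have "(star D x, star E y) \<in> ?C"
      by (rule relation_closureI[OF _ _ RD(5)[OF st] D.tendsto_star[OF sc x(1) s] E.tendsto_star[OF tc x(2) t]])
        (use x in auto)
    moreover have "(c \<odot>\<^bsub>D\<^esub> x, c \<odot>\<^bsub>E\<^esub> y) \<in> ?C" for c
      by (rule relation_closureI[OF _ _ RD(6)[OF st] D.tendsto_smult[OF sc x(1) s] E.tendsto_smult[OF tc x(2) t]])
        (use x in auto)
    moreover have "(x \<oplus>\<^bsub>D\<^esub> x', y \<oplus>\<^bsub>E\<^esub> y') \<in> ?C \<and> (x \<otimes>\<^bsub>D\<^esub> x', y \<otimes>\<^bsub>E\<^esub> y') \<in> ?C"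
      if C': "(x', y') \<in> ?C" for x' y'
    proof -
      obtain s' t' where x': "x' \<in> carrier D" "y' \<in> carrier E" and st': "\<And>n. (s' n, t' n) \<in> R"
        and s': "(\<lambda>n. cnorm D (s' n \<ominus>\<^bsub>D\<^esub> x')) \<longlonglongrightarrow> 0" and t': "(\<lambda>n. cnorm E (t' n \<ominus>\<^bsub>E\<^esub> y')) \<longlonglongrightarrow> 0"
        by (rule relation_closureE[OF C']) (rule that)
      note sc' = RD(2)[OF st'] and tc' = RD(3)[OF st']
      have "(x \<oplus>\<^bsub>D\<^esub> x', y \<oplus>\<^bsub>E\<^esub> y') \<in> ?C"
        by (rule relation_closureI[OF _ _ RD(7)[OF st st'] D.tendsto_plus[OF sc sc' x(1) x'(1) s s']
              E.tendsto_plus[OF tc tc' x(2) x'(2) t t']]) (use x x' in auto)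
      moreover have "(x \<otimes>\<^bsub>D\<^esub> x', y \<otimes>\<^bsub>E\<^esub> y') \<in> ?C"
        by (rule relation_closureI[OF _ _ RD(8)[OF st st'] D.tendsto_mult[OF sc sc' x(1) x'(1) s s']
              E.tendsto_mult[OF tc tc' x(2) x'(2) t t']]) (use x x' in auto)
      ultimately show ?thesis by blast
    qed
    ultimately show ?thesis using x by blast
  qed
  ultimately show ?thesis unfolding isometric_relation_def by blast
qed

lemma isometric_relation_unique:
  assumes D: "pre_cstar_algebra D" and E: "pre_cstar_algebra E" and R: "isometric_relation D E R"
    and xy: "(x, y) \<in> R" "(x, y') \<in> R"
  shows "y = y'"
proof -
  interpret D: pre_cstar_algebra D by fact
  interpret E: pre_cstar_algebra E by fact
  note RD = isometric_relationD[OF R]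
  note c = RD(2)[OF xy(1)] RD(3)[OF xy(1)] RD(3)[OF xy(2)]
  have "(x \<ominus>\<^bsub>D\<^esub> x, y \<ominus>\<^bsub>E\<^esub> y') \<in> R"
    unfolding D.minus_eq_smult[OF c(1) c(1)] E.minus_eq_smult[OF c(2,3)]
    by (rule RD(7)[OF xy(1) RD(6)[OF xy(2)]])
  then have "cnorm E (y \<ominus>\<^bsub>E\<^esub> y') = cnorm D (x \<ominus>\<^bsub>D\<^esub> x)" using RD(4) by metis
  also have "\<dots> = 0" using c by simp
  finally show ?thesis
    using E.cnorm_eq_zero_iff[of "y \<ominus>\<^bsub>E\<^esub> y'"] E.minus_eq_zero_iff[of y y'] c by simp
qed

text \<open>
  The first components of a sequence of pairs that converges in \<open>D\<close> force the second components to be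
  Cauchy in \<open>E\<close>.
\<close>
lemma relation_closure_total:
  assumes D: "pre_cstar_algebra D" and E: "unital_cstar_algebra E" and R: "isometric_relation D E R"
    and dense: "\<And>x \<epsilon>. x \<in> carrier D \<Longrightarrow> \<epsilon> > 0 \<Longrightarrow> \<exists>(a, b)\<in>R. cnorm D (x \<ominus>\<^bsub>D\<^esub> a) < \<epsilon>"
    and x: "x \<in> carrier D"
  shows "\<exists>y. (x, y) \<in> relation_closure D E R"
proof -
  interpret D: pre_cstar_algebra D by fact
  interpret E: pre_cstar_algebra E by (rule unital_cstar_imp_pre_cstar[OF E])
  note RD = isometric_relationD[OF R]
  have "\<exists>a b. (a, b) \<in> R \<and> cnorm D (x \<ominus>\<^bsub>D\<^esub> a) < inverse (real (Suc n))" for n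
    using dense[OF x, of "inverse (real (Suc n))"] by auto
  then obtain a b where ab: "\<And>n. (a n, b n) \<in> R" "\<And>n. cnorm D (x \<ominus>\<^bsub>D\<^esub> a n) < inverse (real (Suc n))"
    by metis
  note ac = RD(2)[OF ab(1)] and bc = RD(3)[OF ab(1)]
  have a: "(\<lambda>n. cnorm D (a n \<ominus>\<^bsub>D\<^esub> x)) \<longlonglongrightarrow> 0"
  proof (rule tendsto_sandwich[OF _ _ tendsto_const LIMSEQ_inverse_real_of_nat])
    show "\<forall>\<^sub>F n in sequentially. cnorm D (a n \<ominus>\<^bsub>D\<^esub> x) \<le> inverse (real (Suc n))"
      using ab(2) D.cnorm_minus_commute[OF x ac]
      by (intro always_eventually allI less_imp_le) simp
  qed (use ac x in simp)
  have iso: "cnorm E (b m \<ominus>\<^bsub>E\<^esub> b n) = cnorm D (a m \<ominus>\<^bsub>D\<^esub> a n)" for m n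
    using RD(4)[OF RD(7)[OF ab(1)[of m] RD(6)[OF ab(1)[of n], of "-1"]]] ac bc
    by (simp add: D.minus_eq_smult E.minus_eq_smult)
  obtain y where y: "y \<in> carrier E" "(\<lambda>n. cnorm E (b n \<ominus>\<^bsub>E\<^esub> y)) \<longlonglongrightarrow> 0"
    by (rule E.cauchy_converges[OF unital_cstar_algebra.complete[OF E] bc])
      (use D.convergent_imp_cauchy[OF ac x a] in \<open>auto simp: iso\<close>)
  then show ?thesis using relation_closureI[OF x y(1) ab(1) a y(2)] by blast
qed

theorem isomorphic_if_dense_relation:
  assumes D: "unital_cstar_algebra D" and E: "unital_cstar_algebra E" and R: "isometric_relation D E R"
    and denseD: "\<And>x \<epsilon>. x \<in> carrier D \<Longrightarrow> \<epsilon> > 0 \<Longrightarrow> \<exists>(a, b)\<in>R. cnorm D (x \<ominus>\<^bsub>D\<^esub> a) < \<epsilon>"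
    and denseE: "\<And>y \<epsilon>. y \<in> carrier E \<Longrightarrow> \<epsilon> > 0 \<Longrightarrow> \<exists>(a, b)\<in>R. cnorm E (y \<ominus>\<^bsub>E\<^esub> b) < \<epsilon>"
  shows "cstar_isomorphic D E"
proof -
  note preD = unital_cstar_imp_pre_cstar[OF D] and preE = unital_cstar_imp_pre_cstar[OF E]
  interpret D: pre_cstar_algebra D by (rule preD)
  let ?C = "relation_closure D E R"
  have C: "isometric_relation D E ?C" by (rule isometric_relation_closure[OF preD preE R])
  note CD = isometric_relationD[OF C]
  note R' = isometric_relation_converse[OF R] and C' = isometric_relation_converse[OF C]
  have total: "\<exists>y. (x, y) \<in> ?C" if "x \<in> carrier D" for x
    by (rule relation_closure_total[OF preD E R denseD that])
  have onto: "\<exists>x. (x, y) \<in> ?C" if "y \<in> carrier E" for y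
    using relation_closure_total[OF preE D R' _ that] denseE
    unfolding relation_closure_converse by (fastforce simp: Bex_def)
  obtain h where h: "\<And>x. x \<in> carrier D \<Longrightarrow> (x, h x) \<in> ?C" using total by metis
  have h_eq: "h x = y" if "(x, y) \<in> ?C" for x y
    using isometric_relation_unique[OF preD preE C h[OF CD(2)[OF that]] that] .
  have "unital_star_hom D E h"
  proof (rule unital_star_homI)
    fix x y c assume x: "x \<in> carrier D"
    show "h x \<in> carrier E" using CD(3)[OF h[OF x]] .
    show "h (c \<odot>\<^bsub>D\<^esub> x) = c \<odot>\<^bsub>E\<^esub> h x" using h_eq[OF CD(6)[OF h[OF x]]] .
    show "h (star D x) = star E (h x)" using h_eq[OF CD(5)[OF h[OF x]]] .
    assume y: "y \<in> carrier D"
    show "h (x \<otimes>\<^bsub>D\<^esub> y) = h x \<otimes>\<^bsub>E\<^esub> h y" using h_eq[OF CD(8)[OF h[OF x] h[OF y]]] .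
    show "h (x \<oplus>\<^bsub>D\<^esub> y) = h x \<oplus>\<^bsub>E\<^esub> h y" using h_eq[OF CD(7)[OF h[OF x] h[OF y]]] .
  qed (rule h_eq[OF CD(1)])
  moreover have "bij_betw h (carrier D) (carrier E)"
    unfolding bij_betw_def
  proof (intro conjI inj_onI subset_antisym subsetI)
    fix x y assume xy: "x \<in> carrier D" "y \<in> carrier D" "h x = h y"
    have "(h x, x) \<in> ?C\<inverse>" "(h x, y) \<in> ?C\<inverse>" using h[OF xy(1)] h[OF xy(2)] xy(3) by auto
    then show "x = y" by (rule isometric_relation_unique[OF preE preD C'])
  next
    fix y assume "y \<in> carrier E"
    then obtain x where "(x, y) \<in> ?C" using onto by blast
    then show "y \<in> h ` carrier D" using CD(2) h_eq by blast
  qed (use CD(3)[OF h] in blast)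
  ultimately show ?thesis unfolding cstar_isomorphic_def by blast
qed

section \<open>The intertwining argument\<close>

text \<open>
  A matrix algebra embedded at the same time into a stage of a tower of \<open>D\<close> and into a stage of
  a tower of \<open>E\<close>; the two embeddings define a partial isomorphism.
\<close>
definition partial_iso where
  "partial_iso D k e E l f = (\<lambda>(m, \<alpha>, \<beta>). 0 < m \<and>
     unital_star_hom (mat_cstar m) D \<alpha> \<and> unital_star_hom (mat_cstar m) E \<beta> \<and>
     (\<exists>i. \<alpha> ` carrier_mat m m \<subseteq> e i ` carrier_mat (k i) (k i)) \<and>
     (\<exists>j. \<beta> ` carrier_mat m m \<subseteq> f j ` carrier_mat (l j) (l j)))"

text \<open>The graph of the partial isomorphism.\<close>
definition pairs :: "nat \<times> (complex mat \<Rightarrow> 'a) \<times> (complex mat \<Rightarrow> 'b) \<Rightarrow> ('a \<times> 'b) set" where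
  "pairs = (\<lambda>(m, \<alpha>, \<beta>). (\<lambda>a. (\<alpha> a, \<beta> a)) ` carrier_mat m m)"

text \<open>
  The left half of the back-and-forth: the domain is enlarged to a stage of the tower of \<open>D\<close> that contains
  a given stage, by completing the diagram of matrix algebras.
\<close>
lemma partial_iso_extend_left:
  assumes D: "pre_cstar_algebra D" "matrix_tower D k e" and E: "pre_cstar_algebra E" "matrix_tower E l f"
    and dvd: "\<And>i. \<exists>j. k i dvd l j" and S: "partial_iso D k e E l f S"
  shows "\<exists>T. partial_iso D k e E l f T \<and> pairs S \<subseteq> pairs T \<and>
    e i0 ` carrier_mat (k i0) (k i0) \<subseteq> fst ` pairs T"
proof -
  obtain m \<alpha> \<beta> where S_eq: "S = (m, \<alpha>, \<beta>)" by (cases S)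
  obtain i1 j1 where m: "0 < m" and \<alpha>: "unital_star_hom (mat_cstar m) D \<alpha>"
    and \<beta>: "unital_star_hom (mat_cstar m) E \<beta>"
    and i1: "\<alpha> ` carrier_mat m m \<subseteq> e i1 ` carrier_mat (k i1) (k i1)"
    and j1: "\<beta> ` carrier_mat m m \<subseteq> f j1 ` carrier_mat (l j1) (l j1)"
    using S unfolding S_eq partial_iso_def by auto
  define i where "i = max i0 i1"
  have i: "\<alpha> ` carrier_mat m m \<subseteq> e i ` carrier_mat (k i) (k i)"
    using i1 matrix_tower_mono(1)[OF D(2), of i1 i] by (force simp: i_def)
  obtain j2 where j2: "k i dvd l j2" using dvd by blast
  define j where "j = max j1 j2"
  have j: "\<beta> ` carrier_mat m m \<subseteq> f j ` carrier_mat (l j) (l j)"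
    using j1 matrix_tower_mono(1)[OF E(2), of j1 j] by (force simp: j_def)
  have kl: "k i dvd l j"
    using dvd_trans[OF j2 matrix_tower_mono(2)[OF E(2), of j2 j]] by (simp add: j_def)
  obtain c where c: "unital_star_hom (mat_cstar m) (mat_cstar (k i)) c"
    "\<And>a. a \<in> carrier_mat m m \<Longrightarrow> e i (c a) = \<alpha> a"
    by (rule tower_stage_hom[OF D \<alpha> i]) blast
  obtain d where d: "unital_star_hom (mat_cstar m) (mat_cstar (l j)) d"
    "\<And>a. a \<in> carrier_mat m m \<Longrightarrow> f j (d a) = \<beta> a"
    by (rule tower_stage_hom[OF E \<beta> j]) blast
  obtain h where h: "unital_star_hom (mat_cstar (k i)) (mat_cstar (l j)) h"
    "\<And>a. a \<in> carrier_mat m m \<Longrightarrow> h (c a) = d a"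
    by (rule matrix_hom_extension[OF m matrix_towerD(2)[OF D(2)] matrix_towerD(2)[OF E(2)] c(1) d(1) kl]) blast
  note hc = unital_star_homD(1)[OF h(1), simplified] and cc = unital_star_homD(1)[OF c(1), simplified]
  define T where "T = (k i, e i, \<lambda>a. f j (h a))"
  have "partial_iso D k e E l f T"
    unfolding T_def partial_iso_def split
    using matrix_towerD(2,4)[OF D(2)] unital_star_hom_comp[OF h(1) matrix_towerD(4)[OF E(2), of j]]
    by (intro conjI exI[of _ i] exI[of _ j]) (auto intro: hc)
  moreover have "pairs S \<subseteq> pairs T"
  proof
    fix z assume "z \<in> pairs S"
    then obtain a where a: "a \<in> carrier_mat m m" "z = (\<alpha> a, \<beta> a)" by (auto simp: S_eq pairs_def)
    then have "z = (e i (c a), f j (h (c a)))" using c d h by simp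
    then show "z \<in> pairs T" using cc[OF a(1)] by (auto simp: T_def pairs_def)
  qed
  moreover have "e i0 ` carrier_mat (k i0) (k i0) \<subseteq> fst ` pairs T"
  proof -
    have "fst ` pairs T = e i ` carrier_mat (k i) (k i)" by (simp add: T_def pairs_def image_image)
    then show ?thesis using matrix_tower_mono(1)[OF D(2), of i0 i] by (simp add: i_def)
  qed
  ultimately show ?thesis by blast
qed

lemma partial_iso_swap:
  "partial_iso E l f D k e (m, \<beta>, \<alpha>) = partial_iso D k e E l f (m, \<alpha>, \<beta>)"
  "pairs (m, \<beta>, \<alpha>) = (pairs (m, \<alpha>, \<beta>))\<inverse>"
  by (auto simp: partial_iso_def pairs_def)

lemma partial_iso_extend_right:
  assumes D: "pre_cstar_algebra D" "matrix_tower D k e" and E: "pre_cstar_algebra E" "matrix_tower E l f"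
    and dvd: "\<And>j. \<exists>i. l j dvd k i" and S: "partial_iso D k e E l f S"
  shows "\<exists>T. partial_iso D k e E l f T \<and> pairs S \<subseteq> pairs T \<and>
    f j0 ` carrier_mat (l j0) (l j0) \<subseteq> snd ` pairs T"
proof -
  obtain m \<alpha> \<beta> where S_eq: "S = (m, \<alpha>, \<beta>)" by (cases S)
  have "partial_iso E l f D k e (m, \<beta>, \<alpha>)" using S unfolding S_eq by (subst partial_iso_swap(1))
  from partial_iso_extend_left[OF E D dvd this]
  obtain T' where T': "partial_iso E l f D k e T'" "pairs (m, \<beta>, \<alpha>) \<subseteq> pairs T'"
    "f j0 ` carrier_mat (l j0) (l j0) \<subseteq> fst ` pairs T'" by blast
  obtain m' \<beta>' \<alpha>' where T_eq: "T' = (m', \<beta>', \<alpha>')" by (cases T')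
  have "partial_iso D k e E l f (m', \<alpha>', \<beta>')"
    using T'(1) unfolding T_eq by (subst partial_iso_swap(1))
  moreover have "f j0 ` carrier_mat (l j0) (l j0) \<subseteq> snd ` pairs (m', \<alpha>', \<beta>')"
    using T'(3) by (simp add: T_eq pairs_def image_image)
  moreover have "pairs S \<subseteq> pairs (m', \<alpha>', \<beta>')"
    using T'(2) unfolding T_eq S_eq partial_iso_swap(2)[of m \<beta> \<alpha>] partial_iso_swap(2)[of m' \<beta>' \<alpha>']
    by (rule converse_mono[THEN iffD1])
  ultimately show ?thesis by blast
qed

theorem towers_isomorphic:
  assumes D: "unital_cstar_algebra D" and tD: "matrix_tower D k e"
    and E: "unital_cstar_algebra E" and tE: "matrix_tower E l f"
    and kl: "\<And>i. \<exists>j. k i dvd l j" and lk: "\<And>j. \<exists>i. l j dvd k i"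
  shows "cstar_isomorphic D E"
proof -
  note preD = unital_cstar_imp_pre_cstar[OF D] and preE = unital_cstar_imp_pre_cstar[OF E]
  let ?P = "partial_iso D k e E l f"
  have start: "\<exists>S. ?P S"
  proof -
    obtain j r where r: "l j = r * k 0" using kl[of 0] by (metis dvd_def mult.commute)
    have "0 < r" using r matrix_towerD(2)[OF tE, of j] by (cases r) auto
    then have amp: "unital_star_hom (mat_cstar (k 0)) (mat_cstar (l j)) (amplify r (k 0))"
      unfolding r using matrix_towerD(2)[OF tD] by (rule amplify_hom)
    have "?P (k 0, e 0, \<lambda>a. f j (amplify r (k 0) a))"
      unfolding partial_iso_def split
      using matrix_towerD(2,4)[OF tD] unital_star_hom_comp[OF amp matrix_towerD(4)[OF tE, of j]]
        unital_star_homD(1)[OF amp]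
      by (intro conjI exI[of _ 0] exI[of _ j]) auto
    then show ?thesis by blast
  qed
  have step: "\<exists>T. ?P T \<and> pairs S \<subseteq> pairs T \<and> e n ` carrier_mat (k n) (k n) \<subseteq> fst ` pairs T \<and>
      f n ` carrier_mat (l n) (l n) \<subseteq> snd ` pairs T" if S: "?P S" for S n
  proof -
    obtain T where T: "?P T" "pairs S \<subseteq> pairs T" "e n ` carrier_mat (k n) (k n) \<subseteq> fst ` pairs T"
      using partial_iso_extend_left[OF preD tD preE tE kl S] by blast
    obtain U where U: "?P U" "pairs T \<subseteq> pairs U" "f n ` carrier_mat (l n) (l n) \<subseteq> snd ` pairs U"
      using partial_iso_extend_right[OF preD tD preE tE lk T(1)] by blast
    show ?thesis using T U by (intro exI[of _ U]) blast
  qed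
  have "\<exists>S. \<forall>n. ?P (S n) \<and> (pairs (S n) \<subseteq> pairs (S (Suc n)) \<and>
      e n ` carrier_mat (k n) (k n) \<subseteq> fst ` pairs (S (Suc n)) \<and>
      f n ` carrier_mat (l n) (l n) \<subseteq> snd ` pairs (S (Suc n)))"
    by (rule dependent_nat_choice) (fact start, rule step)
  then obtain S where S': "\<forall>n. ?P (S n) \<and> (pairs (S n) \<subseteq> pairs (S (Suc n)) \<and>
      e n ` carrier_mat (k n) (k n) \<subseteq> fst ` pairs (S (Suc n)) \<and>
      f n ` carrier_mat (l n) (l n) \<subseteq> snd ` pairs (S (Suc n)))" by (rule exE)
  have S: "?P (S n)" "pairs (S n) \<subseteq> pairs (S (Suc n))"
    "e n ` carrier_mat (k n) (k n) \<subseteq> fst ` pairs (S (Suc n))"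
    "f n ` carrier_mat (l n) (l n) \<subseteq> snd ` pairs (S (Suc n))" for n
    using S'[rule_format, of n] by simp_all
  define R where "R = (\<Union>n. pairs (S n))"
  have mono: "pairs (S m) \<subseteq> pairs (S n)" if "m \<le> n" for m n
    using lift_Suc_mono_le[of "\<lambda>n. pairs (S n)" m n] S(2) that by blast
  have repr: "\<exists>m \<alpha> \<beta>. unital_star_hom (mat_cstar m) D \<alpha> \<and> unital_star_hom (mat_cstar m) E \<beta> \<and>
      pairs (S n) = (\<lambda>a. (\<alpha> a, \<beta> a)) ` carrier_mat m m" for n
    using S(1)[of n] unfolding partial_iso_def pairs_def by (cases "S n") auto
  have "isometric_relation D E R"
    unfolding isometric_relation_def
  proof (rule conjI, goal_cases)
    case 1
    obtain m \<alpha> \<beta> where h: "unital_star_hom (mat_cstar m) D \<alpha>" "unital_star_hom (mat_cstar m) E \<beta>"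
      "pairs (S 0) = (\<lambda>a. (\<alpha> a, \<beta> a)) ` carrier_mat m m" using repr by blast
    have "(\<alpha> (1\<^sub>m m), \<beta> (1\<^sub>m m)) \<in> pairs (S 0)" unfolding h(3) by (rule imageI) simp
    then show ?case
      using unital_star_homD(4)[OF h(1)] unital_star_homD(4)[OF h(2)] by (auto simp: R_def)
  next
    case 2
    show ?case
    proof (rule ballI)
      fix z assume z: "z \<in> R"
      have ops: "fst z \<in> carrier D \<and> snd z \<in> carrier E \<and> cnorm D (fst z) = cnorm E (snd z) \<and>
          (star D (fst z), star E (snd z)) \<in> R \<and> (c \<odot>\<^bsub>D\<^esub> fst z, c \<odot>\<^bsub>E\<^esub> snd z) \<in> R \<and>
          (fst z \<oplus>\<^bsub>D\<^esub> fst z', snd z \<oplus>\<^bsub>E\<^esub> snd z') \<in> R \<and> (fst z \<otimes>\<^bsub>D\<^esub> fst z', snd z \<otimes>\<^bsub>E\<^esub> snd z') \<in> R"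
        if z': "z' \<in> R" for z' c
      proof -
        obtain p q where "z \<in> pairs (S p)" "z' \<in> pairs (S q)" using z z' by (auto simp: R_def)
        then have zz: "z \<in> pairs (S (max p q))" "z' \<in> pairs (S (max p q))"
          using mono[of p "max p q"] mono[of q "max p q"] by auto
        obtain m \<alpha> \<beta> where h: "unital_star_hom (mat_cstar m) D \<alpha>" "unital_star_hom (mat_cstar m) E \<beta>"
          "pairs (S (max p q)) = (\<lambda>a. (\<alpha> a, \<beta> a)) ` carrier_mat m m" using repr by blast
        obtain a b where ab: "a \<in> carrier_mat m m" "b \<in> carrier_mat m m" "z = (\<alpha> a, \<beta> a)" "z' = (\<alpha> b, \<beta> b)"
          using zz unfolding h(3) by blast
        have in_R: "(\<alpha> x, \<beta> x) \<in> R" if "x \<in> carrier_mat m m" for x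
          using h(3) that by (auto simp: R_def)
        note A = unital_star_homD[OF h(1), simplified] and B = unital_star_homD[OF h(2), simplified]
        have "cnorm D (\<alpha> a) = cnorm E (\<beta> a)"
          using hom_mat_isometric[OF preD matrix_towerD(1)[OF tD] h(1) ab(1)]
            hom_mat_isometric[OF preE matrix_towerD(1)[OF tE] h(2) ab(1)] by simp
        then show ?thesis
          using ab A(1) B(1) in_R[of "mat_adjoint a"] in_R[of "c \<cdot>\<^sub>m a"] in_R[of "a + b"] in_R[of "a * b"]
          by (simp add: A(2-6) B(2-6))
      qed
      show "case z of (x, y) \<Rightarrow> x \<in> carrier D \<and> y \<in> carrier E \<and> cnorm D x = cnorm E y \<and>
         (star D x, star E y) \<in> R \<and> (\<forall>c. (c \<odot>\<^bsub>D\<^esub> x, c \<odot>\<^bsub>E\<^esub> y) \<in> R) \<and>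
         (\<forall>(x', y')\<in>R. (x \<oplus>\<^bsub>D\<^esub> x', y \<oplus>\<^bsub>E\<^esub> y') \<in> R \<and> (x \<otimes>\<^bsub>D\<^esub> x', y \<otimes>\<^bsub>E\<^esub> y') \<in> R)"
        using ops[OF z] ops by (force simp: case_prod_unfold)
    qed
  qed
  then show ?thesis
  proof (rule isomorphic_if_dense_relation[OF D E])
    fix x and \<epsilon> :: real assume x: "x \<in> carrier D" "\<epsilon> > 0"
    obtain i a where "a \<in> carrier_mat (k i) (k i)" "cnorm D (x \<ominus>\<^bsub>D\<^esub> e i a) < \<epsilon>"
      using matrix_tower_dense[OF tD x] .
    moreover have "e i a \<in> fst ` pairs (S (Suc i))" using S(3)[of i] calculation(1) by blast
    ultimately show "\<exists>(a, b)\<in>R. cnorm D (x \<ominus>\<^bsub>D\<^esub> a) < \<epsilon>" by (force simp: R_def)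
  next
    fix y and \<epsilon> :: real assume y: "y \<in> carrier E" "\<epsilon> > 0"
    obtain i b where "b \<in> carrier_mat (l i) (l i)" "cnorm E (y \<ominus>\<^bsub>E\<^esub> f i b) < \<epsilon>"
      using matrix_tower_dense[OF tE y] .
    moreover have "f i b \<in> snd ` pairs (S (Suc i))" using S(4)[of i] calculation(1) by blast
    ultimately show "\<exists>(a, b)\<in>R. cnorm E (y \<ominus>\<^bsub>E\<^esub> b) < \<epsilon>" by (force simp: R_def)
  qed
qed

text \<open>Glimm: UHF-algebras that embed unitally into each other are isomorphic.\<close>
theorem UHF_algebras_isomorphic:
  assumes D: "UHF_algebra D" and E: "UHF_algebra E"
    and \<alpha>: "unital_star_hom D E \<alpha>" and \<beta>: "unital_star_hom E D \<beta>"
  shows "cstar_isomorphic D E"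
proof -
  have cD: "unital_cstar_algebra D" and cE: "unital_cstar_algebra E"
    using D E by (auto simp: UHF_algebra_def)
  obtain k e where tD: "matrix_tower D k e" using UHF_algebra_imp_tower[OF D] .
  obtain l f where tE: "matrix_tower E l f" using UHF_algebra_imp_tower[OF E] .
  show ?thesis
  proof (rule towers_isomorphic[OF cD tD cE tE])
    show "\<exists>j. k i dvd l j" for i
      by (rule tower_hom_imp_dvd[OF cE tE matrix_towerD(2)[OF tD] unital_star_hom_comp[OF matrix_towerD(4)[OF tD] \<alpha>]])
    show "\<exists>i. l j dvd k i" for j
      by (rule tower_hom_imp_dvd[OF cD tD matrix_towerD(2)[OF tE] unital_star_hom_comp[OF matrix_towerD(4)[OF tE] \<beta>]])
  qed
qed

section \<open>Maximal UHF-subalgebras\<close>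

lemma UHF_subalgebra_one_nonzero:
  assumes "UHF_subalgebra D A"
  shows "\<one>\<^bsub>A\<^esub> \<noteq> \<zero>\<^bsub>A\<^esub>"
proof -
  obtain k e where "matrix_tower (A\<lparr>carrier := D\<rparr>) k e"
    using UHF_algebra_imp_tower assms unfolding UHF_subalgebra_def by blast
  then show ?thesis using matrix_towerD(1) by fastforce
qed

lemma maximal_UHF_subalgebra_image:
  assumes A: "unital_cstar_algebra A" and B: "unital_cstar_algebra B"
    and \<phi>: "unital_star_hom A B \<phi>" and \<psi>: "unital_star_hom B A \<psi>" and M: "maximal_UHF_subalgebra M A"
  shows "maximal_UHF_subalgebra (\<phi> ` M) B"
proof -
  have MU: "UHF_subalgebra M A" using M by (simp add: maximal_UHF_subalgebra_def)
  note A1 = UHF_subalgebra_one_nonzero[OF MU]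
  have B1: "\<one>\<^bsub>B\<^esub> \<noteq> \<zero>\<^bsub>B\<^esub>"
    using A1 unital_star_homD(4)[OF \<psi>]
      unital_star_hom_zero_minus(1)[OF unital_cstar_imp_pre_cstar[OF B] unital_cstar_imp_pre_cstar[OF A] \<psi>]
    by metis
  note imM = UHF_subalgebra_image[OF A B B1 \<phi> MU]
  have "\<exists>h. unital_embedding (B\<lparr>carrier := D\<rparr>) (B\<lparr>carrier := \<phi> ` M\<rparr>) h" if D: "UHF_subalgebra D B" for D
  proof -
    note imD = UHF_subalgebra_image[OF B A A1 \<psi> D]
    obtain g where g: "unital_star_hom (A\<lparr>carrier := \<psi> ` D\<rparr>) (A\<lparr>carrier := M\<rparr>) g" "inj_on g (\<psi> ` D)"
      using M imD(1) unfolding maximal_UHF_subalgebra_def unital_embedding_def by fastforce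
    have "g ` (\<psi> ` D) \<subseteq> M" using unital_star_homD(1)[OF g(1)] by auto
    then have "inj_on \<phi> (g ` \<psi> ` D)" using imM(3) by (auto simp: bij_betw_def intro: inj_on_subset)
    moreover have "inj_on \<psi> D" using imD(3) by (simp add: bij_betw_def)
    ultimately have "inj_on (\<phi> \<circ> (g \<circ> \<psi>)) D"
      by (intro comp_inj_on g(2)) (simp_all add: image_image o_def)
    then have "unital_embedding (B\<lparr>carrier := D\<rparr>) (B\<lparr>carrier := \<phi> ` M\<rparr>) (\<lambda>x. \<phi> (g (\<psi> x)))"
      using unital_star_hom_comp[OF unital_star_hom_comp[OF imD(2) g(1)] imM(2)]
      by (simp add: unital_embedding_def o_def)
    then show ?thesis by blast
  qed
  then show ?thesis using imM(1) by (simp add: maximal_UHF_subalgebra_def)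
qed

lemma maximal_UHF_subalgebra_hom:
  assumes A: "unital_cstar_algebra A" and B: "unital_cstar_algebra B" and \<phi>: "unital_star_hom A B \<phi>"
    and M: "UHF_subalgebra M A" and N: "maximal_UHF_subalgebra N B"
  obtains h where "unital_star_hom (A\<lparr>carrier := M\<rparr>) (B\<lparr>carrier := N\<rparr>) h"
proof -
  have "UHF_subalgebra N B" using N by (simp add: maximal_UHF_subalgebra_def)
  note im = UHF_subalgebra_image[OF A B UHF_subalgebra_one_nonzero[OF this] \<phi> M]
  obtain g where "unital_star_hom (B\<lparr>carrier := \<phi> ` M\<rparr>) (B\<lparr>carrier := N\<rparr>) g"
    using N im(1) unfolding maximal_UHF_subalgebra_def unital_embedding_def by blast
  then show thesis using that unital_star_hom_comp[OF im(2)] by blast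
qed

theorem proposition3p1:
  fixes A :: "'a cstar" and B :: "'b cstar"
    and \<phi> :: "'a \<Rightarrow> 'b" and \<psi> :: "'b \<Rightarrow> 'a"
  assumes "unital_cstar_algebra A" and "unital_cstar_algebra B"
    and "unital_star_hom A B \<phi>" and "unital_star_hom B A \<psi>"
  shows "((\<exists>M. maximal_UHF_subalgebra M A) \<longleftrightarrow> (\<exists>N. maximal_UHF_subalgebra N B)) \<and>
    (\<forall>M N. maximal_UHF_subalgebra M A \<longrightarrow> maximal_UHF_subalgebra N B \<longrightarrow>
       cstar_isomorphic (A\<lparr>carrier := M\<rparr>) (B\<lparr>carrier := N\<rparr>))"
proof (intro conjI iffI allI impI; (elim exE)?)
  fix M assume "maximal_UHF_subalgebra M A"
  then show "\<exists>N. maximal_UHF_subalgebra N B"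
    using maximal_UHF_subalgebra_image[OF assms] by blast
next
  fix N assume "maximal_UHF_subalgebra N B"
  then show "\<exists>M. maximal_UHF_subalgebra M A"
    using maximal_UHF_subalgebra_image[OF assms(2,1,4,3)] by blast
next
  fix M N assume M: "maximal_UHF_subalgebra M A" and N: "maximal_UHF_subalgebra N B"
  then have "UHF_subalgebra M A" "UHF_subalgebra N B"
    by (auto simp: maximal_UHF_subalgebra_def)
  then have UHF: "UHF_algebra (A\<lparr>carrier := M\<rparr>)" "UHF_algebra (B\<lparr>carrier := N\<rparr>)"
    by (auto simp: UHF_subalgebra_def)
  obtain \<alpha> where \<alpha>: "unital_star_hom (A\<lparr>carrier := M\<rparr>) (B\<lparr>carrier := N\<rparr>) \<alpha>"
    using maximal_UHF_subalgebra_hom[OF assms(1-3) \<open>UHF_subalgebra M A\<close> N] .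
  obtain \<beta> where \<beta>: "unital_star_hom (B\<lparr>carrier := N\<rparr>) (A\<lparr>carrier := M\<rparr>) \<beta>"
    using maximal_UHF_subalgebra_hom[OF assms(2,1,4) \<open>UHF_subalgebra N B\<close> M] .
  show "cstar_isomorphic (A\<lparr>carrier := M\<rparr>) (B\<lparr>carrier := N\<rparr>)"
    by (rule UHF_algebras_isomorphic[OF UHF \<alpha> \<beta>])
qed

end
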